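(* Let $\mathbb{F}\in\{\mathbb{R},\mathbb{C}\}$, let $\boldsymbol x_0\in\mathbb{F}^n$ be a fixed vector, and let $\boldsymbol A\in\mathbb{F}^{m\times n}$ be a standard Gaussian random matrix. There are universal positive constants $C,\widetilde c_1,\widetilde c_2,\widetilde c_3,C'$ such that for every integer $k\in\{1,\dots,n\}$ with $Ck\log(en/k)\le m$, with probability at least \[ 1-\widetilde c_3\exp(-\widetilde c_2m)-\exp(-\sqrt{mn})-2m\exp\!\Big(-\frac{\widetilde c_1m}{\log(en/m)}\Big), \] every $\boldsymbol x^\#\in\Delta_1(|\boldsymbol A\boldsymbol x_0|)$ satisfies $\mathrm{dist}(\boldsymbol x^\#,\boldsymbol x_0)\le C'\,\sigma_k(\boldsymbol x_0)_2$.
   Context: A standard Gaussian random matrix $\boldsymbol A\in\mathbb{F}^{m\times n}$ has i.i.d. entries $\mathcal N(0,1)$ if $\mathbb F=\mathbb R$, and $\mathcal N(0,1/2)+\mathrm i\,\mathcal N(0,1/2)$ if $\mathbb F=\mathbb C$. $|\boldsymbol u|$ is the entrywise modulus. $\mathrm{dist}(\boldsymbol x,\boldsymbol y)=\min_{c\in\mathbb F,|c|=1}\|\boldsymbol x-c\boldsymbol y\|_2$. $\Sigma_k=\{\boldsymbol z:\|\boldsymbol z\|_0\le k\}$, $\sigma_k(\boldsymbol x)_2=\min_{\boldsymbol z\in\Sigma_k}\mathrm{dist}(\boldsymbol x,\boldsymbol z)$. $\Delta_1(|\boldsymbol A\boldsymbol x|)=\operatorname{argmin}_{\boldsymbol z\in\mathbb{F}^n}\{\|\boldsymbol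 z\|_1:|\boldsymbol A\boldsymbol z|=|\boldsymbol A\boldsymbol x|\}$. *)

theory Defs
  imports "HOL-Probability.Probability"
begin

text \<open>Vectors in F^n are functions nat => F vanishing outside {..<n};
  m x n matrices are functions nat \<times> nat => F (entries indexed by {..<m} \<times> {..<n}).\<close>

definition vecs :: "nat \<Rightarrow> (nat \<Rightarrow> 'a::zero) set" where
  "vecs n = {z. \<forall>j\<ge>n. z j = 0}"

definition matvec :: "nat \<Rightarrow> (nat \<times> nat \<Rightarrow> 'a::comm_semiring_0) \<Rightarrow> (nat \<Rightarrow> 'a) \<Rightarrow> nat \<Rightarrow> 'a" where
  "matvec n A z i = (\<Sum>j<n. A (i, j) * z j)"

definition l1norm :: "nat \<Rightarrow> (nat \<Rightarrow> 'a::real_normed_vector) \<Rightarrow> real" where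
  "l1norm n z = (\<Sum>j<n. norm (z j))"

definition l2norm :: "nat \<Rightarrow> (nat \<Rightarrow> 'a::real_normed_vector) \<Rightarrow> real" where
  "l2norm n z = sqrt (\<Sum>j<n. (norm (z j))\<^sup>2)"

definition pdist :: "nat \<Rightarrow> (nat \<Rightarrow> 'a::real_normed_field) \<Rightarrow> (nat \<Rightarrow> 'a) \<Rightarrow> real" where
  "pdist n x y = Inf {l2norm n (\<lambda>j. x j - c * y j) | c. norm c = 1}"

definition sigma_k :: "nat \<Rightarrow> nat \<Rightarrow> (nat \<Rightarrow> 'a::real_normed_field) \<Rightarrow> real" where
  "sigma_k n k x = Inf {pdist n x z | z. z \<in> vecs n \<and> card {j. z j \<noteq> 0} \<le> k}"

definition Delta1 :: "nat \<Rightarrow> nat \<Rightarrow> (nat \<times> nat \<Rightarrow> 'a::real_normed_field) \<Rightarrow> (nat \<Rightarrow> real) \<Rightarrow> (nat \<Rightarrow> 'a) set" where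
  "Delta1 m n A y = {x \<in> vecs n. (\<forall>i<m. norm (matvec n A x i) = y i) \<and>
      (\<forall>z\<in>vecs n. (\<forall>i<m. norm (matvec n A z i) = y i) \<longrightarrow> l1norm n x \<le> l1norm n z)}"

definition real_gauss :: "real measure" where
  "real_gauss = density lborel (normal_density 0 1)"

definition complex_gauss :: "complex measure" where
  "complex_gauss = distr (density lborel (normal_density 0 (sqrt (1/2)))
                            \<Otimes>\<^sub>M density lborel (normal_density 0 (sqrt (1/2))))
                         borel (\<lambda>(a, b). Complex a b)"

definition gauss_matrix :: "nat \<Rightarrow> nat \<Rightarrow> 'a measure \<Rightarrow> (nat \<times> nat \<Rightarrow> 'a) measure" where
  "gauss_matrix m n G = PiM ({..<m} \<times> {..<n}) (\<lambda>_. G)"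

definition recovery_whp :: "'a::real_normed_field measure \<Rightarrow> nat \<Rightarrow> nat \<Rightarrow> nat \<Rightarrow> (nat \<Rightarrow> 'a) \<Rightarrow> real \<Rightarrow> real \<Rightarrow> bool" where
  "recovery_whp G m n k x0 C' p =
    (\<exists>E \<in> sets (gauss_matrix m n G). measure (gauss_matrix m n G) E \<ge> p \<and>
       (\<forall>A\<in>E. \<forall>xs \<in> Delta1 m n A (\<lambda>i. norm (matvec n A x0 i)).
           pdist n xs x0 \<le> C' * sigma_k n k x0))"

end

theory Submission
  imports Defs
begin

text \<open>
  Write \<open>x\<^sub>0 = x\<^sub>S + v\<close> with \<open>S\<close> an optimal support of size \<open>k\<close>, so that \<open>\<parallel>v\<parallel>\<^sub>2 \<le> \<sigma>\<^sub>k(x\<^sub>0)\<^sub>2\<close>, and put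
  \<open>L = ln (e max(n, m) / m)\<close>. By the \<open>\<ell>\<^sub>1\<close>-quotient property of Gaussian matrices there is a vector \<open>u\<close> with
  \<open>A u = A v\<close>, \<open>\<parallel>u\<parallel>\<^sub>1 \<lesssim> (m / L)\<^sup>1\<^sup>/\<^sup>2 \<parallel>v\<parallel>\<^sub>2\<close> and \<open>\<parallel>u\<parallel>\<^sub>2 \<lesssim> \<parallel>v\<parallel>\<^sub>2\<close> (if \<open>n \<lesssim> m\<close> take \<open>u = v\<close>), so \<open>x\<^sub>0\<close> may be replaced
  by \<open>y = x\<^sub>S + u\<close>, which has the same measurements. Let \<open>x\<close> be a minimiser, with the phase of \<open>y\<close> aligned to it,
  and let \<open>h = x - y\<close>, \<open>g = x + y\<close>. Then \<open>Re ((A h)\<^sub>i * cnj ((A g)\<^sub>i)) = 0\<close> for all \<open>i\<close>. If \<open>\<parallel>h\<parallel>\<^sub>2\<close> were much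
  larger than \<open>\<parallel>v\<parallel>\<^sub>2\<close>, minimality would make \<open>h\<close> and \<open>g\<close> effectively sparse, and a net argument shows that with
  high probability \<open>\<Sum>\<^sub>i \<bar>Re ((A h)\<^sub>i * cnj ((A g)\<^sub>i))\<bar> \<gtrsim> m \<parallel>h\<parallel>\<^sub>2 \<parallel>g\<parallel>\<^sub>2\<close> for all aligned, effectively sparse pairs.

  The quotient property is obtained constructively: every \<open>e\<close> has correlation at least of order
  \<open>L\<^sup>1\<^sup>/\<^sup>2 \<parallel>e\<parallel>\<^sub>2\<close> with at least \<open>m\<close> columns, a signed sum of these columns reduces \<open>\<parallel>e\<parallel>\<^sub>2\<close> by a fixed factor, and iterating
  solves \<open>A u = e\<close> exactly. All exceptional events have probability at most \<open>exp (- c m)\<close>.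
\<close>

section \<open>Vectors, sparsity and operator bounds\<close>

text \<open>The decoder minimises an l1 norm but the guarantee is in l2: the tail \<open>v\<close>
  may have l1 norm of order \<open>sqrt n * \<sigma>\<close>, far above the multiple of
  \<open>sqrt t * \<sigma>\<close> that the cone argument tolerates. Only the measurements of
  \<open>v\<close> enter, so it can be traded for a vector with the same measurements. The second
  obstacle is a degeneracy. For X = (A h)_i and Y = (A g)_i over the complex numbers, the second
  moment of X \<bullet> Y is (H G - B^2) / 2 + 3 D^2 / 2, where H, G are the squared norms, B is the
  sum of the h_j \<bullet> (\<i> g_j) and D the sum of the h_j \<bullet> g_j. It vanishes for g =
  \<i> h; phase alignment forces B = 0. A lower tail needs only the transform E exp(- l |X \<bullet>
  Y|), which the second and fourth moments control although the products are heavy tailed. Sparsity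
  is measured by the ratio of l1 to l2 norm at a level \<open>t\<close> near m / (10^24 L). The nets
  are lattice points of l1 balls, so effectively sparse vectors are covered without any enumeration
  of supports. The huge constants make the net error, multiplied by \<open>M\<^sup>2\<close>, fall
  below the lower bound m / 10240.\<close>

lemma l2norm_eq_L2_set: "l2norm n z = L2_set (\<lambda>j. norm (z j)) {..<n}"
  by (simp add: l2norm_def L2_set_def)

lemma l2norm_nonneg [simp]: "0 \<le> l2norm n z"
  by (simp add: l2norm_eq_L2_set)

lemma l1norm_nonneg [simp]: "0 \<le> l1norm n z"
  by (simp add: l1norm_def sum_nonneg)

lemma l2norm_squared: "(l2norm n z)\<^sup>2 = (\<Sum>j<n. (norm (z j))\<^sup>2)"
  by (simp add: l2norm_def sum_nonneg)

lemma l2norm_triangle: "l2norm n (\<lambda>j. x j + y j) \<le> l2norm n x + l2norm n y"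
proof -
  have "L2_set (\<lambda>j. norm (x j + y j)) {..<n} \<le> L2_set (\<lambda>j. norm (x j) + norm (y j)) {..<n}"
    by (intro L2_set_mono) (auto intro: norm_triangle_ineq)
  also have "\<dots> \<le> l2norm n x + l2norm n y"
    unfolding l2norm_eq_L2_set by (rule L2_set_triangle_ineq)
  finally show ?thesis by (simp add: l2norm_eq_L2_set)
qed

lemma l2norm_triangle_diff: "l2norm n (\<lambda>j. x j - y j) \<le> l2norm n x + l2norm n y"
  using l2norm_triangle[of n x "\<lambda>j. - y j"] by (simp add: l2norm_def)

lemma l2norm_mono: "(\<And>j. j < n \<Longrightarrow> norm (x j) \<le> norm (y j)) \<Longrightarrow> l2norm n x \<le> l2norm n y"
  unfolding l2norm_eq_L2_set by (intro L2_set_mono) auto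

lemma l1norm_mono: "(\<And>j. j < n \<Longrightarrow> norm (x j) \<le> norm (y j)) \<Longrightarrow> l1norm n x \<le> l1norm n y"
  unfolding l1norm_def by (intro sum_mono) auto

lemma l2norm_scaleR: "l2norm n (\<lambda>j. c *\<^sub>R x j) = \<bar>c\<bar> * l2norm n x"
  unfolding l2norm_eq_L2_set by (simp add: L2_set_right_distrib)

lemma l1norm_scaleR: "l1norm n (\<lambda>j. c *\<^sub>R x j) = \<bar>c\<bar> * l1norm n x"
  unfolding l1norm_def by (simp add: sum_distrib_left)

lemma l2norm_mult: "l2norm n (\<lambda>j. c * x j) = norm c * l2norm n x"
  for c :: "'a::real_normed_field"
  unfolding l2norm_eq_L2_set by (simp add: L2_set_right_distrib norm_mult)

lemma l1norm_mult: "l1norm n (\<lambda>j. c * x j) = norm c * l1norm n x"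
  for c :: "'a::real_normed_field"
  unfolding l1norm_def by (simp add: sum_distrib_left norm_mult)

lemma l1norm_triangle: "l1norm n (\<lambda>j. x j + y j) \<le> l1norm n x + l1norm n y"
  unfolding l1norm_def sum.distrib[symmetric] by (intro sum_mono norm_triangle_ineq)

lemma l2norm_eq_0: "l2norm n x = 0 \<longleftrightarrow> (\<forall>j<n. x j = 0)"
  unfolding l2norm_eq_L2_set by (subst L2_set_eq_0_iff) auto

lemma norm_le_l2norm: "j < n \<Longrightarrow> norm (x j) \<le> l2norm n x"
  unfolding l2norm_eq_L2_set by (rule member_le_L2_set) auto

lemma l2norm_le_l1norm: "l2norm n x \<le> l1norm n x"
  unfolding l2norm_eq_L2_set l1norm_def by (rule L2_set_le_sum) auto

lemma l2norm_cong: "(\<And>j. j < n \<Longrightarrow> x j = y j) \<Longrightarrow> l2norm n x = l2norm n y"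
  by (simp add: l2norm_def)

lemma sum_norm_le_sqrt_card:
  assumes "S \<subseteq> {..<n}"
  shows "(\<Sum>j\<in>S. norm (z j)) \<le> sqrt (card S) * l2norm n z"
proof -
  have "(\<Sum>j\<in>S. \<bar>1\<bar> * \<bar>norm (z j)\<bar>) \<le> L2_set (\<lambda>_. 1) S * L2_set (\<lambda>j. norm (z j)) S"
    by (rule L2_set_mult_ineq)
  also have "L2_set (\<lambda>_. 1::real) S = sqrt (card S)" by (simp add: L2_set_constant)
  also have "L2_set (\<lambda>j. norm (z j)) S \<le> l2norm n z"
    unfolding l2norm_def L2_set_def using assms by (intro real_sqrt_le_mono sum_mono2) auto
  finally show ?thesis by (auto simp: mult_left_mono)
qed

section \<open>Sparse vectors and restriction to a support\<close>

definition sparse :: "nat \<Rightarrow> nat \<Rightarrow> (nat \<Rightarrow> 'a::zero) set" where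
  "sparse n s = {z \<in> vecs n. card {j. z j \<noteq> 0} \<le> s}"

lemma vecs_support: "z \<in> vecs n \<Longrightarrow> {j. z j \<noteq> 0} \<subseteq> {..<n}"
  by (force simp: vecs_def not_le[symmetric])

lemma finite_support [simp]: "z \<in> vecs n \<Longrightarrow> finite {j. z j \<noteq> 0}"
  using vecs_support finite_subset by blast

lemma l1norm_support:
  assumes "z \<in> vecs n" shows "l1norm n z = (\<Sum>j | z j \<noteq> 0. norm (z j))"
  unfolding l1norm_def using assms
  by (intro sum.mono_neutral_right) (auto dest: vecs_support)

lemma l1norm_sparse:
  assumes "z \<in> sparse n s" shows "l1norm n z \<le> sqrt s * l2norm n z"
proof -
  have "l1norm n z \<le> sqrt (card {j. z j \<noteq> 0}) * l2norm n z"
    using assms sum_norm_le_sqrt_card[of "{j. z j \<noteq> 0}" n z]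
    by (auto simp: l1norm_support sparse_def dest: vecs_support)
  also have "\<dots> \<le> sqrt s * l2norm n z"
    using assms by (intro mult_right_mono) (auto simp: sparse_def)
  finally show ?thesis .
qed

lemma l1norm_le_sqrt: "l1norm n z \<le> sqrt n * l2norm n z"
  using sum_norm_le_sqrt_card[of "{..<n}" n z] by (simp add: l1norm_def)

lemma matvec_add: "matvec n A (\<lambda>j. x j + y j) i = matvec n A x i + matvec n A y i"
  by (simp add: matvec_def algebra_simps sum.distrib)

lemma matvec_diff: "matvec n A (\<lambda>j. x j - y j) i = matvec n A x i - matvec n A y i"
  for A :: "_ \<Rightarrow> 'a::comm_ring"
  by (simp add: matvec_def algebra_simps sum_subtractf)

lemma matvec_mult: "matvec n A (\<lambda>j. c * x j) i = c * matvec n A x i"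
  by (simp add: matvec_def sum_distrib_left ac_simps)

lemma matvec_scaleR: "matvec n A (\<lambda>j. c *\<^sub>R x j) i = c *\<^sub>R matvec n A x i"
  for A :: "_ \<Rightarrow> 'a::real_normed_field"
  by (simp add: matvec_def scaleR_sum_right)

section \<open>Blocks of largest entries and operator bounds beyond sparse vectors\<close>

lemma ex_top_subset:
  fixes f :: "'b \<Rightarrow> real"
  assumes "finite P" "t \<le> card P"
  shows "\<exists>T\<subseteq>P. card T = t \<and> (\<forall>j\<in>T. \<forall>l\<in>P - T. f l \<le> f j)"
  using assms(2)
proof (induction t)
  case 0 show ?case by (intro exI[of _ "{}"]) auto
next
  case (Suc t)
  then obtain T where T: "T \<subseteq> P" "card T = t" "\<forall>j\<in>T. \<forall>l\<in>P - T. f l \<le> f j" by auto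
  have fin: "finite T" "finite (P - T)" using T(1) assms(1) finite_subset by auto
  have "P - T \<noteq> {}" using Suc.prems T fin card_mono[of T P] by auto
  then obtain a where a: "a \<in> P - T" "\<And>l. l \<in> P - T \<Longrightarrow> f l \<le> f a"
  proof -
    have "Max (f ` (P - T)) \<in> f ` (P - T)" using fin(2) \<open>P - T \<noteq> {}\<close> by (intro Max_in) auto
    then show ?thesis using that fin(2) by (metis Max_ge finite_imageI imageE image_eqI)
  qed
  show ?case
    by (rule exI[of _ "insert a T"]) (use T a fin in auto)
qed

definition restr :: "nat set \<Rightarrow> (nat \<Rightarrow> 'a::zero) \<Rightarrow> nat \<Rightarrow> 'a" where
  "restr S z j = (if j \<in> S then z j else 0)"

lemma restr_vecs: "z \<in> vecs n \<Longrightarrow> restr S z \<in> vecs n"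
  by (auto simp: vecs_def restr_def)

lemma restr_split: "(\<lambda>j. restr S z j + restr (- S) z j) = z"
  for z :: "nat \<Rightarrow> 'a::monoid_add"
  by (auto simp: restr_def)

lemma restr_sparse:
  assumes "z \<in> vecs n" "finite S" "card S \<le> s" shows "restr S z \<in> sparse n s"
proof -
  have "card {j. restr S z j \<noteq> 0} \<le> card S"
    using assms by (intro card_mono) (auto simp: restr_def)
  then show ?thesis using assms by (simp add: sparse_def restr_vecs)
qed

lemma l2norm_restr_le: "l2norm n (restr S z) \<le> l2norm n z"
  by (rule l2norm_mono) (auto simp: restr_def)

lemma l1norm_restr_split: "l1norm n z = l1norm n (restr S z) + l1norm n (restr (- S) z)"
  unfolding l1norm_def sum.distrib[symmetric] by (intro sum.cong) (auto simp: restr_def)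

text \<open>With \<open>T\<close> the \<open>t\<close> largest entries, whatever lies outside is at
  most their minimum, hence at most their mean.\<close>

lemma exists_dominating_block:
  fixes z :: "nat \<Rightarrow> 'a::real_normed_vector"
  assumes z: "z \<in> vecs n" and t: "1 \<le> t" "t \<le> card {j. z j \<noteq> 0}"
  obtains T where "T \<subseteq> {j. z j \<noteq> 0}" "finite T" "card T = t"
    "\<forall>l. norm (restr (- T) z l) \<le> l1norm n (restr T z) / t"
proof -
  define P where "P = {j. z j \<noteq> 0}"
  have finP: "finite P" using z by (simp add: P_def)
  obtain T where T: "T \<subseteq> P" "card T = t" "\<forall>j\<in>T. \<forall>l\<in>P - T. norm (z l) \<le> norm (z j)"
    using ex_top_subset[OF finP t(2)[folded P_def], of "\<lambda>j. norm (z j)"] by blast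
  have finT: "finite T" by (rule finite_subset[OF T(1) finP])
  have Tn: "T \<subseteq> {..<n}" using T vecs_support[OF z] by (auto simp: P_def)
  have l1T: "l1norm n (restr T z) = (\<Sum>j\<in>T. norm (z j))"
    unfolding l1norm_def restr_def using Tn
    by (intro sum.mono_neutral_cong_right) auto
  have dom: "norm (restr (- T) z l) \<le> l1norm n (restr T z) / t" for l
  proof (cases "l \<in> P - T")
    case True
    have "t * norm (z l) = (\<Sum>j\<in>T. norm (z l))" using T by simp
    also have "\<dots> \<le> (\<Sum>j\<in>T. norm (z j))" using T True by (intro sum_mono) auto
    finally show ?thesis
      using t(1) True by (simp add: l1T restr_def field_simps)
  next
    case False
    then have "restr (- T) z l = 0" by (auto simp: restr_def P_def)
    then show ?thesis by simp
  qed
  show ?thesis by (rule that[OF T(1)[unfolded P_def] finT T(2) allI[OF dom]])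
qed

text \<open>Induction on the support size, peeling off the \<open>t\<close> largest entries. A block
  costs \<open>sqrt t\<close> times its sup norm, and that sup norm is at most 1/t times the l1 norm
  of the preceding block. Only the first block is charged to \<open>b\<close>; the others telescope
  into the l1 norm.\<close>

lemma matvec_bound_bounded_entries:
  fixes A :: "nat \<times> nat \<Rightarrow> 'a::real_normed_field"
  assumes M: "\<And>z. z \<in> sparse n t \<Longrightarrow> l2norm m (matvec n A z) \<le> M * l2norm n z"
    and "M \<ge> 0" "t \<ge> 1"
  shows "z \<in> vecs n \<Longrightarrow> (\<And>j. norm (z j) \<le> b) \<Longrightarrow>
    l2norm m (matvec n A z) \<le> M * (sqrt t * b + l1norm n z / sqrt t)"
proof (induction "card {j. z j \<noteq> 0}" arbitrary: z b rule: less_induct)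
  case less
  have b0: "b \<ge> 0" by (rule order_trans[OF norm_ge_zero less.prems(2)[of 0]])
  have sp: "l2norm n w \<le> sqrt t * b" if "w \<in> sparse n t" "\<And>j. norm (w j) \<le> b" for w :: "nat \<Rightarrow> 'a"
  proof -
    have w: "w \<in> vecs n" "card {j. w j \<noteq> 0} \<le> t" using that by (auto simp: sparse_def)
    have "(l2norm n w)\<^sup>2 = (\<Sum>j | w j \<noteq> 0. (norm (w j))\<^sup>2)"
      unfolding l2norm_squared using w
      by (intro sum.mono_neutral_right) (auto dest: vecs_support)
    also have "\<dots> \<le> (\<Sum>j | w j \<noteq> 0. b\<^sup>2)"
      using that(2) by (intro sum_mono power_mono) auto
    also have "\<dots> \<le> t * b\<^sup>2" using w by (simp add: mult_right_mono)
    also have "\<dots> = (sqrt t * b)\<^sup>2" by (simp add: power_mult_distrib)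
    finally show ?thesis
      using b0 by (rule power2_le_imp_le[OF _ mult_nonneg_nonneg[OF real_sqrt_ge_zero[OF of_nat_0_le_iff]]])
  qed
  show ?case
  proof (cases "card {j. z j \<noteq> 0} \<le> t")
    case True
    then have zs: "z \<in> sparse n t" using less.prems(1) by (simp add: sparse_def)
    have "l2norm m (matvec n A z) \<le> M * l2norm n z" by (rule M[OF zs])
    also have "\<dots> \<le> M * (sqrt t * b)" by (rule mult_left_mono[OF sp[OF zs less.prems(2)] assms(2)])
    also have "\<dots> \<le> M * (sqrt t * b + l1norm n z / sqrt t)"
      using assms(2) by (intro mult_left_mono) auto
    finally show ?thesis .
  next
    case False
    define P where "P = {j. z j \<noteq> 0}"
    have tP: "t \<le> card {j. z j \<noteq> 0}" using False by simp
    obtain T where T: "T \<subseteq> P" "finite T" "card T = t"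
        "\<forall>l. norm (restr (- T) z l) \<le> l1norm n (restr T z) / t"
      unfolding P_def by (rule exists_dominating_block[OF less.prems(1) \<open>1 \<le> t\<close> tP])
    define b' where "b' = l1norm n (restr T z) / t"
    have rest: "norm (restr (- T) z l) \<le> b'" for l unfolding b'_def by (rule T(4)[rule_format])
    have "{j. restr (- T) z j \<noteq> 0} = P - T" by (auto simp: restr_def P_def)
    then have "card {j. restr (- T) z j \<noteq> 0} = card P - t"
      using T(1-3) by (simp add: card_Diff_subset)
    moreover have "t < card P" using False by (simp add: P_def)
    ultimately have "card {j. restr (- T) z j \<noteq> 0} < card P"
      using \<open>t \<ge> 1\<close> by linarith
    then have IH: "l2norm m (matvec n A (restr (- T) z)) \<le> M * (sqrt t * b' + l1norm n (restr (- T) z) / sqrt t)"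
      using less.hyps[OF _ restr_vecs[OF less.prems(1)] rest] by (simp add: P_def)
    have zT: "restr T z \<in> sparse n t" using less.prems(1) T(2,3) by (intro restr_sparse) auto
    have "l2norm m (matvec n A (restr T z)) \<le> M * l2norm n (restr T z)" by (rule M[OF zT])
    also have "\<dots> \<le> M * (sqrt t * b)"
      using less.prems(2) b0 by (intro mult_left_mono sp zT assms(2)) (auto simp: restr_def)
    finally have 1: "l2norm m (matvec n A (restr T z)) \<le> M * (sqrt t * b)" .
    have "l2norm m (matvec n A z) = l2norm m (\<lambda>i. matvec n A (restr T z) i + matvec n A (restr (- T) z) i)"
      by (subst matvec_add[symmetric]) (simp add: restr_split)
    also have "\<dots> \<le> l2norm m (matvec n A (restr T z)) + l2norm m (matvec n A (restr (- T) z))"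
      by (rule l2norm_triangle)
    also have "\<dots> \<le> M * (sqrt t * b) + M * (sqrt t * b' + l1norm n (restr (- T) z) / sqrt t)"
      using 1 IH by simp
    \<comment> \<open>The leading term of the remainder is paid by the l1 norm of the block just
      removed.\<close>
    also have "sqrt t * b' = l1norm n (restr T z) / sqrt t"
      using \<open>t \<ge> 1\<close> by (simp add: b'_def field_simps)
    also have "M * (sqrt t * b) + M * (l1norm n (restr T z) / sqrt t + l1norm n (restr (- T) z) / sqrt t) =
        M * (sqrt t * b + l1norm n z / sqrt t)"
      by (subst l1norm_restr_split[of n z T]) (simp add: algebra_simps add_divide_distrib)
    finally show ?thesis .
  qed
qed

text \<open>The same peeling with the first block charged to the l2 norm. A vector whose l1 norm is
  at most \<open>sqrt t\<close> times its l2 norm thus loses only a factor 2 against a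
  \<open>t\<close>-sparse one.\<close>

lemma matvec_bound_of_sparse_bound:
  fixes A :: "nat \<times> nat \<Rightarrow> 'a::real_normed_field"
  assumes M: "\<And>z. z \<in> sparse n t \<Longrightarrow> l2norm m (matvec n A z) \<le> M * l2norm n z"
    and "M \<ge> 0" "t \<ge> 1" and z: "z \<in> vecs n"
  shows "l2norm m (matvec n A z) \<le> M * (l2norm n z + l1norm n z / sqrt t)"
proof (cases "card {j. z j \<noteq> 0} \<le> t")
  case True
  have "l2norm m (matvec n A z) \<le> M * l2norm n z" using True z by (intro M) (simp add: sparse_def)
  also have "\<dots> \<le> M * (l2norm n z + l1norm n z / sqrt t)"
    using assms(2) by (intro mult_left_mono) auto
  finally show ?thesis .
next
  case False
  have tP: "t \<le> card {j. z j \<noteq> 0}" using False by simp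
  obtain T where T: "T \<subseteq> {j. z j \<noteq> 0}" "finite T" "card T = t"
      "\<forall>l. norm (restr (- T) z l) \<le> l1norm n (restr T z) / t"
    by (rule exists_dominating_block[OF z \<open>1 \<le> t\<close> tP])
  define b' where "b' = l1norm n (restr T z) / t"
  have rest: "norm (restr (- T) z l) \<le> b'" for l unfolding b'_def by (rule T(4)[rule_format])
  have zT: "restr T z \<in> sparse n t" using z T(2,3) by (intro restr_sparse) auto
  have 1: "l2norm m (matvec n A (restr T z)) \<le> M * l2norm n z"
    using M[OF zT] mult_left_mono[OF l2norm_restr_le assms(2), of n T z] by linarith
  have 2: "l2norm m (matvec n A (restr (- T) z)) \<le> M * (sqrt t * b' + l1norm n (restr (- T) z) / sqrt t)"
    by (rule matvec_bound_bounded_entries[OF M assms(2,3) restr_vecs[OF z] rest])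
  have "l2norm m (matvec n A z) = l2norm m (\<lambda>i. matvec n A (restr T z) i + matvec n A (restr (- T) z) i)"
    by (subst matvec_add[symmetric]) (simp add: restr_split)
  also have "\<dots> \<le> l2norm m (matvec n A (restr T z)) + l2norm m (matvec n A (restr (- T) z))"
    by (rule l2norm_triangle)
  also have "\<dots> \<le> M * l2norm n z + M * (sqrt t * b' + l1norm n (restr (- T) z) / sqrt t)"
    using 1 2 by simp
  also have "sqrt t * b' = l1norm n (restr T z) / sqrt t"
    using \<open>t \<ge> 1\<close> by (simp add: b'_def field_simps)
  also have "M * l2norm n z + M * (l1norm n (restr T z) / sqrt t + l1norm n (restr (- T) z) / sqrt t) =
      M * (l2norm n z + l1norm n z / sqrt t)"
    by (subst l1norm_restr_split[of n z T]) (simp add: algebra_simps add_divide_distrib)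
  finally show ?thesis .
qed

section \<open>Lattice nets\<close>

text \<open>Rounding towards zero: it never enlarges a coordinate and fixes zero, so rounding a
  vector neither increases its norms nor extends its support.\<close>

definition trunc_int :: "real \<Rightarrow> int" where
  "trunc_int y = (if 0 \<le> y then \<lfloor>y\<rfloor> else \<lceil>y\<rceil>)"

lemma trunc_int_bounds:
  "\<bar>real_of_int (trunc_int y)\<bar> \<le> \<bar>y\<bar>" "\<bar>y - real_of_int (trunc_int y)\<bar> \<le> 1"
  "\<bar>y - real_of_int (trunc_int y)\<bar> \<le> \<bar>y\<bar>"
proof -
  have "0 \<le> \<lfloor>y\<rfloor>" if "0 \<le> y" using that by simp
  moreover have "\<lceil>y\<rceil> \<le> 0" if "y < 0" using that by (simp add: ceiling_le_iff)
  moreover have "real_of_int \<lfloor>y\<rfloor> \<le> y" "y \<le> real_of_int \<lfloor>y\<rfloor> + 1" by linarith+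
  moreover have "y \<le> real_of_int \<lceil>y\<rceil>" "real_of_int \<lceil>y\<rceil> \<le> y + 1" by linarith+
  ultimately show
    "\<bar>real_of_int (trunc_int y)\<bar> \<le> \<bar>y\<bar>" "\<bar>y - real_of_int (trunc_int y)\<bar> \<le> 1"
    "\<bar>y - real_of_int (trunc_int y)\<bar> \<le> \<bar>y\<bar>"
    unfolding trunc_int_def by (cases "0 \<le> y"; simp add: abs_if; linarith)+
qed

definition lattice_point :: "nat \<Rightarrow> real \<Rightarrow> (nat \<times> 'a \<Rightarrow> int) \<Rightarrow> nat \<Rightarrow> 'a::euclidean_space" where
  "lattice_point n \<delta> \<kappa> j = (if j < n then \<Sum>b\<in>Basis. (\<delta> * real_of_int (\<kappa> (j, b))) *\<^sub>R b else 0)"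

text \<open>A scaled integer l1 ball, in real coordinates. The box makes it the image of a subset of
  a finite \<open>PiE\<close>, over which sums of products factor.\<close>

definition lattice_net :: "nat \<Rightarrow> real \<Rightarrow> nat \<Rightarrow> (nat \<Rightarrow> 'a::euclidean_space) set" where
  "lattice_net n \<delta> T = lattice_point n \<delta> `
     {\<kappa> \<in> PiE ({..<n} \<times> Basis) (\<lambda>_. {- int T..int T}). (\<Sum>p\<in>{..<n} \<times> Basis. \<bar>\<kappa> p\<bar>) \<le> int T}"

lemma finite_lattice_net [simp]: "finite (lattice_net n \<delta> T)"
  unfolding lattice_net_def
  by (intro finite_imageI finite_subset[OF _ finite_PiE[of "{..<n} \<times> Basis" "\<lambda>_. {- int T..int T}"]]) auto

lemma lattice_net_vecs: "w \<in> lattice_net n \<delta> T \<Longrightarrow> w \<in> vecs n"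
  by (auto simp: lattice_net_def lattice_point_def vecs_def)

text \<open>The term at 0 contributes 1, and each of the two geometric tails at most 2 q.\<close>

lemma sum_power_abs_le:
  fixes q :: real
  assumes "0 < q" "q \<le> 1/2"
  shows "(\<Sum>k\<in>{- int T..int T}. q ^ nat \<bar>k\<bar>) \<le> exp (4 * q)"
proof -
  have geo: "(\<Sum>i=1..T. q ^ i) \<le> 2 * q"
  proof -
    have "(\<Sum>i=1..T. q ^ i) = q * (\<Sum>i<T. q ^ i)"
      by (induction T) (auto simp: algebra_simps)
    also have "(\<Sum>i<T. q ^ i) \<le> (\<Sum>i. q ^ i)"
      using assms by (intro sum_le_suminf summable_geometric) auto
    also have "(\<Sum>i. q ^ i) = 1 / (1 - q)" using assms by (intro suminf_geometric) auto
    also have "\<dots> \<le> 2" using assms by (simp add: field_simps)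
    finally show ?thesis using assms by simp
  qed
  have split: "{- int T..int T} = (\<lambda>i. - int i) ` {1..T} \<union> ({0} \<union> int ` {1..T})"
  proof (intro equalityI subsetI)
    fix k assume k: "k \<in> {- int T..int T}"
    consider "k < 0" | "k = 0" | "k > 0" by linarith
    then show "k \<in> (\<lambda>i. - int i) ` {1..T} \<union> ({0} \<union> int ` {1..T})"
    proof cases
      case 1
      then have "k = - int (nat (- k))" "nat (- k) \<in> {1..T}" using k by auto
      then show ?thesis by blast
    next
      case 3
      then have "k = int (nat k)" "nat k \<in> {1..T}" using k by auto
      then show ?thesis by blast
    qed auto
  qed auto
  have "(\<Sum>k\<in>{- int T..int T}. q ^ nat \<bar>k\<bar>) =
     (\<Sum>k\<in>(\<lambda>i. - int i) ` {1..T}. q ^ nat \<bar>k\<bar>) + ((\<Sum>k\<in>{0}. q ^ nat \<bar>k\<bar>) + (\<Sum>k\<in>int ` {1..T}. q ^ nat \<bar>k\<bar>))"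
    unfolding split by (subst sum.union_disjoint; force?)+
  also have "(\<Sum>k\<in>(\<lambda>i. - int i) ` {1..T}. q ^ nat \<bar>k\<bar>) = (\<Sum>i=1..T. q ^ i)"
    by (subst sum.reindex) (auto simp: inj_on_def)
  also have "(\<Sum>k\<in>int ` {1..T}. q ^ nat \<bar>k\<bar>) = (\<Sum>i=1..T. q ^ i)"
    by (subst sum.reindex) (auto simp: inj_on_def)
  finally have "(\<Sum>k\<in>{- int T..int T}. q ^ nat \<bar>k\<bar>) \<le> 1 + 4 * q" using geo by simp
  also have "\<dots> \<le> exp (4 * q)" by (rule exp_ge_add_one_self)
  finally show ?thesis .
qed

text \<open>Generating-function count: weighting an integer point \<open>\<kappa>\<close> by \<open>q\<close> to the power of its
  \<open>\<ell>\<^sub>1\<close>-norm makes the sum over all points a product over coordinates.\<close>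

lemma card_lattice_net:
  fixes q :: real
  assumes q: "0 < q" "q \<le> 1/2"
  shows "real (card (lattice_net n \<delta> T :: (nat \<Rightarrow> 'a::euclidean_space) set)) \<le>
    exp (4 * q * (real n * DIM('a))) * (1 / q) ^ T"
proof -
  let ?P = "{..<n} \<times> (Basis :: 'a set)"
  let ?B = "\<lambda>_. {- int T..int T}"
  let ?K = "{\<kappa> \<in> PiE ?P ?B. (\<Sum>p\<in>?P. \<bar>\<kappa> p\<bar>) \<le> int T}"
  have finB: "finite (PiE ?P ?B)" by (intro finite_PiE) auto
  then have finK: "finite ?K" by (rule rev_finite_subset) auto
  have "real (card (lattice_net n \<delta> T :: (nat \<Rightarrow> 'a) set)) \<le> real (card ?K)"
    unfolding lattice_net_def using card_image_le[OF finK] by simp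
  also have "\<dots> = (\<Sum>\<kappa>\<in>?K. 1)" by simp
  also have "\<dots> \<le> (\<Sum>\<kappa>\<in>?K. (\<Prod>p\<in>?P. q ^ nat \<bar>\<kappa> p\<bar>) * (1 / q) ^ T)"
  proof (intro sum_mono)
    fix \<kappa> assume \<kappa>: "\<kappa> \<in> ?K"
    have "int (\<Sum>p\<in>?P. nat \<bar>\<kappa> p\<bar>) \<le> int T" using \<kappa> by simp
    then have le: "(\<Sum>p\<in>?P. nat \<bar>\<kappa> p\<bar>) \<le> T" by linarith
    have "q ^ T \<le> q ^ (\<Sum>p\<in>?P. nat \<bar>\<kappa> p\<bar>)"
      using le q by (intro power_decreasing) auto
    also have "\<dots> = (\<Prod>p\<in>?P. q ^ nat \<bar>\<kappa> p\<bar>)" by (simp add: power_sum)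
    finally have "q ^ T * (1 / q) ^ T \<le> (\<Prod>p\<in>?P. q ^ nat \<bar>\<kappa> p\<bar>) * (1 / q) ^ T"
      using q by (intro mult_right_mono) auto
    then show "1 \<le> (\<Prod>p\<in>?P. q ^ nat \<bar>\<kappa> p\<bar>) * (1 / q) ^ T"
      using q by (simp add: power_one_over)
  qed
  also have "\<dots> \<le> (\<Sum>\<kappa>\<in>PiE ?P ?B. (\<Prod>p\<in>?P. q ^ nat \<bar>\<kappa> p\<bar>) * (1 / q) ^ T)"
    using q finB by (intro sum_mono2) (auto intro!: mult_nonneg_nonneg prod_nonneg)
  also have "\<dots> = (\<Sum>\<kappa>\<in>PiE ?P ?B. (\<Prod>p\<in>?P. q ^ nat \<bar>\<kappa> p\<bar>)) * (1 / q) ^ T"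
    by (simp add: sum_distrib_right)
  also have "(\<Sum>\<kappa>\<in>PiE ?P ?B. (\<Prod>p\<in>?P. q ^ nat \<bar>\<kappa> p\<bar>)) = (\<Prod>p\<in>?P. \<Sum>k\<in>{- int T..int T}. q ^ nat \<bar>k\<bar>)"
    by (subst prod_sum_PiE) auto
  also have "\<dots> \<le> (\<Prod>p\<in>?P. exp (4 * q))"
    using q by (intro prod_mono conjI sum_power_abs_le sum_nonneg) auto
  also have "\<dots> = exp (4 * q * (real n * DIM('a)))"
    by (simp add: card_cartesian_product exp_of_nat_mult[symmetric] mult_ac)
  finally show ?thesis using q by (simp add: mult_right_mono)
qed

text \<open>Every real coordinate is rounded towards zero. The factors 2 come from the at most two
  real coordinates per entry. Of the three pointwise bounds, the first two can be multiplied to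
  bound the squared l2 error by the l1 norm, and the last keeps the net point in every ball that
  contains \<open>z\<close>.\<close>

lemma lattice_net_approx:
  fixes z :: "nat \<Rightarrow> 'a::euclidean_space"
  assumes z: "z \<in> vecs n" and \<delta>: "\<delta> > 0" and T: "2 * l1norm n z \<le> \<delta> * T" and dim: "DIM('a) \<le> 2"
  obtains w where "w \<in> lattice_net n \<delta> T" "\<And>j. norm (z j - w j) \<le> 2 * \<delta>"
    "\<And>j. norm (z j - w j) \<le> norm (z j)" "\<And>j. norm (w j) \<le> norm (z j)"
proof -
  let ?P = "{..<n} \<times> (Basis :: 'a set)"
  define \<kappa> where "\<kappa> = restrict (\<lambda>(j, b). trunc_int (z j \<bullet> b / \<delta>)) ?P"
  define w where "w = lattice_point n \<delta> \<kappa>"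
  have \<kappa>: "\<kappa> (j, b) = trunc_int (z j \<bullet> b / \<delta>)" if "j < n" "b \<in> Basis" for j b
    using that by (simp add: \<kappa>_def)
  have wb: "w j \<bullet> b = \<delta> * real_of_int (trunc_int (z j \<bullet> b / \<delta>))" if "j < n" "b \<in> Basis" for j b
    using that by (simp add: w_def lattice_point_def \<kappa> inner_sum_left inner_Basis if_distrib sum.delta cong: if_cong)
  have dif: "\<bar>(z j - w j) \<bullet> b\<bar> = \<delta> * \<bar>z j \<bullet> b / \<delta> - real_of_int (trunc_int (z j \<bullet> b / \<delta>))\<bar>"
    if "j < n" "b \<in> Basis" for j b
  proof -
    have "(z j - w j) \<bullet> b = \<delta> * (z j \<bullet> b / \<delta> - real_of_int (trunc_int (z j \<bullet> b / \<delta>)))"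
      unfolding inner_diff_left wb[OF that] using \<delta> by (simp add: right_diff_distrib)
    then show ?thesis using \<delta> by (simp add: abs_mult)
  qed
  have absz: "\<bar>z j \<bullet> b\<bar> = \<delta> * \<bar>z j \<bullet> b / \<delta>\<bar>" for j b using \<delta> by simp
  have out: "z j = 0 \<and> w j = 0" if "\<not> j < n" for j
    using z that by (auto simp: vecs_def w_def lattice_point_def)
  have 1: "norm (z j - w j) \<le> norm (z j)" for j
  proof (cases "j < n")
    case True show ?thesis
    proof (rule norm_le_componentwise)
      fix b :: 'a assume b: "b \<in> Basis"
      show "\<bar>(z j - w j) \<bullet> b\<bar> \<le> \<bar>z j \<bullet> b\<bar>"
        unfolding dif[OF True b] absz[of j b] by (rule mult_left_mono[OF trunc_int_bounds(3) less_imp_le[OF \<delta>]])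
    qed
  qed (use out in auto)
  have 2: "norm (w j) \<le> norm (z j)" for j
  proof (cases "j < n")
    case True show ?thesis
    proof (rule norm_le_componentwise)
      fix b :: 'a assume b: "b \<in> Basis"
      show "\<bar>w j \<bullet> b\<bar> \<le> \<bar>z j \<bullet> b\<bar>"
        unfolding wb[OF True b] absz[of j b] abs_mult abs_of_pos[OF \<delta>]
        by (rule mult_left_mono[OF trunc_int_bounds(1) less_imp_le[OF \<delta>]])
    qed
  qed (use out in auto)
  have 3: "norm (z j - w j) \<le> 2 * \<delta>" for j
  proof (cases "j < n")
    case True
    have "norm (z j - w j) \<le> (\<Sum>b\<in>Basis. \<bar>(z j - w j) \<bullet> b\<bar>)" by (rule norm_le_l1)
    also have "\<dots> \<le> (\<Sum>b\<in>(Basis::'a set). \<delta>)"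
    proof (intro sum_mono)
      fix b :: 'a assume b: "b \<in> Basis"
      show "\<bar>(z j - w j) \<bullet> b\<bar> \<le> \<delta>"
        unfolding dif[OF True b] using \<delta> trunc_int_bounds(2)[of "z j \<bullet> b / \<delta>"] mult_left_mono[of _ 1 \<delta>] by auto
    qed
    also have "\<dots> \<le> 2 * \<delta>" using dim \<delta> by simp
    finally show ?thesis .
  qed (use out \<delta> in auto)
  have "real_of_int (\<Sum>p\<in>?P. \<bar>\<kappa> p\<bar>) = (\<Sum>j<n. \<Sum>b\<in>(Basis::'a set). \<bar>real_of_int (\<kappa> (j, b))\<bar>)"
    by (simp add: sum.cartesian_product)
  also have "\<dots> \<le> (\<Sum>j<n. \<Sum>b\<in>(Basis::'a set). norm (z j) / \<delta>)"
  proof (intro sum_mono)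
    fix j and b :: 'a assume "j \<in> {..<n}" and b: "b \<in> Basis"
    then have "\<bar>real_of_int (\<kappa> (j, b))\<bar> \<le> \<bar>z j \<bullet> b / \<delta>\<bar>" using trunc_int_bounds(1)[of "z j \<bullet> b / \<delta>"] by (simp add: \<kappa>)
    also have "\<dots> \<le> norm (z j) / \<delta>" using \<delta> Basis_le_norm[OF b, of "z j"] by (simp add: divide_right_mono)
    finally show "\<bar>real_of_int (\<kappa> (j, b))\<bar> \<le> norm (z j) / \<delta>" .
  qed
  also have "\<dots> = DIM('a) * (l1norm n z / \<delta>)"
    by (simp add: l1norm_def sum_distrib_left sum_divide_distrib)
  also have "\<dots> \<le> 2 * (l1norm n z / \<delta>)" using dim \<delta> by (intro mult_right_mono) auto
  also have "\<dots> \<le> T" using T \<delta> by (simp add: field_simps)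
  finally have sumT: "(\<Sum>p\<in>?P. \<bar>\<kappa> p\<bar>) \<le> int T" by linarith
  have "\<bar>\<kappa> p\<bar> \<le> int T" if "p \<in> ?P" for p
    using sumT member_le_sum[of p ?P "\<lambda>p. \<bar>\<kappa> p\<bar>"] that by auto
  then have "\<kappa> \<in> PiE ?P (\<lambda>_. {- int T..int T})"
    by (auto simp: PiE_iff abs_le_iff \<kappa>_def extensional_def restrict_def) force+
  then have "w \<in> lattice_net n \<delta> T" using sumT unfolding w_def lattice_net_def by auto
  then show ?thesis using that 1 2 3 by blast
qed

section \<open>Chernoff bounds for Gaussian matrices\<close>

text \<open>A product measure is the joint law of its own coordinates. The empty index set is
  separate because the characterisation of independence through the joint law assumes a nonempty
  one.\<close>

lemma indep_vars_PiM_components: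
  assumes G: "prob_space G"
  shows "prob_space.indep_vars (PiM I (\<lambda>_. G)) (\<lambda>_. G) (\<lambda>i a. a i) I"
proof -
  interpret prob_space "PiM I (\<lambda>_. G)" by (rule prob_space_PiM) (rule G)
  show ?thesis
  proof (cases "I = {}")
    case True
    interpret E: prob_space "PiM {} (\<lambda>_. G)" by (rule prob_space_PiM) simp
    show ?thesis unfolding True by (simp add: E.indep_vars_def E.indep_sets_def)
  next
    case False
    show ?thesis
    proof (subst indep_vars_iff_distr_eq_PiM'[OF False])
      have "distr (PiM I (\<lambda>_. G)) (PiM I (\<lambda>_. G)) (\<lambda>x. restrict (\<lambda>i. x i) I) =
          distr (PiM I (\<lambda>_. G)) (PiM I (\<lambda>_. G)) (\<lambda>x. x)"
        by (intro distr_cong refl) (auto simp: space_PiM)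
      also have "\<dots> = PiM I (\<lambda>_. G)" by simp
      also have "\<dots> = PiM I (\<lambda>i. distr (PiM I (\<lambda>_. G)) G (\<lambda>x. x i))"
        using G by (intro PiM_cong refl) (subst distr_PiM_component; auto)
      finally show "distr (PiM I (\<lambda>_. G)) (PiM I (\<lambda>_. G)) (\<lambda>x. restrict (\<lambda>i. x i) I) =
          PiM I (\<lambda>i. distr (PiM I (\<lambda>_. G)) G (\<lambda>x. x i))" .
    qed auto
  qed
qed

text \<open>Markov's inequality for the exponential of the sum, which factors because
  \<open>S l\<close> reads only the coordinates in \<open>K l\<close> and these blocks are disjoint.
  The blocks will be rows for \<open>matvec\<close> and columns for \<open>colprod\<close>.\<close>

lemma chernoff_blocks:
  fixes S :: "'l \<Rightarrow> ('p \<Rightarrow> 'a) \<Rightarrow> real"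
  assumes G: "prob_space G" and L: "finite L"
    and K: "\<And>l. l \<in> L \<Longrightarrow> K l \<subseteq> P" "disjoint_family_on K L"
    and meas: "\<And>l. l \<in> L \<Longrightarrow> S l \<in> borel_measurable (PiM (K l) (\<lambda>_. G))"
    and dep: "\<And>l a. l \<in> L \<Longrightarrow> S l (restrict a (K l)) = S l a"
    and bound: "\<And>l. l \<in> L \<Longrightarrow> (\<integral>\<^sup>+ a. ennreal (exp (S l a)) \<partial>PiM P (\<lambda>_. G)) \<le> ennreal c" and c: "c \<ge> 0"
  shows "{a \<in> space (PiM P (\<lambda>_. G)). b \<le> (\<Sum>l\<in>L. S l a)} \<in> sets (PiM P (\<lambda>_. G))" (is "?E \<in> _")
    and "measure (PiM P (\<lambda>_. G)) {a \<in> space (PiM P (\<lambda>_. G)). b \<le> (\<Sum>l\<in>L. S l a)} \<le> c ^ card L * exp (- b)"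
proof -
  let ?M = "PiM P (\<lambda>_. G)"
  interpret prob_space ?M by (rule prob_space_PiM) (rule G)
  have measM: "S l \<in> borel_measurable ?M" if "l \<in> L" for l
  proof -
    have "(\<lambda>a. S l (restrict a (K l))) \<in> borel_measurable ?M"
      by (rule measurable_compose[OF measurable_restrict_subset[OF K(1)[OF that]] meas[OF that]])
    then show ?thesis by (simp add: dep[OF that] cong: measurable_cong)
  qed
  have sumM: "(\<lambda>a. \<Sum>l\<in>L. S l a) \<in> borel_measurable ?M"
    using measM by (intro borel_measurable_sum) auto
  show E: "?E \<in> sets ?M" using sumM by measurable
  have "indep_vars (\<lambda>l. PiM (K l) (\<lambda>_. G)) (\<lambda>l a. restrict (\<lambda>i. a i) (K l)) L"
    by (rule indep_vars_restrict[OF indep_vars_PiM_components[OF G] K])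
  then have "indep_vars (\<lambda>_. borel) (\<lambda>l a. ennreal (exp (S l (restrict (\<lambda>i. a i) (K l))))) L"
    using meas by (intro indep_vars_compose2[where Y="\<lambda>l a. ennreal (exp (S l a))" and M'="\<lambda>l. PiM (K l) (\<lambda>_. G)"]) auto
  then have "(\<integral>\<^sup>+ a. (\<Prod>l\<in>L. ennreal (exp (S l (restrict (\<lambda>i. a i) (K l))))) \<partial>?M) =
      (\<Prod>l\<in>L. \<integral>\<^sup>+ a. ennreal (exp (S l (restrict (\<lambda>i. a i) (K l)))) \<partial>?M)"
    using L by (intro indep_vars_nn_integral) auto
  moreover have "(\<integral>\<^sup>+ a. (\<Prod>l\<in>L. ennreal (exp (S l (restrict (\<lambda>i. a i) (K l))))) \<partial>?M) =
      (\<integral>\<^sup>+ a. ennreal (exp (\<Sum>l\<in>L. S l a)) \<partial>?M)"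
    using L by (intro nn_integral_cong) (simp add: dep exp_sum prod_ennreal)
  moreover have "(\<Prod>l\<in>L. \<integral>\<^sup>+ a. ennreal (exp (S l (restrict (\<lambda>i. a i) (K l)))) \<partial>?M) \<le> (\<Prod>l\<in>L. ennreal c)"
    using bound by (intro prod_mono_ennreal) (simp add: dep)
  ultimately have I: "(\<integral>\<^sup>+ a. ennreal (exp (\<Sum>l\<in>L. S l a)) \<partial>?M) \<le> ennreal (c ^ card L)"
    using c by (simp add: ennreal_power)
  have "emeasure ?M ?E = emeasure ?M {a \<in> space ?M. 1 \<le> ennreal (exp (- b)) * ennreal (exp (\<Sum>l\<in>L. S l a))}"
    by (intro arg_cong[where f="emeasure ?M"])
       (auto simp: ennreal_mult'[symmetric] mult_exp_exp ennreal_1[symmetric] simp del: ennreal_1)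
  also have "\<dots> \<le> ennreal (exp (- b)) * (\<integral>\<^sup>+ a. ennreal (exp (\<Sum>l\<in>L. S l a)) * indicator (space ?M) a \<partial>?M)"
    using sumM by (intro nn_integral_Markov_inequality) auto
  also have "(\<integral>\<^sup>+ a. ennreal (exp (\<Sum>l\<in>L. S l a)) * indicator (space ?M) a \<partial>?M) =
      (\<integral>\<^sup>+ a. ennreal (exp (\<Sum>l\<in>L. S l a)) \<partial>?M)"
    by (intro nn_integral_cong) simp
  also have "ennreal (exp (- b)) * \<dots> \<le> ennreal (exp (- b)) * ennreal (c ^ card L)"
    by (intro mult_left_mono I) simp
  also have "\<dots> = ennreal (c ^ card L * exp (- b))"
    using c by (simp add: ennreal_mult' mult.commute)
  finally have "ennreal (measure ?M ?E) \<le> ennreal (c ^ card L * exp (- b))"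
    by (simp add: emeasure_eq_measure)
  then show "measure ?M ?E \<le> c ^ card L * exp (- b)"
    using c by (subst (asm) ennreal_le_iff) auto
qed

lemma measure_Union_le_card:
  assumes "finite_measure M" "finite W" "\<And>w. w \<in> W \<Longrightarrow> F w \<in> sets M" "\<And>w. w \<in> W \<Longrightarrow> measure M (F w) \<le> p"
  shows "measure M (\<Union>w\<in>W. F w) \<le> real (card W) * (p::real)"
proof -
  have "measure M (\<Union>w\<in>W. F w) \<le> (\<Sum>w\<in>W. measure M (F w))"
    using assms(2,3) by (rule measure_UNION_le)
  also have "\<dots> \<le> (\<Sum>w\<in>W. p)" using assms(4) by (rule sum_mono)
  finally show ?thesis by simp
qed

text \<open>The abstract form of the two Gaussian laws: \<open>\<iota>\<close> is \<open>0\<close> over the reals and \<open>\<i>\<close> over the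
  complex numbers, and both fields carry the real inner product
  \<open>x \<bullet> y = Re (x * cnj y)\<close>. Coefficients live on an arbitrary finite index set so that
  the assumptions apply verbatim to rows and columns of a matrix.\<close>

locale gaussian_field =
  fixes G :: "'a::{real_normed_field, euclidean_space} measure" and \<iota> :: 'a
  assumes G_prob: "prob_space G" and G_sets: "sets G = sets borel"
    and dim_le: "DIM('a) \<le> 2"
    and \<iota>_norm: "norm \<iota> \<le> 1"
    and \<iota>_skew: "\<And>v w :: 'a. v \<bullet> (\<iota> * w) = - (w \<bullet> (\<iota> * v))"
    and align: "\<And>n (x :: nat \<Rightarrow> 'a) y. \<exists>c. norm c = 1 \<and>
        (\<Sum>j<n. x j \<bullet> (\<iota> * (c * y j))) = 0 \<and> 0 \<le> (\<Sum>j<n. x j \<bullet> (c * y j))"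
    and exp_moment: "\<And>(P :: (nat \<times> nat) set) h. finite P \<Longrightarrow> (\<Sum>p\<in>P. (norm (h p))\<^sup>2) \<le> 1 \<Longrightarrow>
        (\<integral>\<^sup>+ a. ennreal (exp ((norm (\<Sum>p\<in>P. a p * h p))\<^sup>2 / 4)) \<partial>PiM P (\<lambda>_. G)) \<le> ennreal 2"
    and inner_second_moment: "\<And>(P :: (nat \<times> nat) set) h g. finite P \<Longrightarrow>
        ((\<Sum>p\<in>P. (norm (h p))\<^sup>2) * (\<Sum>p\<in>P. (norm (g p))\<^sup>2) - (\<Sum>p\<in>P. h p \<bullet> (\<iota> * g p))\<^sup>2) / 2 \<le>
        (\<integral>a. ((\<Sum>p\<in>P. a p * h p) \<bullet> (\<Sum>p\<in>P. a p * g p))\<^sup>2 \<partial>PiM P (\<lambda>_. G))"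
    and tail: "\<And>(P :: (nat \<times> nat) set) e s. finite P \<Longrightarrow> 1/4 \<le> (\<Sum>p\<in>P. (norm (e p))\<^sup>2) \<Longrightarrow> 0 \<le> s \<Longrightarrow>
        exp (- (3 * s)\<^sup>2 - 2) \<le> measure (PiM P (\<lambda>_. G)) {a \<in> space (PiM P (\<lambda>_. G)). s \<le> \<bar>\<Sum>p\<in>P. a p \<bullet> e p\<bar>}"

section \<open>Exponential inequalities and sums over single rows and columns\<close>

lemma exp_ge_power_over_fact:
  fixes x :: real assumes "0 \<le> x" shows "x ^ n / fact n \<le> exp x"
proof -
  have s: "(\<lambda>n. x ^ n /\<^sub>R fact n) sums exp x" by (rule exp_converges)
  have "(\<Sum>i\<in>{n}. x ^ i /\<^sub>R fact i) \<le> (\<Sum>i. x ^ i /\<^sub>R fact i)"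
    using assms s by (intro sum_le_suminf) (auto simp: sums_iff)
  then show ?thesis using s by (simp add: sums_iff divide_inverse mult.commute)
qed

text \<open>The product of the quadratics 1 + x + x^2/2 and 1 - x + x^2/2 is 1 + x^4/4, which is at
  least 1, and the first of them is at most exp x.\<close>

lemma exp_minus_le_quadratic:
  fixes x :: real assumes "0 \<le> x" shows "exp (- x) \<le> 1 - x + x\<^sup>2 / 2"
proof -
  have pos: "0 \<le> 1 - x + x\<^sup>2 / 2"
    using zero_le_power2[of "x - 1"] by (simp add: power2_eq_square algebra_simps)
  have "1 \<le> (1 + x + x\<^sup>2 / 2) * (1 - x + x\<^sup>2 / 2)"
    using zero_le_power2[of "x\<^sup>2"] by (simp add: power2_eq_square algebra_simps)
  also have "\<dots> \<le> exp x * (1 - x + x\<^sup>2 / 2)"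
    using exp_lower_Taylor_quadratic[OF assms] pos by (intro mult_right_mono) auto
  finally show ?thesis by (simp add: exp_minus field_simps)
qed

lemma row_sum:
  fixes i m n :: nat
  assumes "i < m"
  shows "(\<Sum>p\<in>{..<m} \<times> {..<n}. if fst p = i then f (snd p) else 0) = (\<Sum>j<n. f j)"
proof -
  have "(\<Sum>p\<in>{..<m} \<times> {..<n}. if fst p = i then f (snd p) else 0) = (\<Sum>i'<m. \<Sum>j<n. if i' = i then f j else 0)"
    unfolding sum.cartesian_product by (intro sum.cong) auto
  also have "\<dots> = (\<Sum>i'<m. if i' = i then \<Sum>j<n. f j else 0)" by (intro sum.cong) auto
  finally show ?thesis using assms by simp
qed

lemma column_sum:
  fixes j m n :: nat
  assumes "j < n"
  shows "(\<Sum>p\<in>{..<m} \<times> {..<n}. if snd p = j then f (fst p) else 0) = (\<Sum>i<m. f i)"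
proof -
  have "(\<Sum>p\<in>{..<m} \<times> {..<n}. if snd p = j then f (fst p) else 0) = (\<Sum>i<m. \<Sum>j'<n. if j' = j then f i else 0)"
    unfolding sum.cartesian_product by (intro sum.cong) auto
  also have "\<dots> = (\<Sum>i<m. f i)" using assms by (intro sum.cong) auto
  finally show ?thesis .
qed

text \<open>Padding a row with zeros yields a linear combination of all matrix entries, the form in
  which the moment assumptions of the locale are stated.\<close>

lemma matvec_as_sum:
  assumes "i < m"
  shows "matvec n A z i = (\<Sum>p\<in>{..<m} \<times> {..<n}. A p * (if fst p = i then z (snd p) else 0))"
proof -
  have "(\<Sum>p\<in>{..<m} \<times> {..<n}. A p * (if fst p = i then z (snd p) else 0)) =
      (\<Sum>p\<in>{..<m} \<times> {..<n}. if fst p = i then A (i, snd p) * z (snd p) else 0)"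
    by (intro sum.cong) (auto)
  also have "\<dots> = matvec n A z i" by (subst row_sum[OF assms]) (simp add: matvec_def)
  finally show ?thesis by simp
qed

text \<open>Over both fields this is the real part of the \<open>j\<close>-th entry of the adjoint
  of \<open>A\<close> applied to \<open>e\<close>.\<close>

definition colprod :: "nat \<Rightarrow> (nat \<times> nat \<Rightarrow> 'a::real_inner) \<Rightarrow> (nat \<Rightarrow> 'a) \<Rightarrow> nat \<Rightarrow> real" where
  "colprod m A e j = (\<Sum>i<m. A (i, j) \<bullet> e i)"

lemma colprod_as_sum:
  assumes "j < n"
  shows "colprod m A e j = (\<Sum>p\<in>{..<m} \<times> {..<n}. A p \<bullet> (if snd p = j then e (fst p) else 0))"
proof -
  have "(\<Sum>p\<in>{..<m} \<times> {..<n}. A p \<bullet> (if snd p = j then e (fst p) else 0)) =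
      (\<Sum>p\<in>{..<m} \<times> {..<n}. if snd p = j then A (fst p, j) \<bullet> e (fst p) else 0)"
    by (intro sum.cong) (auto)
  also have "\<dots> = colprod m A e j" by (subst column_sum[OF assms]) (simp add: colprod_def)
  finally show ?thesis by simp
qed

section \<open>Tail bounds for a fixed vector or a fixed pair\<close>

context gaussian_field
begin

lemma measurable_entry:
  assumes "p \<in> I" shows "(\<lambda>a. a p) \<in> borel_measurable (PiM I (\<lambda>_. G))"
  using measurable_component_singleton[OF assms, of "\<lambda>_. G"] G_sets
  by (simp cong: measurable_cong_sets)

lemma measurable_matvec:
  assumes "\<And>j. j < n \<Longrightarrow> (i, j) \<in> I"
  shows "(\<lambda>a. matvec n a z i) \<in> borel_measurable (PiM I (\<lambda>_. G))"
  unfolding matvec_def using assms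
  by (intro borel_measurable_sum borel_measurable_times measurable_entry) auto

lemma measurable_colprod:
  assumes "\<And>i. i < m \<Longrightarrow> (i, j) \<in> I"
  shows "(\<lambda>a. colprod m a z j) \<in> borel_measurable (PiM I (\<lambda>_. G))"
  unfolding colprod_def using assms
  by (intro borel_measurable_sum borel_measurable_inner measurable_entry) auto

lemma prob_space_gauss_matrix: "prob_space (gauss_matrix m n G)"
  unfolding gauss_matrix_def by (rule prob_space_PiM) (rule G_prob)

lemma disjoint_rows: "disjoint_family_on (\<lambda>i. {i} \<times> {..<n}) L"
  by (auto simp: disjoint_family_on_def)

lemma disjoint_columns: "disjoint_family_on (\<lambda>j. {..<m} \<times> {j}) L"
  by (auto simp: disjoint_family_on_def)

lemma matvec_restrict: "matvec n (restrict a ({i} \<times> {..<n})) z i = matvec n a z i"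
  by (simp add: matvec_def)

lemma colprod_restrict: "colprod m (restrict a ({..<m} \<times> {j})) z j = colprod m a z j"
  by (simp add: colprod_def)

lemma matvec_exp_moment:
  assumes "l2norm n z \<le> 1" "i < m"
  shows "(\<integral>\<^sup>+ a. ennreal (exp ((norm (matvec n a z i))\<^sup>2 / 4)) \<partial>gauss_matrix m n G) \<le> ennreal 2"
proof -
  let ?h = "\<lambda>p. if fst p = i then z (snd p) else 0"
  have "(\<Sum>p\<in>{..<m} \<times> {..<n}. (norm (?h p))\<^sup>2) = (\<Sum>p\<in>{..<m} \<times> {..<n}. if fst p = i then (norm (z (snd p)))\<^sup>2 else 0)"
    by (intro sum.cong) auto
  also have "\<dots> = (l2norm n z)\<^sup>2" by (subst row_sum[OF assms(2)]) (simp add: l2norm_squared)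
  also have "\<dots> \<le> 1" using assms(1) by (simp add: power_le_one)
  finally show ?thesis
    unfolding gauss_matrix_def matvec_as_sum[OF assms(2)] by (intro exp_moment) auto
qed

lemma matvec_norm_tail:
  assumes "l2norm n z \<le> 1"
  shows "{A \<in> space (gauss_matrix m n G). R \<le> (l2norm m (matvec n A z))\<^sup>2} \<in> sets (gauss_matrix m n G)" (is "?E \<in> _")
    and "measure (gauss_matrix m n G) {A \<in> space (gauss_matrix m n G). R \<le> (l2norm m (matvec n A z))\<^sup>2} \<le> 2 ^ m * exp (- (R / 4))"
proof -
  let ?S = "\<lambda>i a. (norm (matvec n a z i))\<^sup>2 / 4"
  have E: "?E = {A \<in> space (gauss_matrix m n G). R / 4 \<le> (\<Sum>i<m. ?S i A)}"
    by (auto simp: l2norm_squared simp flip: sum_divide_distrib)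
  have 1: "?S i \<in> borel_measurable (PiM ({i} \<times> {..<n}) (\<lambda>_. G))" for i
  proof -
    have [measurable]: "(\<lambda>a. matvec n a z i) \<in> borel_measurable (PiM ({i} \<times> {..<n}) (\<lambda>_. G))"
      by (intro measurable_matvec) auto
    show ?thesis by measurable
  qed
  have 3: "(\<integral>\<^sup>+ a. ennreal (exp (?S i a)) \<partial>PiM ({..<m} \<times> {..<n}) (\<lambda>_. G)) \<le> ennreal 2" if "i \<in> {..<m}" for i
    using matvec_exp_moment[OF assms, of i m] that by (simp add: gauss_matrix_def)
  note * = chernoff_blocks[OF G_prob, of "{..<m}" "\<lambda>i. {i} \<times> {..<n}" "{..<m} \<times> {..<n}" ?S 2 "R/4", OF _ _ disjoint_rows 1 _ 3]
  show "?E \<in> sets (gauss_matrix m n G)"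
    unfolding E unfolding gauss_matrix_def by (rule *(1)) (auto simp: matvec_restrict)
  show "measure (gauss_matrix m n G) ?E \<le> 2 ^ m * exp (- (R / 4))"
    unfolding E unfolding gauss_matrix_def using *(2) by (auto simp: matvec_restrict)
qed

text \<open>A Paley-Zygmund argument in exponential form: \<open>hg\<close> gives second moment at
  least 1/8, the exponential moments give a bounded fourth moment, and together they bound the mean
  of |Q| from below, hence its Laplace transform away from 1.\<close>

lemma inner_matvec_exp_moment:
  assumes h: "l2norm n h \<le> 1" and g: "l2norm n g \<le> 1" and i: "i < m"
    and hg: "1/4 \<le> (l2norm n h)\<^sup>2 * (l2norm n g)\<^sup>2 - (\<Sum>j<n. h j \<bullet> (\<iota> * g j))\<^sup>2"
  shows "(\<integral>\<^sup>+ a. ennreal (exp (- (\<bar>matvec n a h i \<bullet> matvec n a g i\<bar> / 163840))) \<partial>gauss_matrix m n G)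
      \<le> ennreal (exp (- (1 / 163840 / 5120)))"
proof -
  let ?M = "gauss_matrix m n G"
  interpret prob_space ?M by (rule prob_space_gauss_matrix)
  let ?Q = "\<lambda>a. matvec n a h i \<bullet> matvec n a g i"
  let ?E = "\<lambda>z a. exp ((norm (matvec n a z i))\<^sup>2 / 4)"
  have mm: "(\<lambda>a. matvec n a z i) \<in> borel_measurable ?M" for z :: "nat \<Rightarrow> 'a"
    unfolding gauss_matrix_def using i by (intro measurable_matvec) auto
  note [measurable] = mm[of h] mm[of g]
  have intE: "integrable ?M (?E z) \<and> (\<integral>a. ?E z a \<partial>?M) \<le> 2" if "l2norm n z \<le> 1" for z :: "nat \<Rightarrow> 'a"
  proof -
    have le: "(\<integral>\<^sup>+ a. ennreal (?E z a) \<partial>?M) \<le> ennreal 2" by (rule matvec_exp_moment[OF that i])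
    have [measurable]: "?E z \<in> borel_measurable ?M" using mm[of z] by measurable
    have int: "integrable ?M (?E z)"
      using le_less_trans[OF le ennreal_less_top] by (intro integrableI_nonneg) auto
    moreover have "(\<integral>a. ?E z a \<partial>?M) = enn2real (\<integral>\<^sup>+ a. ennreal (?E z a) \<partial>?M)"
      by (rule integral_eq_nn_integral) auto
    moreover have "\<dots> \<le> 2" using enn2real_mono[OF le] by simp
    ultimately show ?thesis by auto
  qed
  \<comment> \<open>Domination by the two exponential moments, each of mean at most 2, gives
    integrability and the fourth moment bound 4 * 3072 = 12288.\<close>
  have QE: "(?Q a)\<^sup>2 \<le> 16 * (?E h a + ?E g a)" "(?Q a) ^ 4 \<le> 3072 * (?E h a + ?E g a)" for a
  proof -
    define v w where "v = (norm (matvec n a h i))\<^sup>2 / 4" and "w = (norm (matvec n a g i))\<^sup>2 / 4"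
    have vw: "0 \<le> v" "0 \<le> w" by (auto simp: v_def w_def)
    have Q2: "(?Q a)\<^sup>2 \<le> 16 * (v * w)"
    proof -
      have "\<bar>?Q a\<bar> \<le> norm (matvec n a h i) * norm (matvec n a g i)" by (rule Cauchy_Schwarz_ineq2)
      then have "\<bar>?Q a\<bar>\<^sup>2 \<le> (norm (matvec n a h i) * norm (matvec n a g i))\<^sup>2" by (intro power_mono) auto
      then show ?thesis by (simp add: v_def w_def power_mult_distrib)
    qed
    have e2: "v\<^sup>2 / 2 \<le> exp v" "w\<^sup>2 / 2 \<le> exp w"
      using exp_ge_power_over_fact[OF vw(1), of 2] exp_ge_power_over_fact[OF vw(2), of 2] by (auto simp: fact_numeral)
    have e4: "v ^ 4 / 24 \<le> exp v" "w ^ 4 / 24 \<le> exp w"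
      using exp_ge_power_over_fact[OF vw(1), of 4] exp_ge_power_over_fact[OF vw(2), of 4] by (auto simp: fact_numeral)
    have "2 * (v * w) \<le> v\<^sup>2 + w\<^sup>2" using zero_le_power2[of "v - w"] by (simp add: power2_eq_square algebra_simps)
    then have "16 * (v * w) \<le> 8 * (v\<^sup>2 + w\<^sup>2)" by simp
    also have "\<dots> \<le> 16 * (exp v + exp w)" using e2 by simp
    finally have "(?Q a)\<^sup>2 \<le> 16 * (exp v + exp w)" using Q2 by simp
    then show "(?Q a)\<^sup>2 \<le> 16 * (?E h a + ?E g a)" by (simp add: v_def w_def)
    have "(?Q a) ^ 4 = ((?Q a)\<^sup>2)\<^sup>2" by simp
    also have "\<dots> \<le> (16 * (v * w))\<^sup>2" using Q2 by (intro power_mono) auto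
    also have "\<dots> = 256 * (v\<^sup>2 * w\<^sup>2)" by (simp add: power_mult_distrib)
    also have "\<dots> \<le> 128 * (v ^ 4 + w ^ 4)"
      using zero_le_power2[of "v\<^sup>2 - w\<^sup>2"] by (simp add: power2_eq_square power4_eq_xxxx algebra_simps)
    also have "\<dots> \<le> 128 * (24 * exp v + 24 * exp w)" using e4 by (intro mult_left_mono) auto
    finally show "(?Q a) ^ 4 \<le> 3072 * (?E h a + ?E g a)" by (simp add: v_def w_def)
  qed
  have intB: "integrable ?M (\<lambda>a. c * (?E h a + ?E g a))" for c :: real
    using intE[OF h] intE[OF g] by (intro integrable_mult_right integrable_add) auto
  have EB: "(\<integral>a. c * (?E h a + ?E g a) \<partial>?M) \<le> 4 * c" if "0 \<le> c" for c :: real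
  proof -
    have "(\<integral>a. c * (?E h a + ?E g a) \<partial>?M) = c * ((\<integral>a. ?E h a \<partial>?M) + (\<integral>a. ?E g a \<partial>?M))"
      using intE[OF h] intE[OF g] by simp
    also have "\<dots> \<le> c * 4" using intE[OF h] intE[OF g] that by (intro mult_left_mono) auto
    finally show ?thesis by simp
  qed
  have int2: "integrable ?M (\<lambda>a. (?Q a)\<^sup>2)"
    by (rule Bochner_Integration.integrable_bound[OF intB[of 16]]) (auto intro!: AE_I2 order_trans[OF QE(1)])
  have int4: "integrable ?M (\<lambda>a. (?Q a) ^ 4)"
    by (rule Bochner_Integration.integrable_bound[OF intB[of 3072]]) (auto intro!: AE_I2 order_trans[OF QE(2)])
  have m4: "(\<integral>a. (?Q a) ^ 4 \<partial>?M) \<le> 12288"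
    using integral_mono[OF int4 intB[of 3072] QE(2)] EB[of 3072] by simp
  have m2': "1/8 \<le> (\<integral>a. (?Q a)\<^sup>2 \<partial>?M)"
  proof -
    let ?c = "\<lambda>z p. if fst p = i then z (snd p) else 0"
    have n: "(\<Sum>p\<in>{..<m} \<times> {..<n}. (norm (?c z p))\<^sup>2) = (l2norm n z)\<^sup>2" for z :: "nat \<Rightarrow> 'a"
    proof -
      have "(\<Sum>p\<in>{..<m} \<times> {..<n}. (norm (?c z p))\<^sup>2) = (\<Sum>p\<in>{..<m} \<times> {..<n}. if fst p = i then (norm (z (snd p)))\<^sup>2 else 0)"
        by (intro sum.cong) auto
      then show ?thesis using row_sum[OF i, of "\<lambda>j. (norm (z j))\<^sup>2" n] by (simp add: l2norm_squared)
    qed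
    have b: "(\<Sum>p\<in>{..<m} \<times> {..<n}. ?c h p \<bullet> (\<iota> * ?c g p)) = (\<Sum>j<n. h j \<bullet> (\<iota> * g j))"
    proof -
      have "(\<Sum>p\<in>{..<m} \<times> {..<n}. ?c h p \<bullet> (\<iota> * ?c g p)) = (\<Sum>p\<in>{..<m} \<times> {..<n}. if fst p = i then h (snd p) \<bullet> (\<iota> * g (snd p)) else 0)"
        by (intro sum.cong) auto
      then show ?thesis using row_sum[OF i, of "\<lambda>j. h j \<bullet> (\<iota> * g j)" n] by simp
    qed
    have "1/8 \<le> ((l2norm n h)\<^sup>2 * (l2norm n g)\<^sup>2 - (\<Sum>j<n. h j \<bullet> (\<iota> * g j))\<^sup>2) / 2" using hg by simp
    also have "\<dots> \<le> (\<integral>a. (?Q a)\<^sup>2 \<partial>?M)"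
      using inner_second_moment[of "{..<m} \<times> {..<n}" "?c h" "?c g"]
      unfolding n b gauss_matrix_def matvec_as_sum[OF i] by simp
    finally show ?thesis .
  qed
  \<comment> \<open>With this \<open>l\<close> the coefficient 3/640 - l/2 of the second moment
    stays positive, so that 1/8 may be inserted; what remains still exceeds 1/5120.\<close>
  define l :: real where "l = 1 / 163840"
  have l: "0 < l" by (simp add: l_def)
  have pw: "exp (- (l * \<bar>?Q a\<bar>)) \<le> 1 - l * (3 * (?Q a)\<^sup>2 / 640 - (?Q a) ^ 4 / 65536000) + l\<^sup>2 * (?Q a)\<^sup>2 / 2" for a
  proof -
    define u where "u = \<bar>?Q a\<bar>"
    have u: "0 \<le> u" "u\<^sup>2 = (?Q a)\<^sup>2" "u ^ 4 = (?Q a) ^ 4" by (auto simp: u_def)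
    \<comment> \<open>This polynomial minorises u by an even quartic touching it at 320, near the
      optimal contact point sqrt (12288 / (1/8)).\<close>
    have "0 \<le> u * (u - 320)\<^sup>2 * (u + 640)" using u by auto
    then have "3 * u\<^sup>2 / 640 - u ^ 4 / 65536000 \<le> u"
      by (simp add: power2_eq_square power4_eq_xxxx algebra_simps)
    then have "l * (3 * u\<^sup>2 / 640 - u ^ 4 / 65536000) \<le> l * u" using l by (intro mult_left_mono) auto
    moreover have "exp (- (l * u)) \<le> 1 - l * u + (l * u)\<^sup>2 / 2"
      using l u by (intro exp_minus_le_quadratic) auto
    ultimately show ?thesis using u unfolding u_def by (simp add: power_mult_distrib)
  qed
  let ?B = "\<lambda>a. 1 - l * (3 * (?Q a)\<^sup>2 / 640 - (?Q a) ^ 4 / 65536000) + l\<^sup>2 * (?Q a)\<^sup>2 / 2"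
  have intB: "integrable ?M ?B"
    using int2 int4 by auto
  have "(\<integral>a. ?B a \<partial>?M) = 1 - l * (3 * (\<integral>a. (?Q a)\<^sup>2 \<partial>?M) / 640 - (\<integral>a. (?Q a) ^ 4 \<partial>?M) / 65536000) + l\<^sup>2 * (\<integral>a. (?Q a)\<^sup>2 \<partial>?M) / 2"
    using int2 int4 by (simp add: prob_space)
  also have "\<dots> \<le> 1 - l / 5120"
  proof -
    have "1 - 1 / 163840 * (3 * s / 640 - r / 65536000) + (1 / 163840)\<^sup>2 * s / 2 \<le> 1 - 1 / 163840 / 5120"
      if "1/8 \<le> s" "r \<le> 12288" for s r :: real
      using that by (simp add: power2_eq_square field_simps)
    from this[OF m2' m4] show ?thesis by (simp only: l_def)
  qed
  also have "\<dots> \<le> exp (- (l / 5120))" using exp_ge_add_one_self[of "- (l / 5120)"] by simp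
  finally have le: "(\<integral>a. ?B a \<partial>?M) \<le> exp (- (l / 5120))" .
  have "(\<integral>\<^sup>+ a. ennreal (exp (- (l * \<bar>?Q a\<bar>))) \<partial>?M) \<le> (\<integral>\<^sup>+ a. ennreal (?B a) \<partial>?M)"
    by (intro nn_integral_mono ennreal_leI pw)
  also have "\<dots> = ennreal (\<integral>a. ?B a \<partial>?M)"
    by (intro nn_integral_eq_integral intB AE_I2 order_trans[OF _ pw]) auto
  also have "\<dots> \<le> ennreal (exp (- (l / 5120)))" using le by (rule ennreal_leI)
  finally show ?thesis by (simp add: l_def)
qed

text \<open>The threshold m / 10240 is half of m / 5120, so it uses up half of the exponent:
  1677721600 = 163840 * 10240.\<close>

lemma inner_matvec_lower_tail:
  assumes h: "l2norm n h \<le> 1" and g: "l2norm n g \<le> 1"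
    and hg: "1/4 \<le> (l2norm n h)\<^sup>2 * (l2norm n g)\<^sup>2 - (\<Sum>j<n. h j \<bullet> (\<iota> * g j))\<^sup>2"
  shows "{A \<in> space (gauss_matrix m n G). (\<Sum>i<m. \<bar>matvec n A h i \<bullet> matvec n A g i\<bar>) \<le> m / 10240} \<in> sets (gauss_matrix m n G)" (is "?E \<in> _")
    and "measure (gauss_matrix m n G) {A \<in> space (gauss_matrix m n G). (\<Sum>i<m. \<bar>matvec n A h i \<bullet> matvec n A g i\<bar>) \<le> m / 10240}
      \<le> exp (- (m / 1677721600))"
proof -
  let ?S = "\<lambda>i a. - (\<bar>matvec n a h i \<bullet> matvec n a g i\<bar> / 163840)"
  have E: "?E = {A \<in> space (gauss_matrix m n G). - (m / 1677721600) \<le> (\<Sum>i<m. ?S i A)}"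
    by (auto simp: sum_negf simp flip: sum_divide_distrib)
  have 1: "?S i \<in> borel_measurable (PiM ({i} \<times> {..<n}) (\<lambda>_. G))" for i
    by (intro borel_measurable_uminus borel_measurable_divide borel_measurable_abs borel_measurable_inner measurable_matvec) auto
  have 3: "(\<integral>\<^sup>+ a. ennreal (exp (?S i a)) \<partial>PiM ({..<m} \<times> {..<n}) (\<lambda>_. G)) \<le> ennreal (exp (- (1 / 163840 / 5120)))"
    if "i \<in> {..<m}" for i
    using inner_matvec_exp_moment[OF h g _ hg, of i m] that by (simp add: gauss_matrix_def)
  note * = chernoff_blocks[OF G_prob, of "{..<m}" "\<lambda>i. {i} \<times> {..<n}" "{..<m} \<times> {..<n}" ?S "exp (- (1 / 163840 / 5120))" "- (m / 1677721600)", OF _ _ disjoint_rows 1 _ 3]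
  show "?E \<in> sets (gauss_matrix m n G)"
    unfolding E unfolding gauss_matrix_def by (rule *(1)) (auto simp: matvec_restrict)
  have "measure (gauss_matrix m n G) ?E \<le> exp (- (1 / 163840 / 5120)) ^ m * exp (m / 1677721600)"
    unfolding E unfolding gauss_matrix_def using *(2) by (auto simp: matvec_restrict)
  also have "\<dots> = exp (- (m / 1677721600))"
    by (simp add: exp_of_nat_mult[symmetric] mult_exp_exp)
  finally show "measure (gauss_matrix m n G) ?E \<le> exp (- (m / 1677721600))" .
qed

text \<open>The columns are independent and each indicator has probability P at least p, so that E
  exp(- indicator) = 1 - (1 - 1/e) P, which is at most exp(- p/2).\<close>

lemma colprod_count_tail:
  assumes e: "1/2 \<le> l2norm m e" and s: "0 \<le> s"
  shows "{A \<in> space (gauss_matrix m n G). (\<Sum>j<n. if s \<le> \<bar>colprod m A e j\<bar> then 1 else 0) \<le> b} \<in> sets (gauss_matrix m n G)" (is "?E \<in> _")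
    and "measure (gauss_matrix m n G) {A \<in> space (gauss_matrix m n G). (\<Sum>j<n. if s \<le> \<bar>colprod m A e j\<bar> then 1 else 0) \<le> b}
      \<le> exp (b - n * exp (- (3 * s)\<^sup>2 - 2) / 2)"
proof -
  let ?M = "gauss_matrix m n G"
  interpret prob_space ?M by (rule prob_space_gauss_matrix)
  define p where "p = exp (- (3 * s)\<^sup>2 - 2)"
  let ?S = "\<lambda>j a. - (if s \<le> \<bar>colprod m a e j\<bar> then 1 else 0 :: real)"
  have E: "?E = {A \<in> space (gauss_matrix m n G). - b \<le> (\<Sum>j<n. ?S j A)}"
    by (auto simp: sum_negf)
  have 1: "?S j \<in> borel_measurable (PiM ({..<m} \<times> {j}) (\<lambda>_. G))" for j
  proof -
    have [measurable]: "(\<lambda>a. colprod m a e j) \<in> borel_measurable (PiM ({..<m} \<times> {j}) (\<lambda>_. G))"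
      by (intro measurable_colprod) auto
    show ?thesis by measurable
  qed
  have 3: "(\<integral>\<^sup>+ a. ennreal (exp (?S j a)) \<partial>PiM ({..<m} \<times> {..<n}) (\<lambda>_. G)) \<le> ennreal (exp (- (p / 2)))"
    if "j \<in> {..<n}" for j
  proof -
    have j: "j < n" using that by simp
    define F where "F = {a \<in> space ?M. s \<le> \<bar>colprod m a e j\<bar>}"
    have [measurable]: "(\<lambda>a. colprod m a e j) \<in> borel_measurable ?M"
      unfolding gauss_matrix_def using j by (intro measurable_colprod) auto
    have Fs[measurable]: "F \<in> sets ?M" unfolding F_def by measurable
    have pF: "p \<le> measure ?M F"
    proof -
      have "(\<Sum>q\<in>{..<m} \<times> {..<n}. (norm (if snd q = j then e (fst q) else 0))\<^sup>2) =
          (\<Sum>q\<in>{..<m} \<times> {..<n}. if snd q = j then (norm (e (fst q)))\<^sup>2 else 0)"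
        by (intro sum.cong) auto
      also have "\<dots> = (l2norm m e)\<^sup>2" using column_sum[OF j, of "\<lambda>i. (norm (e i))\<^sup>2" m] by (simp add: l2norm_squared)
      also have "1/4 \<le> (l2norm m e)\<^sup>2" using power_mono[OF e, of 2] by (simp add: power2_eq_square)
      finally show ?thesis
        using tail[of "{..<m} \<times> {..<n}" "\<lambda>q. if snd q = j then e (fst q) else 0" s] s
        unfolding F_def gauss_matrix_def p_def colprod_as_sum[OF j] by simp
    qed
    have "(\<integral>\<^sup>+ a. ennreal (exp (?S j a)) \<partial>?M) = (\<integral>\<^sup>+ a. ennreal (1 - (1 - exp (-1)) * indicator F a) \<partial>?M)"
      by (intro nn_integral_cong) (auto simp: F_def indicator_def)
    also have "\<dots> = ennreal (\<integral>a. 1 - (1 - exp (-1)) * indicator F a \<partial>?M)"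
    proof (intro nn_integral_eq_integral AE_I2)
      show "integrable ?M (\<lambda>a. 1 - (1 - exp (-1)) * indicator F a :: real)"
        by (intro Bochner_Integration.integrable_diff integrable_mult_right integrable_real_indicator)
           (auto simp: emeasure_eq_measure)
    qed (auto split: split_indicator)
    also have "(\<integral>a. 1 - (1 - exp (-1)) * indicator F a \<partial>?M) = 1 - (1 - exp (-1)) * measure ?M F"
      by (simp add: prob_space emeasure_eq_measure)
    also have "\<dots> \<le> exp (- (p / 2))"
    proof -
      have "exp (-1) \<le> (1/2 :: real)"
        using exp_ge_add_one_self[of 1] by (simp add: exp_minus field_simps)
      then have "p / 2 \<le> (1 - exp (-1)) * measure ?M F"
        using mult_mono[of "1/2" "1 - exp (-1)" p "measure ?M F"] pF by (auto simp: p_def)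
      then show ?thesis using exp_ge_add_one_self[of "- (p / 2)"] by simp
    qed
    finally show ?thesis by (simp add: gauss_matrix_def ennreal_leI)
  qed
  note * = chernoff_blocks[OF G_prob, of "{..<n}" "\<lambda>j. {..<m} \<times> {j}" "{..<m} \<times> {..<n}" ?S "exp (- (p / 2))" "- b", OF _ _ disjoint_columns 1 _ 3]
  show "?E \<in> sets (gauss_matrix m n G)"
    unfolding E unfolding gauss_matrix_def by (rule *(1)) (auto simp: colprod_restrict)
  have "measure (gauss_matrix m n G) ?E \<le> exp (- (p / 2)) ^ n * exp b"
    unfolding E unfolding gauss_matrix_def using *(2) by (auto simp: colprod_restrict)
  also have "\<dots> = exp (b - n * p / 2)"
    by (simp add: exp_of_nat_mult[symmetric] mult_exp_exp)
  finally show "measure (gauss_matrix m n G) ?E \<le> exp (b - n * exp (- (3 * s)\<^sup>2 - 2) / 2)"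
    by (simp add: p_def)
qed

end

section \<open>Uniform bounds over nets\<close>

text \<open>The usual upper bound for the logarithm of the number of subsets of size
  \<open>s\<close> of a set of size \<open>N\<close>.\<close>

definition entropy_bound :: "nat \<Rightarrow> nat \<Rightarrow> real" where
  "entropy_bound N s = s * ln (exp 1 * N / s)"

lemma entropy_bound_ge:
  assumes "1 \<le> s" "s \<le> N" shows "real s \<le> entropy_bound N s"
proof -
  have "1 \<le> ln (exp 1 * real N / real s)"
    using assms by (subst ln_ge_iff) (auto simp: field_simps)
  then show ?thesis using assms by (simp add: entropy_bound_def)
qed

text \<open>The generating-function count at q = s / (2 N): the first factor is then at most exp(4
  s), and 1/q = 2 N / s is at most e N / s. \<open>N\<close> may exceed \<open>n\<close>, which is
  needed when there are more rows than columns.\<close>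

lemma card_lattice_net_entropy:
  assumes dim: "DIM('a::euclidean_space) \<le> 2" and s: "1 \<le> s" "s \<le> N" "n \<le> N"
  shows "real (card (lattice_net n \<delta> (\<beta> * s) :: (nat \<Rightarrow> 'a) set)) \<le> exp ((4 + real \<beta>) * entropy_bound N s)"
proof -
  define q where "q = real s / (2 * real N)"
  have q: "0 < q" "q \<le> 1/2" using s by (auto simp: q_def field_simps)
  have "real n * DIM('a) \<le> real N * 2"
    using dim s by (intro mult_mono) auto
  then have "4 * q * (real n * DIM('a)) \<le> 4 * q * (real N * 2)" using q by (intro mult_left_mono) auto
  also have "\<dots> = 4 * real s" using s by (simp add: q_def)
  also have "\<dots> \<le> 4 * entropy_bound N s" using entropy_bound_ge[OF s(1,2)] by simp
  finally have 1: "exp (4 * q * (real n * DIM('a))) \<le> exp (4 * entropy_bound N s)" by simp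
  have "1 / q = 2 * real N / real s" by (simp add: q_def)
  also have "\<dots> \<le> exp 1 * real N / real s"
    using exp_ge_add_one_self[of 1] by (intro divide_right_mono mult_right_mono) auto
  also have "\<dots> = exp (ln (exp 1 * real N / real s))" using s by (intro exp_ln[symmetric]) auto
  finally have "(1 / q) ^ (\<beta> * s) \<le> exp (ln (exp 1 * real N / real s)) ^ (\<beta> * s)"
    using q by (intro power_mono) auto
  also have "\<dots> = exp (real \<beta> * entropy_bound N s)"
    by (simp add: exp_of_nat_mult[symmetric] entropy_bound_def mult_ac)
  finally have 2: "(1 / q) ^ (\<beta> * s) \<le> exp (real \<beta> * entropy_bound N s)" .
  have "real (card (lattice_net n \<delta> (\<beta> * s) :: (nat \<Rightarrow> 'a) set)) \<le> exp (4 * q * (real n * DIM('a))) * (1 / q) ^ (\<beta> * s)"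
    by (rule card_lattice_net[OF q])
  also have "\<dots> \<le> exp (4 * entropy_bound N s) * exp (real \<beta> * entropy_bound N s)"
    using 1 2 q by (intro mult_mono) auto
  finally show ?thesis by (simp add: mult_exp_exp algebra_simps)
qed

text \<open>Only finiteness matters here: it makes the supremum in the net argument a real
  number.\<close>

lemma matvec_crude_bound:
  fixes A :: "nat \<times> nat \<Rightarrow> 'a::real_normed_field"
  shows "l2norm m (matvec n A z) \<le> (\<Sum>i<m. \<Sum>j<n. norm (A (i, j))) * l2norm n z"
proof -
  have "l2norm m (matvec n A z) \<le> (\<Sum>i<m. norm (matvec n A z i))"
    using l2norm_le_l1norm[of m "matvec n A z"] by (simp add: l1norm_def)
  also have "\<dots> \<le> (\<Sum>i<m. \<Sum>j<n. norm (A (i, j)) * l2norm n z)"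
    unfolding matvec_def
    by (intro sum_mono order_trans[OF norm_sum]) (auto simp: norm_mult intro!: sum_mono mult_left_mono norm_le_l2norm)
  finally show ?thesis by (simp add: sum_distrib_right)
qed

lemma homogeneous_bound:
  fixes A :: "nat \<times> nat \<Rightarrow> 'a::real_normed_field"
  assumes "\<And>z. z \<in> sparse n s \<Longrightarrow> l2norm n z \<le> 1 \<Longrightarrow> l2norm m (matvec n A z) \<le> b"
    and z: "z \<in> sparse n s"
  shows "l2norm m (matvec n A z) \<le> b * l2norm n z"
proof (cases "l2norm n z = 0")
  case True
  then have "matvec n A z i = 0" for i by (simp add: l2norm_eq_0 matvec_def)
  then have "l2norm m (matvec n A z) = 0" by (simp add: l2norm_eq_0)
  then show ?thesis using True by simp
next
  case False
  then have pos: "0 < l2norm n z" using l2norm_nonneg[of n z] by linarith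
  let ?c = "1 / l2norm n z"
  have "l2norm m (matvec n A (\<lambda>j. ?c *\<^sub>R z j)) \<le> b"
  proof (rule assms(1))
    show "(\<lambda>j. ?c *\<^sub>R z j) \<in> sparse n s" using z pos by (auto simp: sparse_def vecs_def)
    show "l2norm n (\<lambda>j. ?c *\<^sub>R z j) \<le> 1" unfolding l2norm_scaleR using pos by simp
  qed
  then have "?c * l2norm m (matvec n A z) \<le> b"
    unfolding matvec_scaleR l2norm_scaleR using pos by simp
  then show ?thesis using pos by (simp add: field_simps)
qed

text \<open>Rounding an \<open>s\<close>-sparse vector leaves an \<open>s\<close>-sparse error of at most half its norm,
  so the supremum over the ball is at most twice the maximum over the net.\<close>

lemma sparse_bound_of_net_bound:
  fixes A :: "nat \<times> nat \<Rightarrow> 'a::{real_normed_field, euclidean_space}"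
  assumes dim: "DIM('a) \<le> 2" and s: "1 \<le> s"
    and net: "\<And>w. w \<in> lattice_net n (1 / (4 * sqrt s)) (8 * s) \<Longrightarrow> l2norm n w \<le> 1 \<Longrightarrow> l2norm m (matvec n A w) \<le> b"
    and z: "z \<in> sparse n s"
  shows "l2norm m (matvec n A z) \<le> 2 * b * l2norm n z"
proof (rule homogeneous_bound[OF _ z])
  define Y where "Y = {l2norm m (matvec n A z) | z. z \<in> sparse n s \<and> l2norm n z \<le> 1}"
  \<comment> \<open>An error of at most 2 \<delta> on at most \<open>s\<close> entries has l2 norm
    at most 1/2, and \<delta> * 8 s = 2 sqrt s covers twice the l1 norm of a sparse unit
    vector.\<close>
  define \<delta> where "\<delta> = 1 / (4 * sqrt s)"
  have \<delta>: "0 < \<delta>" using s by (simp add: \<delta>_def)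
  have zs: "(\<lambda>_. 0 :: 'a) \<in> sparse n s" by (simp add: sparse_def vecs_def)
  have "l2norm n (\<lambda>_. 0 :: 'a) \<le> 1" by (simp add: l2norm_def)
  then have ne: "Y \<noteq> {}" using zs unfolding Y_def by blast
  have bdd: "bdd_above Y"
  proof (rule bdd_aboveI)
    fix y assume "y \<in> Y"
    then obtain z where z: "y = l2norm m (matvec n A z)" "l2norm n z \<le> 1" by (auto simp: Y_def)
    have "y \<le> (\<Sum>i<m. \<Sum>j<n. norm (A (i, j))) * l2norm n z" unfolding z(1) by (rule matvec_crude_bound)
    also have "\<dots> \<le> (\<Sum>i<m. \<Sum>j<n. norm (A (i, j))) * 1" using z(2) by (intro mult_left_mono sum_nonneg) auto
    finally show "y \<le> (\<Sum>i<m. \<Sum>j<n. norm (A (i, j)))" by simp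
  qed
  \<comment> \<open>Twice the rounding error is again admissible in \<open>Y\<close>; since the
    supremum is finite, the inequality can be solved for it.\<close>
  have "Sup Y \<le> b + Sup Y / 2"
  proof (rule cSup_least[OF ne])
    fix y assume "y \<in> Y"
    then obtain z where z: "y = l2norm m (matvec n A z)" "z \<in> sparse n s" "l2norm n z \<le> 1" by (auto simp: Y_def)
    have zv: "z \<in> vecs n" using z by (simp add: sparse_def)
    have "l1norm n z \<le> sqrt s * l2norm n z" by (rule l1norm_sparse[OF z(2)])
    also have "\<dots> \<le> sqrt s * 1" using z(3) by (intro mult_left_mono) auto
    finally have "l1norm n z \<le> sqrt s" by simp
    moreover have "\<delta> * real (8 * s) = 2 * sqrt s"
      using s by (simp add: \<delta>_def field_simps)
    ultimately have T: "2 * l1norm n z \<le> \<delta> * real (8 * s)" by simp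
    obtain w where w: "w \<in> lattice_net n \<delta> (8 * s)" "\<And>j. norm (z j - w j) \<le> 2 * \<delta>"
      "\<And>j. norm (z j - w j) \<le> norm (z j)" "\<And>j. norm (w j) \<le> norm (z j)"
      using lattice_net_approx[OF zv \<delta> T dim] by metis
    define r where "r = (\<lambda>j. z j - w j)"
    have supp: "{j. r j \<noteq> 0} \<subseteq> {j. z j \<noteq> 0}"
    proof
      fix j assume "j \<in> {j. r j \<noteq> 0}"
      then show "j \<in> {j. z j \<noteq> 0}" using w(3)[of j] by (auto simp: r_def)
    qed
    have r: "r \<in> sparse n s"
      using card_mono[OF finite_support[OF zv] supp] z(2) lattice_net_vecs[OF w(1)]
      by (auto simp: sparse_def r_def vecs_def)
    have rn: "l2norm n r \<le> 1/2"
    proof -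
      have "(l2norm n r)\<^sup>2 = (\<Sum>j | r j \<noteq> 0. (norm (r j))\<^sup>2)"
        unfolding l2norm_squared using vecs_support[of r n] r
        by (intro sum.mono_neutral_right) (auto simp: sparse_def)
      also have "\<dots> \<le> (\<Sum>j | r j \<noteq> 0. (2 * \<delta>)\<^sup>2)"
        using w(2) by (intro sum_mono power_mono) (auto simp: r_def)
      also have "\<dots> \<le> s * (2 * \<delta>)\<^sup>2" using r by (simp add: sparse_def mult_right_mono)
      also have "\<dots> = (1/2)\<^sup>2" using s by (simp add: \<delta>_def power2_eq_square field_simps)
      finally show ?thesis by (rule power2_le_imp_le) simp
    qed
    have "l2norm n w \<le> l2norm n z" using w(4) by (intro l2norm_mono) auto
    then have 1: "l2norm m (matvec n A w) \<le> b" using z(3) w(1) by (intro net) (auto simp: \<delta>_def)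
    have "l2norm m (matvec n A (\<lambda>j. 2 *\<^sub>R r j)) \<le> Sup Y"
    proof (rule cSup_upper[OF _ bdd])
      have "(\<lambda>j. 2 *\<^sub>R r j) \<in> sparse n s" using r by (auto simp: sparse_def vecs_def)
      moreover have "l2norm n (\<lambda>j. 2 *\<^sub>R r j) \<le> 1" using rn unfolding l2norm_scaleR by simp
      ultimately show "l2norm m (matvec n A (\<lambda>j. 2 *\<^sub>R r j)) \<in> Y" unfolding Y_def by blast
    qed
    then have 2: "l2norm m (matvec n A r) \<le> Sup Y / 2" unfolding matvec_scaleR l2norm_scaleR by simp
    have "y = l2norm m (\<lambda>i. matvec n A w i + matvec n A r i)"
      unfolding z(1) by (subst matvec_add[symmetric]) (simp add: r_def)
    also have "\<dots> \<le> l2norm m (matvec n A w) + l2norm m (matvec n A r)" by (rule l2norm_triangle)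
    finally show "y \<le> b + Sup Y / 2" using 1 2 by simp
  qed
  then have SY: "Sup Y \<le> 2 * b" by simp
  fix z :: "nat \<Rightarrow> 'a" assume "z \<in> sparse n s" "l2norm n z \<le> 1"
  then have "l2norm m (matvec n A z) \<le> Sup Y" by (intro cSup_upper[OF _ bdd]) (auto simp: Y_def)
  then show "l2norm m (matvec n A z) \<le> 2 * b" using SY by simp
qed

section \<open>Exceptional events and perturbation from the net\<close>

lemma l2norm_diff_lower: "l2norm n x - l2norm n (\<lambda>j. x j - y j) \<le> l2norm n y"
  using l2norm_triangle[of n "\<lambda>j. x j - y j" y] by simp

lemma sum_norm_mult_le: "(\<Sum>i<m. norm (x i) * norm (y i)) \<le> l2norm m x * l2norm m y"
  using L2_set_mult_ineq[of "\<lambda>i. norm (x i)" "\<lambda>i. norm (y i)" "{..<m}"] by (simp add: l2norm_eq_L2_set)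

lemma sum_inner_le: "(\<Sum>i<m. \<bar>x i \<bullet> y i\<bar>) \<le> l2norm m x * l2norm m y"
  by (rule order_trans[OF _ sum_norm_mult_le]) (intro sum_mono Cauchy_Schwarz_ineq2)

context gaussian_field
begin

lemma sparse_bound_event:
  assumes s: "1 \<le> s" "s \<le> N" "n \<le> N"
  shows "\<exists>E\<in>sets (gauss_matrix m n G). measure (gauss_matrix m n G) E \<le> exp (- real m) \<and>
    (\<forall>A\<in>space (gauss_matrix m n G) - E. \<forall>z\<in>sparse n s.
       l2norm m (matvec n A z) \<le> 16 * sqrt (m + entropy_bound N s) * l2norm n z)"
proof -
  let ?M = "gauss_matrix m n G"
  interpret prob_space ?M by (rule prob_space_gauss_matrix)
  define W where "W = {w :: nat \<Rightarrow> 'a. w \<in> lattice_net n (1 / (4 * sqrt s)) (8 * s) \<and> l2norm n w \<le> 1}"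
  define H where "H = real m + entropy_bound N s"
  \<comment> \<open>The level 64 H gives the exponent 16 H, enough for the net (12 entropies), for
    the factor 2^m and for the remaining exp(- m).\<close>
  define F where "F = (\<lambda>w. {A \<in> space ?M. 64 * H \<le> (l2norm m (matvec n A w))\<^sup>2})"
  have E0: "0 \<le> entropy_bound N s" using entropy_bound_ge[OF s(1,2)] by linarith
  have finW: "finite W" unfolding W_def by (rule finite_subset[OF _ finite_lattice_net]) auto
  have cW: "real (card W) \<le> exp (12 * entropy_bound N s)"
  proof -
    have "card W \<le> card (lattice_net n (1 / (4 * sqrt s)) (8 * s) :: (nat \<Rightarrow> 'a) set)"
      unfolding W_def by (intro card_mono finite_lattice_net) auto
    then show ?thesis using card_lattice_net_entropy[OF dim_le s, of "1 / (4 * sqrt s)" 8] by simp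
  qed
  have Fs: "F w \<in> sets ?M" "measure ?M (F w) \<le> 2 ^ m * exp (- (16 * H))" if "w \<in> W" for w
    using matvec_norm_tail[of n w m "64 * H"] that by (auto simp: F_def W_def)
  have "measure ?M (\<Union>w\<in>W. F w) \<le> real (card W) * (2 ^ m * exp (- (16 * H)))"
    using finW Fs by (intro measure_Union_le_card) (auto intro: finite_measure_axioms)
  also have "\<dots> \<le> exp (12 * entropy_bound N s) * (exp m * exp (- (16 * H)))"
  proof -
    have "(2::real) ^ m \<le> exp 1 ^ m" using exp_ge_add_one_self[of 1] by (intro power_mono) auto
    then show ?thesis using cW by (intro mult_mono) (auto simp: exp_of_nat_mult[symmetric])
  qed
  also have "\<dots> \<le> exp (- real m)" using E0 by (simp add: mult_exp_exp H_def)
  finally have m: "measure ?M (\<Union>w\<in>W. F w) \<le> exp (- real m)" .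
  have "l2norm m (matvec n A z) \<le> 16 * sqrt H * l2norm n z"
    if A: "A \<in> space ?M - (\<Union>w\<in>W. F w)" and z: "z \<in> sparse n s" for A z
  proof -
    have "l2norm m (matvec n A w) \<le> 8 * sqrt H"
      if "w \<in> lattice_net n (1 / (4 * sqrt s)) (8 * s)" "l2norm n w \<le> 1" for w
    proof (rule power2_le_imp_le)
      have "\<not> 64 * H \<le> (l2norm m (matvec n A w))\<^sup>2" using A that by (auto simp: W_def F_def)
      then show "(l2norm m (matvec n A w))\<^sup>2 \<le> (8 * sqrt H)\<^sup>2"
        using E0 by (simp add: power_mult_distrib H_def)
    qed (use E0 in \<open>simp add: H_def\<close>)
    from sparse_bound_of_net_bound[OF dim_le s(1) this z] show ?thesis by simp
  qed
  then show ?thesis using m finW Fs by (intro bexI[of _ "\<Union>w\<in>W. F w"]) (auto simp: H_def)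
qed

text \<open>A net of pairs costs twice five entropies; \<open>small\<close> makes this at most half
  of the exponent m / 1677721600, which leaves m / 3355443200.\<close>

lemma inner_lower_event:
  assumes t: "1 \<le> t" "t \<le> N" "n \<le> N" and small: "10 * entropy_bound N t \<le> m / 3355443200"
  shows "\<exists>E\<in>sets (gauss_matrix m n G). measure (gauss_matrix m n G) E \<le> exp (- (m / 3355443200)) \<and>
    (\<forall>A\<in>space (gauss_matrix m n G) - E. \<forall>h\<in>lattice_net n (1 / sqrt t) t. \<forall>g\<in>lattice_net n (1 / sqrt t) t.
       l2norm n h \<le> 1 \<longrightarrow> l2norm n g \<le> 1 \<longrightarrow>
       1/4 \<le> (l2norm n h)\<^sup>2 * (l2norm n g)\<^sup>2 - (\<Sum>j<n. h j \<bullet> (\<iota> * g j))\<^sup>2 \<longrightarrow>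
       m / 10240 < (\<Sum>i<m. \<bar>matvec n A h i \<bullet> matvec n A g i\<bar>))"
proof -
  let ?M = "gauss_matrix m n G"
  interpret prob_space ?M by (rule prob_space_gauss_matrix)
  let ?N = "lattice_net n (1 / sqrt t) t :: (nat \<Rightarrow> 'a) set"
  define W where "W = {(h, g). h \<in> ?N \<and> g \<in> ?N \<and> l2norm n h \<le> 1 \<and> l2norm n g \<le> 1 \<and>
       1/4 \<le> (l2norm n h)\<^sup>2 * (l2norm n g)\<^sup>2 - (\<Sum>j<n. h j \<bullet> (\<iota> * g j))\<^sup>2}"
  define F where "F = (\<lambda>(h, g). {A \<in> space ?M. (\<Sum>i<m. \<bar>matvec n A h i \<bullet> matvec n A g i\<bar>) \<le> m / 10240})"
  have WN: "W \<subseteq> ?N \<times> ?N" by (auto simp: W_def)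
  have finW: "finite W" by (rule finite_subset[OF WN]) simp
  have cN: "real (card ?N) \<le> exp (5 * entropy_bound N t)"
    using card_lattice_net_entropy[OF dim_le t, of "1 / sqrt t" 1] by simp
  have "real (card W) \<le> real (card ?N) * real (card ?N)"
    using card_mono[OF _ WN] by (simp add: card_cartesian_product flip: of_nat_mult)
  also have "\<dots> \<le> exp (5 * entropy_bound N t) * exp (5 * entropy_bound N t)"
    using cN by (intro mult_mono) auto
  finally have cW: "real (card W) \<le> exp (10 * entropy_bound N t)" by (simp add: mult_exp_exp)
  have Fs: "F w \<in> sets ?M" "measure ?M (F w) \<le> exp (- (m / 1677721600))" if "w \<in> W" for w
    using inner_matvec_lower_tail[of n "fst w" "snd w" m] that by (auto simp: F_def W_def)
  have "measure ?M (\<Union>w\<in>W. F w) \<le> real (card W) * exp (- (m / 1677721600))"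
    using finW Fs by (intro measure_Union_le_card) (auto intro: finite_measure_axioms)
  also have "\<dots> \<le> exp (10 * entropy_bound N t) * exp (- (m / 1677721600))"
    using cW by (intro mult_right_mono) auto
  also have "\<dots> \<le> exp (- (m / 3355443200))" using small by (simp add: mult_exp_exp)
  finally have m: "measure ?M (\<Union>w\<in>W. F w) \<le> exp (- (m / 3355443200))" .
  show ?thesis
  proof (intro bexI[of _ "\<Union>w\<in>W. F w"] conjI m ballI impI)
    fix A h g
    assume A: "A \<in> space ?M - (\<Union>w\<in>W. F w)" and "h \<in> ?N" "g \<in> ?N" "l2norm n h \<le> 1" "l2norm n g \<le> 1"
       "1/4 \<le> (l2norm n h)\<^sup>2 * (l2norm n g)\<^sup>2 - (\<Sum>j<n. h j \<bullet> (\<iota> * g j))\<^sup>2"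
    then have "(h, g) \<in> W" by (auto simp: W_def)
    then have "A \<notin> F (h, g)" using A by blast
    then show "m / 10240 < (\<Sum>i<m. \<bar>matvec n A h i \<bullet> matvec n A g i\<bar>)" using A by (auto simp: F_def)
  qed (use finW Fs in auto)
qed

lemma iota_form_le: "\<bar>\<Sum>j<n. h j \<bullet> (\<iota> * g j)\<bar> \<le> l2norm n h * l2norm n g"
proof -
  have "\<bar>\<Sum>j<n. h j \<bullet> (\<iota> * g j)\<bar> \<le> (\<Sum>j<n. norm (h j) * norm (g j))"
  proof (intro order_trans[OF sum_abs] sum_mono)
    fix j
    have "\<bar>h j \<bullet> (\<iota> * g j)\<bar> \<le> norm (h j) * norm (\<iota> * g j)" by (rule Cauchy_Schwarz_ineq2)
    also have "\<dots> \<le> norm (h j) * norm (g j)"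
      using \<iota>_norm by (intro mult_left_mono) (auto simp: norm_mult mult_left_le_one_le)
    finally show "\<bar>h j \<bullet> (\<iota> * g j)\<bar> \<le> norm (h j) * norm (g j)" .
  qed
  also have "\<dots> \<le> l2norm n h * l2norm n g" by (rule sum_norm_mult_le)
  finally show ?thesis .
qed

text \<open>All products vanish at (h, g), while at a nearby net pair their absolute sum exceeds m /
  10240. The difference is bilinear and therefore bounded by the operator bound times the rounding
  error. The choice \<epsilon>^2 = 2 \<kappa> reflects that error.\<close>

lemma inner_not_all_zero:
  fixes A :: "nat \<times> nat \<Rightarrow> 'a" and \<kappa> \<epsilon> :: real
  defines "\<kappa> \<equiv> 2 / 10 ^ 16" and "\<epsilon> \<equiv> 2 / 10 ^ 8"
  assumes t: "1 \<le> t" and m: "1 \<le> m"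
    and upper: "\<And>z. z \<in> sparse n t \<Longrightarrow> l2norm m (matvec n A z) \<le> M * l2norm n z"
    and M: "0 \<le> M" "M\<^sup>2 \<le> 512 * m"
    and lower: "\<forall>h\<in>lattice_net n (1 / sqrt t) t. \<forall>g\<in>lattice_net n (1 / sqrt t) t.
       l2norm n h \<le> 1 \<longrightarrow> l2norm n g \<le> 1 \<longrightarrow>
       1/4 \<le> (l2norm n h)\<^sup>2 * (l2norm n g)\<^sup>2 - (\<Sum>j<n. h j \<bullet> (\<iota> * g j))\<^sup>2 \<longrightarrow>
       m / 10240 < (\<Sum>i<m. \<bar>matvec n A h i \<bullet> matvec n A g i\<bar>)"
    and h: "h \<in> vecs n" "l2norm n h = 1" "l1norm n h \<le> \<kappa> * sqrt t"
    and g: "g \<in> vecs n" "l2norm n g = 1" "l1norm n g \<le> \<kappa> * sqrt t"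
    and B: "(\<Sum>j<n. h j \<bullet> (\<iota> * g j)) = 0"
    and zero: "\<And>i. i < m \<Longrightarrow> matvec n A h i \<bullet> matvec n A g i = 0"
  shows False
proof -
  have st: "0 < sqrt t" using t by simp
  have \<delta>: "0 < 1 / sqrt t" using t by simp
  have approx: "\<exists>w. w \<in> lattice_net n (1 / sqrt t) t \<and> l2norm n w \<le> 1 \<and> l1norm n w \<le> \<kappa> * sqrt t \<and>
      l2norm n (\<lambda>j. z j - w j) \<le> \<epsilon> \<and> l1norm n (\<lambda>j. z j - w j) \<le> \<kappa> * sqrt t"
    if z: "z \<in> vecs n" "l2norm n z = 1" "l1norm n z \<le> \<kappa> * sqrt t" for z :: "nat \<Rightarrow> 'a"
  proof -
    have "l1norm n z * 5000000000000000 \<le> sqrt t" using z(3) by (simp add: \<kappa>_def)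
    then have "2 * l1norm n z \<le> sqrt t" using l1norm_nonneg[of n z] by linarith
    then have T: "2 * l1norm n z \<le> (1 / sqrt t) * t" by (simp add: real_div_sqrt)
    obtain w where w: "w \<in> lattice_net n (1 / sqrt t) t" "\<And>j. norm (z j - w j) \<le> 2 * (1 / sqrt t)"
      "\<And>j. norm (z j - w j) \<le> norm (z j)" "\<And>j. norm (w j) \<le> norm (z j)"
      using lattice_net_approx[OF z(1) \<delta> T dim_le] by metis
    \<comment> \<open>One factor of each square is bounded by 2 / sqrt t and the other by the entry
      itself, so effective sparsity alone makes the l2 error small.\<close>
    have "(l2norm n (\<lambda>j. z j - w j))\<^sup>2 \<le> (\<Sum>j<n. 2 / sqrt t * norm (z j))"
      unfolding l2norm_squared unfolding power2_eq_square using w(2,3)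
      by (intro sum_mono mult_mono) auto
    also have "\<dots> = 2 / sqrt t * l1norm n z" by (simp add: l1norm_def sum_distrib_left)
    also have "\<dots> \<le> 2 / sqrt t * (\<kappa> * sqrt t)" using z(3) by (intro mult_left_mono) auto
    also have "\<dots> = \<epsilon>\<^sup>2" using t by (simp add: \<kappa>_def \<epsilon>_def power2_eq_square)
    finally have "l2norm n (\<lambda>j. z j - w j) \<le> \<epsilon>" by (rule power2_le_imp_le) (simp add: \<epsilon>_def)
    moreover have "l2norm n w \<le> 1" using l2norm_mono[of n w z] w(4) z(2) by auto
    moreover have "l1norm n w \<le> \<kappa> * sqrt t" using l1norm_mono[of n w z] w(4) z(3) by auto
    moreover have "l1norm n (\<lambda>j. z j - w j) \<le> \<kappa> * sqrt t"
      using l1norm_mono[of n "\<lambda>j. z j - w j" z] w(3) z(3) by auto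
    ultimately show ?thesis using w(1) by blast
  qed
  obtain h' where h': "h' \<in> lattice_net n (1 / sqrt t) t" "l2norm n h' \<le> 1" "l1norm n h' \<le> \<kappa> * sqrt t"
    "l2norm n (\<lambda>j. h j - h' j) \<le> \<epsilon>" "l1norm n (\<lambda>j. h j - h' j) \<le> \<kappa> * sqrt t" using approx[OF h] by blast
  obtain g' where g': "g' \<in> lattice_net n (1 / sqrt t) t" "l2norm n g' \<le> 1" "l1norm n g' \<le> \<kappa> * sqrt t"
    "l2norm n (\<lambda>j. g j - g' j) \<le> \<epsilon>" "l1norm n (\<lambda>j. g j - g' j) \<le> \<kappa> * sqrt t" using approx[OF g] by blast
  have ub: "l2norm m (matvec n A z) \<le> M * (a + \<kappa>)"
    if "z \<in> vecs n" "l2norm n z \<le> a" "l1norm n z \<le> \<kappa> * sqrt t" for z a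
  proof -
    have "l2norm m (matvec n A z) \<le> M * (l2norm n z + l1norm n z / sqrt t)"
      by (rule matvec_bound_of_sparse_bound[OF upper M(1) t that(1)])
    also have "\<dots> \<le> M * (a + \<kappa>)"
      using that(2,3) st M(1) by (intro mult_left_mono add_mono) (auto simp: field_simps)
    finally show ?thesis .
  qed
  have v': "h' \<in> vecs n" "g' \<in> vecs n" using h'(1) g'(1) lattice_net_vecs by auto
  have r: "(\<lambda>j. h j - h' j) \<in> vecs n" "(\<lambda>j. g j - g' j) \<in> vecs n" using h(1) g(1) v' by (auto simp: vecs_def)
  \<comment> \<open>At (h, g) the left side is 1 because of \<open>B\<close>; small perturbations
    keep it far above 1/4.\<close>
  have form: "(l2norm n h')\<^sup>2 * (l2norm n g')\<^sup>2 - (\<Sum>j<n. h' j \<bullet> (\<iota> * g' j))\<^sup>2 \<ge> 1/4"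
  proof -
    have a: "9/10 \<le> l2norm n h'" "9/10 \<le> l2norm n g'"
      using l2norm_diff_lower[of n h h'] l2norm_diff_lower[of n g g'] h(2) g(2) h'(4) g'(4) by (auto simp: \<epsilon>_def)
    have "(9/10)\<^sup>2 * (9/10)\<^sup>2 \<le> (l2norm n h')\<^sup>2 * (l2norm n g')\<^sup>2"
      using a by (intro mult_mono power_mono) auto
    moreover have "\<bar>\<Sum>j<n. h' j \<bullet> (\<iota> * g' j)\<bar> \<le> 1/10"
    proof -
      have "(\<Sum>j<n. h j \<bullet> (\<iota> * g j)) - (\<Sum>j<n. h' j \<bullet> (\<iota> * g' j)) =
          (\<Sum>j<n. (h j - h' j) \<bullet> (\<iota> * g' j)) + (\<Sum>j<n. h j \<bullet> (\<iota> * (g j - g' j)))"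
        by (simp add: inner_diff_left inner_diff_right right_diff_distrib sum_subtractf)
      then have "\<bar>\<Sum>j<n. h' j \<bullet> (\<iota> * g' j)\<bar> \<le> \<bar>\<Sum>j<n. (h j - h' j) \<bullet> (\<iota> * g' j)\<bar> + \<bar>\<Sum>j<n. h j \<bullet> (\<iota> * (g j - g' j))\<bar>"
        using B by linarith
      also have "\<dots> \<le> \<epsilon> * 1 + 1 * \<epsilon>"
        using h'(4) g'(2,4) h(2)
        by (intro add_mono order_trans[OF iota_form_le] mult_mono) (auto simp: \<epsilon>_def)
      finally show ?thesis by (simp add: \<epsilon>_def)
    qed
    then have "\<bar>\<Sum>j<n. h' j \<bullet> (\<iota> * g' j)\<bar>\<^sup>2 \<le> (1/10)\<^sup>2" by (intro power_mono) auto
    ultimately show ?thesis by (simp add: power2_eq_square)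
  qed
  have "m / 10240 < (\<Sum>i<m. \<bar>matvec n A h' i \<bullet> matvec n A g' i\<bar>)"
    using lower h'(1,2) g'(1,2) form by blast
  \<comment> \<open>Replacing one factor at a time; the product of the two unperturbed factors is
    zero.\<close>
  also have "\<dots> \<le> (\<Sum>i<m. \<bar>matvec n A (\<lambda>j. h j - h' j) i \<bullet> matvec n A g' i\<bar> + \<bar>matvec n A h i \<bullet> matvec n A (\<lambda>j. g j - g' j) i\<bar>)"
  proof (intro sum_mono)
    fix i assume "i \<in> {..<m}"
    then have "matvec n A h i \<bullet> matvec n A g i = 0" using zero by simp
    then show "\<bar>matvec n A h' i \<bullet> matvec n A g' i\<bar> \<le>
        \<bar>matvec n A (\<lambda>j. h j - h' j) i \<bullet> matvec n A g' i\<bar> + \<bar>matvec n A h i \<bullet> matvec n A (\<lambda>j. g j - g' j) i\<bar>"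
      by (simp add: matvec_diff inner_diff_left inner_diff_right)
  qed
  also have "\<dots> \<le> l2norm m (matvec n A (\<lambda>j. h j - h' j)) * l2norm m (matvec n A g')
      + l2norm m (matvec n A h) * l2norm m (matvec n A (\<lambda>j. g j - g' j))"
    unfolding sum.distrib by (intro add_mono sum_inner_le)
  also have "\<dots> \<le> M * (\<epsilon> + \<kappa>) * (M * (1 + \<kappa>)) + M * (1 + \<kappa>) * (M * (\<epsilon> + \<kappa>))"
    using ub[OF r(1) h'(4,5)] ub[OF r(2) g'(4,5)] ub[OF v'(2) g'(2,3)] ub[OF h(1) _ h(3), of 1] h(2) M(1)
    by (intro add_mono mult_mono) (auto simp: \<epsilon>_def \<kappa>_def)
  also have "\<dots> = M\<^sup>2 * (2 * (\<epsilon> + \<kappa>) * (1 + \<kappa>))" by (simp add: power2_eq_square algebra_simps)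
  also have "\<dots> \<le> 512 * m * (2 * (\<epsilon> + \<kappa>) * (1 + \<kappa>))"
    using M(2) by (intro mult_right_mono) (auto simp: \<epsilon>_def \<kappa>_def)
  \<comment> \<open>The left side is about 2.1 / 10^5 times m, the right side about 9.8 / 10^5 times
    m.\<close>
  also have "\<dots> \<le> m / 10240" using m by (simp add: \<epsilon>_def \<kappa>_def field_simps)
  finally show False by simp
qed

end

section \<open>The quotient property\<close>

text \<open>With real coefficients the adjoint enters only through the real numbers
  \<open>colprod\<close>, so signs suffice as multipliers over the complex field too.\<close>

lemma inner_matvec_of_real:
  fixes A :: "nat \<times> nat \<Rightarrow> 'a::{real_normed_field, real_inner}"
  shows "(\<Sum>i<m. matvec n A (\<lambda>j. of_real (c j)) i \<bullet> e i) = (\<Sum>j<n. c j * colprod m A e j)"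
proof -
  have "(\<Sum>i<m. matvec n A (\<lambda>j. of_real (c j)) i \<bullet> e i) = (\<Sum>i<m. \<Sum>j<n. c j * (A (i, j) \<bullet> e i))"
    unfolding matvec_def inner_sum_left
    by (intro sum.cong refl) (metis inner_scaleR_left mult.commute scaleR_conv_of_real)
  also have "\<dots> = (\<Sum>j<n. c j * colprod m A e j)"
    by (subst sum.swap) (simp add: colprod_def sum_distrib_left)
  finally show ?thesis .
qed

lemma colprod_diff: "colprod m A (\<lambda>i. x i - y i) j = colprod m A x j - colprod m A y j"
  by (simp add: colprod_def inner_diff_right sum_subtractf)

lemma colprod_scaleR: "colprod m A (\<lambda>i. c *\<^sub>R x i) j = c * colprod m A x j"
  by (simp add: colprod_def sum_distrib_left)

text \<open>Duality: the adjoint restricted to the columns in \<open>J\<close> inherits the bound of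
  \<open>A\<close> on vectors supported there. The test vector consists of the correlations
  themselves.\<close>

lemma sum_colprod_squares_le:
  fixes A :: "nat \<times> nat \<Rightarrow> 'a::{real_normed_field, real_inner}"
  assumes upper: "\<And>z. z \<in> sparse n s \<Longrightarrow> l2norm m (matvec n A z) \<le> M * l2norm n z"
    and J: "J \<subseteq> {..<n}" "card J \<le> s" and M: "0 \<le> M"
  shows "(\<Sum>j\<in>J. (colprod m A e j)\<^sup>2) \<le> M\<^sup>2 * (l2norm m e)\<^sup>2"
proof -
  define c where "c = (\<lambda>j. if j \<in> J then colprod m A e j else 0)"
  define z :: "nat \<Rightarrow> 'a" where "z = (\<lambda>j. of_real (c j))"
  define X where "X = (\<Sum>j\<in>J. (colprod m A e j)\<^sup>2)"
  have finJ: "finite J" using J finite_subset by blast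
  have X0: "0 \<le> X" by (auto simp: X_def intro: sum_nonneg)
  have "card {j. z j \<noteq> 0} \<le> card J" using finJ by (intro card_mono) (auto simp: z_def c_def)
  then have z: "z \<in> sparse n s" using J by (force simp: sparse_def vecs_def z_def c_def)
  have zn: "l2norm n z = sqrt X"
    unfolding l2norm_def X_def z_def c_def using J(1)
    by (intro arg_cong[where f=sqrt] sum.mono_neutral_cong_right) auto
  have "X = (\<Sum>j<n. c j * colprod m A e j)"
    unfolding X_def c_def using J(1) by (intro sum.mono_neutral_cong_left) (auto simp: power2_eq_square)
  also have "\<dots> = (\<Sum>i<m. matvec n A z i \<bullet> e i)" unfolding z_def by (rule inner_matvec_of_real[symmetric])
  also have "\<dots> \<le> (\<Sum>i<m. \<bar>matvec n A z i \<bullet> e i\<bar>)" by (intro sum_mono) auto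
  also have "\<dots> \<le> l2norm m (matvec n A z) * l2norm m e" by (rule sum_inner_le)
  also have "\<dots> \<le> M * l2norm n z * l2norm m e" by (rule mult_right_mono[OF upper[OF z] l2norm_nonneg])
  finally have "sqrt X * sqrt X \<le> (M * l2norm m e) * sqrt X" using X0 by (simp add: zn mult_ac)
  then have "sqrt X \<le> M * l2norm m e" 
  proof (cases "X = 0")
    case False
    then have "0 < sqrt X" using X0 by simp
    then show ?thesis using \<open>sqrt X * sqrt X \<le> (M * l2norm m e) * sqrt X\<close> by (rule mult_right_le_imp_le[rotated])
  qed (use M in simp)
  then have "(sqrt X)\<^sup>2 \<le> (M * l2norm m e)\<^sup>2" using X0 by (intro power_mono) auto
  then show ?thesis using X0 by (simp add: X_def[symmetric] power_mult_distrib)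
qed

text \<open>Passing from a net point to \<open>e\<close> loses half of the level and fewer than
  \<open>m\<close> columns, which is why the net supplies more than \<open>2 * m\<close> of
  them.\<close>

lemma many_correlated_columns:
  fixes A :: "nat \<times> nat \<Rightarrow> 'a::{real_normed_field, euclidean_space}" and L :: real
  assumes dim: "DIM('a) \<le> 2" and m: "1 \<le> m" and L: "1 \<le> L"
    and upper: "\<And>z. z \<in> sparse n m \<Longrightarrow> l2norm m (matvec n A z) \<le> 23 * sqrt (m * L) * l2norm n z"
    and net: "\<And>w. w \<in> lattice_net m (1 / (600 * sqrt m)) (1200 * m) \<Longrightarrow> 1/2 \<le> l2norm m w \<Longrightarrow>
       2 * real m < (\<Sum>j<n. if sqrt L / 6 \<le> \<bar>colprod m A w j\<bar> then 1 else 0)"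
    and e: "e \<in> vecs m" "l2norm m e = 1"
  shows "m \<le> card {j\<in>{..<n}. sqrt L / 12 \<le> \<bar>colprod m A e j\<bar>}"
proof -
  define \<delta> where "\<delta> = 1 / (600 * sqrt m)"
  have \<delta>: "0 < \<delta>" using m by (simp add: \<delta>_def)
  have "2 * l1norm m e \<le> 2 * sqrt m" using l1norm_le_sqrt[of m e] e by simp
  also have "\<dots> = \<delta> * real (1200 * m)" using m by (simp add: \<delta>_def field_simps)
  finally have T: "2 * l1norm m e \<le> \<delta> * real (1200 * m)" .
  obtain w where w: "w \<in> lattice_net m \<delta> (1200 * m)" "\<And>j. norm (e j - w j) \<le> 2 * \<delta>"
    using lattice_net_approx[OF e(1) \<delta> T dim] by metis
  define d where "d = (\<lambda>i. e i - w i)"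
  have "(l2norm m d)\<^sup>2 \<le> (\<Sum>i<m. (2 * \<delta>)\<^sup>2)"
    unfolding l2norm_squared d_def using w(2) by (intro sum_mono power_mono) auto
  also have "\<dots> = (1 / 300)\<^sup>2" using m by (simp add: \<delta>_def power2_eq_square field_simps)
  finally have d2: "(l2norm m d)\<^sup>2 \<le> (1 / 300)\<^sup>2" .
  then have d: "l2norm m d \<le> 1 / 300" by (rule power2_le_imp_le) simp
  then have w2: "1/2 \<le> l2norm m w" using l2norm_diff_lower[of m e w] e(2) by (simp add: d_def)
  let ?good = "{j\<in>{..<n}. sqrt L / 12 \<le> \<bar>colprod m A e j\<bar>}"
  let ?bad = "{j\<in>{..<n}. sqrt L / 12 \<le> \<bar>colprod m A d j\<bar>}"
  let ?big = "{j\<in>{..<n}. sqrt L / 6 \<le> \<bar>colprod m A w j\<bar>}"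
  \<comment> \<open>Otherwise \<open>m\<close> columns would give a sum of squares m L / 144, above
    the bound (23/300)^2 m L = 529/90000 m L obtained by duality.\<close>
  have "card ?bad < m"
  proof (rule ccontr)
    assume "\<not> card ?bad < m"
    then obtain J where J: "J \<subseteq> ?bad" "card J = m"
      by (meson linorder_not_le obtain_subset_with_card_n)
    have "real m * (L / 144) = (\<Sum>j\<in>J. (sqrt L / 12)\<^sup>2)" using J L by (simp add: power_divide)
    also have "\<dots> \<le> (\<Sum>j\<in>J. \<bar>colprod m A d j\<bar>\<^sup>2)"
      using J L by (intro sum_mono power_mono) auto
    also have "\<dots> = (\<Sum>j\<in>J. (colprod m A d j)\<^sup>2)" by simp
    also have "\<dots> \<le> (23 * sqrt (m * L))\<^sup>2 * (l2norm m d)\<^sup>2"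
      using J L by (intro sum_colprod_squares_le[OF upper]) auto
    also have "\<dots> \<le> (23 * sqrt (m * L))\<^sup>2 * (1 / 300)\<^sup>2" using d2 by (intro mult_left_mono) auto
    also have "\<dots> = real m * L * (529 / 90000)" using L by (simp add: power_mult_distrib power2_eq_square)
    finally have "real m * L * (1/144) \<le> real m * L * (529 / 90000)" by simp
    moreover have "0 < real m * L" using m L by simp
    ultimately show False by (subst (asm) mult_le_cancel_left_pos) auto
  qed
  moreover have "card ?big \<le> card ?good + card ?bad"
  proof -
    have "?big \<subseteq> ?good \<union> ?bad"
    proof
      fix j assume j: "j \<in> ?big"
      have "colprod m A d j = colprod m A e j - colprod m A w j" unfolding d_def by (rule colprod_diff)
      then have "\<bar>colprod m A w j\<bar> \<le> \<bar>colprod m A e j\<bar> + \<bar>colprod m A d j\<bar>" by linarith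
      moreover have "sqrt L / 6 \<le> \<bar>colprod m A w j\<bar>" using j by simp
      ultimately have "sqrt L / 12 \<le> \<bar>colprod m A e j\<bar> \<or> sqrt L / 12 \<le> \<bar>colprod m A d j\<bar>" by linarith
      then show "j \<in> ?good \<union> ?bad" using j by blast
    qed
    then have "card ?big \<le> card (?good \<union> ?bad)" by (intro card_mono) auto
    also have "\<dots> \<le> card ?good + card ?bad" by (rule card_Un_le)
    finally show ?thesis .
  qed
  moreover have "2 * m < card ?big"
  proof -
    have "2 * real m < (\<Sum>j<n. if sqrt L / 6 \<le> \<bar>colprod m A w j\<bar> then 1 else 0)"
      using w(1) w2 by (intro net) (auto simp: \<delta>_def)
    also have "\<dots> = real (card ?big)" by (simp add: sum.If_cases Int_def)
    finally show ?thesis by simp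
  qed
  ultimately show ?thesis by linarith
qed

text \<open>A descent step along the signed sum of \<open>m\<close> well correlated columns: the
  linear gain is at least \<alpha> m sqrt L r / 12 (twice), the quadratic loss at most (23 \<alpha>
  m sqrt L)^2.\<close>

lemma quotient_step:
  fixes A :: "nat \<times> nat \<Rightarrow> 'a::{real_normed_field, euclidean_space}" and L :: real
  assumes dim: "DIM('a) \<le> 2" and m: "1 \<le> m" and L: "1 \<le> L"
    and upper: "\<And>z. z \<in> sparse n m \<Longrightarrow> l2norm m (matvec n A z) \<le> 23 * sqrt (m * L) * l2norm n z"
    and net: "\<And>w. w \<in> lattice_net m (1 / (600 * sqrt m)) (1200 * m) \<Longrightarrow> 1/2 \<le> l2norm m w \<Longrightarrow>
       2 * real m < (\<Sum>j<n. if sqrt L / 6 \<le> \<bar>colprod m A w j\<bar> then 1 else 0)"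
  shows "\<exists>u\<in>vecs n. l2norm m (\<lambda>i. e i - matvec n A u i) \<le> (1 - 1 / 152352) * l2norm m e \<and>
    l1norm n u \<le> 1 / (6348 * sqrt L) * l2norm m e \<and> l2norm n u \<le> 1 / (6348 * sqrt m) * l2norm m e"
proof (cases "l2norm m e = 0")
  case True
  have "matvec n A (\<lambda>_. 0) i = 0" for i by (simp add: matvec_def)
  then have "l2norm m (\<lambda>i. e i - matvec n A (\<lambda>_. 0) i) = 0" using True by simp
  then show ?thesis using True
    by (intro bexI[of _ "\<lambda>_. 0"]) (auto simp: vecs_def l1norm_def l2norm_def)
next
  case False
  define r where "r = l2norm m e"
  have r: "0 < r" using False l2norm_nonneg[of m e] unfolding r_def by linarith
  \<comment> \<open>\<open>e\<close> is arbitrary beyond index \<open>m\<close>, whereas the net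
    covers only \<open>vecs m\<close>.\<close>
  define e1 where "e1 = (\<lambda>i. (1 / r) *\<^sub>R restr {..<m} e i)"
  have "l2norm m (restr {..<m} e) = r" unfolding r_def by (intro l2norm_cong) (simp add: restr_def)
  then have e1: "l2norm m e1 = 1" unfolding e1_def l2norm_scaleR using r by simp
  have e1v: "e1 \<in> vecs m" by (simp add: e1_def vecs_def restr_def)
  have ce1: "colprod m A e1 j = colprod m A e j / r" for j
    unfolding e1_def colprod_scaleR by (simp add: colprod_def restr_def)
  have "m \<le> card {j\<in>{..<n}. sqrt L / 12 \<le> \<bar>colprod m A e1 j\<bar>}"
    using many_correlated_columns[OF dim m L upper net e1v e1] by simp
  then obtain J where J: "J \<subseteq> {j\<in>{..<n}. sqrt L / 12 \<le> \<bar>colprod m A e1 j\<bar>}" "card J = m"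
    by (meson obtain_subset_with_card_n)
  have finJ: "finite J" and Jn: "J \<subseteq> {..<n}" using J(1) finite_subset[of J "{..<n}"] by auto
  have big: "sqrt L / 12 * r \<le> \<bar>colprod m A e j\<bar>" if "j \<in> J" for j
  proof -
    have "sqrt L / 12 \<le> \<bar>colprod m A e j / r\<bar>" using J(1) that unfolding ce1 by blast
    then show ?thesis using r by (simp add: field_simps)
  qed
  \<comment> \<open>The minimiser of the quadratic bound: \<alpha> m sqrt L = r / (12 * 23^2) = r /
    6348.\<close>
  define \<alpha> where "\<alpha> = r / (6348 * m * sqrt L)"
  have \<alpha>: "0 \<le> \<alpha>" using r L by (simp add: \<alpha>_def)
  define c where "c = (\<lambda>j. if j \<in> J then \<alpha> * sgn (colprod m A e j) else 0)"
  define u :: "nat \<Rightarrow> 'a" where "u = (\<lambda>j. of_real (c j))"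
  have cabs: "\<bar>c j\<bar> \<le> (if j \<in> J then \<alpha> else 0)" for j
    using \<alpha> by (auto simp: c_def abs_mult sgn_if)
  have uv: "u \<in> vecs n" using Jn by (force simp: u_def c_def vecs_def)
  have us: "u \<in> sparse n m"
  proof -
    have "card {j. u j \<noteq> 0} \<le> card J" using finJ by (intro card_mono) (auto simp: u_def c_def)
    then show ?thesis using uv J(2) by (simp add: sparse_def)
  qed
  have u1: "l1norm n u \<le> \<alpha> * m"
  proof -
    have "l1norm n u \<le> (\<Sum>j<n. if j \<in> J then \<alpha> else 0)"
      unfolding l1norm_def u_def using cabs by (intro sum_mono) (simp del: if_split_asm)
    also have "\<dots> = (\<Sum>j\<in>J. \<alpha>)" using Jn by (intro sum.mono_neutral_cong_right) auto
    finally show ?thesis using J by (simp add: mult.commute)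
  qed
  have u2: "l2norm n u \<le> \<alpha> * sqrt m"
  proof (rule power2_le_imp_le)
    have "(l2norm n u)\<^sup>2 = (\<Sum>j<n. \<bar>c j\<bar>\<^sup>2)" unfolding l2norm_squared u_def by simp
    also have "\<dots> \<le> (\<Sum>j<n. (if j \<in> J then \<alpha> else 0)\<^sup>2)"
      by (intro sum_mono power_mono cabs) auto
    also have "\<dots> = (\<Sum>j\<in>J. \<alpha>\<^sup>2)" using Jn by (intro sum.mono_neutral_cong_right) auto
    also have "\<dots> = (\<alpha> * sqrt m)\<^sup>2" using J by (simp add: power_mult_distrib mult.commute)
    finally show "(l2norm n u)\<^sup>2 \<le> (\<alpha> * sqrt m)\<^sup>2" .
  qed (use \<alpha> in auto)
  have corr: "\<alpha> * m * (sqrt L / 12 * r) \<le> (\<Sum>i<m. matvec n A u i \<bullet> e i)"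
  proof -
    have "\<alpha> * m * (sqrt L / 12 * r) = (\<Sum>j\<in>J. \<alpha> * (sqrt L / 12 * r))" using J by simp
    also have "\<dots> \<le> (\<Sum>j\<in>J. \<alpha> * \<bar>colprod m A e j\<bar>)" using big \<alpha> by (intro sum_mono mult_left_mono) auto
    also have "\<dots> = (\<Sum>j<n. c j * colprod m A e j)"
      unfolding c_def using Jn by (intro sum.mono_neutral_cong_left) (auto simp: abs_sgn mult_ac)
    also have "\<dots> = (\<Sum>i<m. matvec n A u i \<bullet> e i)" unfolding u_def by (rule inner_matvec_of_real[symmetric])
    finally show ?thesis .
  qed
  have Au: "l2norm m (matvec n A u) \<le> 23 * (\<alpha> * m * sqrt L)"
  proof -
    have "l2norm m (matvec n A u) \<le> 23 * sqrt (m * L) * l2norm n u" by (rule upper[OF us])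
    also have "\<dots> \<le> 23 * sqrt (m * L) * (\<alpha> * sqrt m)" using u2 L by (intro mult_left_mono) auto
    also have "\<dots> = 23 * (\<alpha> * m * sqrt L)" by (simp add: real_sqrt_mult)
    finally show ?thesis .
  qed
  have am: "\<alpha> * m * sqrt L = r / 6348" using m L by (simp add: \<alpha>_def field_simps)
  have "(l2norm m (\<lambda>i. e i - matvec n A u i))\<^sup>2 = r\<^sup>2 - 2 * (\<Sum>i<m. matvec n A u i \<bullet> e i) + (l2norm m (matvec n A u))\<^sup>2"
    unfolding r_def l2norm_squared power2_norm_eq_inner
    by (simp add: inner_diff_left inner_diff_right inner_commute sum.distrib sum_subtractf algebra_simps sum_distrib_left)
  also have "\<dots> \<le> r\<^sup>2 - 2 * (\<alpha> * m * (sqrt L / 12 * r)) + (23 * (\<alpha> * m * sqrt L))\<^sup>2"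
    by (intro add_mono diff_mono mult_left_mono power_mono order.refl corr Au) auto
  also have "\<alpha> * m * (sqrt L / 12 * r) = (\<alpha> * m * sqrt L) * r / 12" by simp
  \<comment> \<open>The minimum is r^2 (1 - 1/76176), and 152352 = 2 * 76176 comes from 1 - 2 x
    being at most (1 - x)^2.\<close>
  also have "r\<^sup>2 - 2 * ((\<alpha> * m * sqrt L) * r / 12) + (23 * (\<alpha> * m * sqrt L))\<^sup>2 \<le> ((1 - 1 / 152352) * r)\<^sup>2"
    unfolding am by (simp add: power2_eq_square field_simps)
  finally have 1: "l2norm m (\<lambda>i. e i - matvec n A u i) \<le> (1 - 1 / 152352) * r"
    by (rule power2_le_imp_le) (use r in simp)
  have 2: "l1norm n u \<le> 1 / (6348 * sqrt L) * r"
    using u1 m L by (simp add: \<alpha>_def)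
  have "\<alpha> * sqrt m = r / (6348 * sqrt m * sqrt L)"
  proof -
    have "\<alpha> * s = r / (6348 * s * sqrt L)" if "real m = s * s" "0 < s" for s
      using that by (simp add: \<alpha>_def)
    from this[of "sqrt m"] m show ?thesis by simp
  qed
  also have "\<dots> \<le> r / (6348 * sqrt m * 1)" using r m L by (intro divide_left_mono mult_left_mono) auto
  finally have 3: "l2norm n u \<le> 1 / (6348 * sqrt m) * r" using u2 by simp
  show ?thesis using uv 1 2 3 by (auto simp: r_def)
qed

lemma matvec_sum: "matvec n A (\<lambda>j. \<Sum>k<K. us k j) i = (\<Sum>k<K. matvec n A (us k) i)"
  unfolding matvec_def sum_distrib_left by (rule sum.swap)

text \<open>Applying the step to successive residuals makes them decay geometrically. The
  corrections form a convergent series with both norms summable, and the partial sums telescope: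
  their image is \<open>e\<close> minus the current residual.\<close>

lemma exact_solution_of_contraction:
  fixes A :: "nat \<times> nat \<Rightarrow> 'a::{real_normed_field, euclidean_space}"
  assumes q: "0 \<le> q" "q < 1" and a: "0 \<le> a" and b: "0 \<le> b"
    and step: "\<And>e. \<exists>u\<in>vecs n. l2norm m (\<lambda>i. e i - matvec n A u i) \<le> q * l2norm m e \<and>
      l1norm n u \<le> a * l2norm m e \<and> l2norm n u \<le> b * l2norm m e"
  shows "\<exists>u\<in>vecs n. (\<forall>i<m. matvec n A u i = e i) \<and>
    l1norm n u \<le> a * l2norm m e / (1 - q) \<and> l2norm n u \<le> b * l2norm m e / (1 - q)"
proof -
  obtain f where f: "\<And>e. f e \<in> vecs n" "\<And>e. l2norm m (\<lambda>i. e i - matvec n A (f e) i) \<le> q * l2norm m e"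
    "\<And>e. l1norm n (f e) \<le> a * l2norm m e" "\<And>e. l2norm n (f e) \<le> b * l2norm m e"
    using step by metis
  define es where "es = rec_nat e (\<lambda>_ e'. \<lambda>i. e' i - matvec n A (f e') i)"
  have es0: "es 0 = e" and esS: "es (Suc k) = (\<lambda>i. es k i - matvec n A (f (es k)) i)" for k
    by (auto simp: es_def)
  define us where "us = (\<lambda>k. f (es k))"
  define r where "r = l2norm m e"
  have r0: "0 \<le> r" by (simp add: r_def)
  have esn: "l2norm m (es k) \<le> q ^ k * r" for k
  proof (induction k)
    case (Suc k)
    have "l2norm m (es (Suc k)) \<le> q * l2norm m (es k)" unfolding esS by (rule f(2))
    also have "\<dots> \<le> q * (q ^ k * r)" using Suc q by (intro mult_left_mono) auto
    finally show ?case by simp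
  qed (simp add: es0 r_def)
  have us1: "l1norm n (us k) \<le> a * r * q ^ k" for k
    using order_trans[OF f(3) mult_left_mono[OF esn a], of k] by (simp add: us_def mult_ac)
  have us2: "l2norm n (us k) \<le> b * r * q ^ k" for k
    using order_trans[OF f(4) mult_left_mono[OF esn b], of k] by (simp add: us_def mult_ac)
  have sq: "summable (\<lambda>k. q ^ k)" using q by (intro summable_geometric) auto
  have geo: "(\<Sum>k<K. c * q ^ k) \<le> c / (1 - q)" if "0 \<le> c" for c K
  proof -
    have "(\<Sum>k<K. q ^ k) \<le> (\<Sum>k. q ^ k)" using q sq by (intro sum_le_suminf) auto
    also have "\<dots> = 1 / (1 - q)" using q by (intro suminf_geometric) auto
    finally have "c * (\<Sum>k<K. q ^ k) \<le> c * (1 / (1 - q))" using that by (intro mult_left_mono)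
    then show ?thesis by (simp add: sum_distrib_left)
  qed
  have summ: "summable (\<lambda>k. us k j)" for j
  proof (rule summable_comparison_test')
    show "summable (\<lambda>k. b * r * q ^ k)" using sq by (intro summable_mult)
    fix k :: nat
    show "norm (us k j) \<le> b * r * q ^ k"
    proof (cases "j < n")
      case True
      then show ?thesis using norm_le_l2norm[OF True, of "us k"] us2[of k] by simp
    next
      case False
      then have "us k j = 0" using f(1)[of "es k"] by (simp add: us_def vecs_def)
      then show ?thesis using b r0 q by simp
    qed
  qed
  define u where "u = (\<lambda>j. \<Sum>k. us k j)"
  define U where "U = (\<lambda>K j. \<Sum>k<K. us k j)"
  have lim: "(\<lambda>K. U K j) \<longlonglongrightarrow> u j" for j
    unfolding U_def u_def by (rule summable_LIMSEQ[OF summ])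
  have uv: "u \<in> vecs n"
    using f(1) by (auto simp: u_def vecs_def us_def)
  have U1: "l1norm n (U K) \<le> a * r / (1 - q)" for K
  proof -
    have "l1norm n (U K) \<le> (\<Sum>k<K. l1norm n (us k))"
    proof (induction K)
      case (Suc K)
      have "l1norm n (U (Suc K)) \<le> l1norm n (U K) + l1norm n (us K)"
        unfolding U_def sum.lessThan_Suc by (rule l1norm_triangle)
      then show ?case using Suc by simp
    qed (simp add: U_def l1norm_def)
    also have "\<dots> \<le> (\<Sum>k<K. a * r * q ^ k)" by (intro sum_mono us1)
    also have "\<dots> \<le> a * r / (1 - q)" using a r0 by (intro geo) auto
    finally show ?thesis .
  qed
  have U2: "l2norm n (U K) \<le> b * r / (1 - q)" for K
  proof -
    have "l2norm n (U K) \<le> (\<Sum>k<K. l2norm n (us k))"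
    proof (induction K)
      case (Suc K)
      have "l2norm n (U (Suc K)) \<le> l2norm n (U K) + l2norm n (us K)"
        unfolding U_def sum.lessThan_Suc by (rule l2norm_triangle)
      then show ?case using Suc by simp
    qed (simp add: U_def l2norm_def)
    also have "\<dots> \<le> (\<Sum>k<K. b * r * q ^ k)" by (intro sum_mono us2)
    also have "\<dots> \<le> b * r / (1 - q)" using b r0 by (intro geo) auto
    finally show ?thesis .
  qed
  have "(\<lambda>K. l1norm n (U K)) \<longlonglongrightarrow> l1norm n u"
    unfolding l1norm_def by (intro tendsto_sum tendsto_norm lim)
  then have 1: "l1norm n u \<le> a * r / (1 - q)" using U1 by (intro LIMSEQ_le_const2) auto
  have "(\<lambda>K. l2norm n (U K)) \<longlonglongrightarrow> l2norm n u"
    unfolding l2norm_def by (intro tendsto_real_sqrt tendsto_sum tendsto_power tendsto_norm lim)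
  then have 2: "l2norm n u \<le> b * r / (1 - q)" using U2 by (intro LIMSEQ_le_const2) auto
  have eU: "matvec n A (U K) i = e i - es K i" for K i
    unfolding U_def matvec_sum by (induction K) (auto simp: es0 esS us_def)
  have "matvec n A u i = e i" if i: "i < m" for i
  proof -
    have "(\<lambda>K. matvec n A (U K) i) \<longlonglongrightarrow> matvec n A u i"
      unfolding matvec_def by (intro tendsto_sum tendsto_mult tendsto_const lim)
    moreover have "(\<lambda>K. es K i) \<longlonglongrightarrow> 0"
    proof (rule Lim_null_comparison)
      show "\<forall>\<^sub>F K in sequentially. norm (es K i) \<le> q ^ K * r"
        using order_trans[OF norm_le_l2norm[OF i] esn] by simp
      show "(\<lambda>K. q ^ K * r) \<longlonglongrightarrow> 0"
        using q LIMSEQ_realpow_zero[of q] tendsto_mult_left_zero by blast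
    qed
    then have "(\<lambda>K. e i - es K i) \<longlonglongrightarrow> e i - 0" by (intro tendsto_diff tendsto_const)
    ultimately show ?thesis unfolding eU using LIMSEQ_unique by fastforce
  qed
  then show ?thesis using uv 1 2 by (auto simp: r_def)
qed

text \<open>Summing the geometric series multiplies the bounds of one step by 152352, and 152352 /
  6348 = 24.\<close>

lemma quotient_property:
  fixes A :: "nat \<times> nat \<Rightarrow> 'a::{real_normed_field, euclidean_space}" and L :: real
  assumes dim: "DIM('a) \<le> 2" and m: "1 \<le> m" and L: "1 \<le> L"
    and upper: "\<And>z. z \<in> sparse n m \<Longrightarrow> l2norm m (matvec n A z) \<le> 23 * sqrt (m * L) * l2norm n z"
    and net: "\<And>w. w \<in> lattice_net m (1 / (600 * sqrt m)) (1200 * m) \<Longrightarrow> 1/2 \<le> l2norm m w \<Longrightarrow>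
       2 * real m < (\<Sum>j<n. if sqrt L / 6 \<le> \<bar>colprod m A w j\<bar> then 1 else 0)"
  shows "\<exists>u\<in>vecs n. (\<forall>i<m. matvec n A u i = e i) \<and>
    l1norm n u \<le> 24 * l2norm m e / sqrt L \<and> l2norm n u \<le> 24 * l2norm m e / sqrt m"
proof -
  have "\<exists>u\<in>vecs n. (\<forall>i<m. matvec n A u i = e i) \<and>
    l1norm n u \<le> 1 / (6348 * sqrt L) * l2norm m e / (1 - (1 - 1 / 152352)) \<and>
    l2norm n u \<le> 1 / (6348 * sqrt m) * l2norm m e / (1 - (1 - 1 / 152352))"
    using L by (intro exact_solution_of_contraction quotient_step[OF dim m L upper net]) auto
  then show ?thesis by (simp add: field_simps)
qed

section \<open>Exceptional events behind the quotient property\<close>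

context gaussian_field
begin

text \<open>At level sqrt L / 6 a column is well correlated with probability at least exp(- L/4 -
  2), and there are n = m exp(L - 1) columns. The expected number beats \<open>m\<close> by the
  factor exp(3 L/4 - 3), which for L at least 16 outweighs the net size exp(1204 m).\<close>

lemma column_event:
  assumes m: "1 \<le> m" and L: "L = ln (exp 1 * n / m)" "16 \<le> L"
  shows "\<exists>E\<in>sets (gauss_matrix m n G). measure (gauss_matrix m n G) E \<le> exp (- real m) \<and>
    (\<forall>A\<in>space (gauss_matrix m n G) - E. \<forall>w\<in>lattice_net m (1 / (600 * sqrt m)) (1200 * m). 1/2 \<le> l2norm m w \<longrightarrow>
       2 * real m < (\<Sum>j<n. if sqrt L / 6 \<le> \<bar>colprod m A w j\<bar> then 1 else 0))"
proof -
  let ?M = "gauss_matrix m n G"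
  interpret prob_space ?M by (rule prob_space_gauss_matrix)
  let ?N = "lattice_net m (1 / (600 * sqrt m)) (1200 * m) :: (nat \<Rightarrow> 'a) set"
  define W where "W = {w \<in> ?N. 1/2 \<le> l2norm m w}"
  define F where "F = (\<lambda>w. {A \<in> space ?M. (\<Sum>j<n. if sqrt L / 6 \<le> \<bar>colprod m A w j\<bar> then 1 else 0) \<le> 2 * real m})"
  have finW: "finite W" by (rule finite_subset[OF _ finite_lattice_net]) (auto simp: W_def)
  have "card W \<le> card ?N" unfolding W_def by (intro card_mono finite_lattice_net) auto
  moreover have "real (card ?N) \<le> exp (1204 * real m)"
    using card_lattice_net_entropy[OF dim_le m order.refl order.refl, of "1 / (600 * sqrt m)" 1200] m
    by (simp add: entropy_bound_def)
  ultimately have cW: "real (card W) \<le> exp (1204 * real m)" by linarith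
  \<comment> \<open>For \<open>n = 0\<close> the convention \<open>ln 0 = 0\<close> would give
    \<open>L = 0\<close>.\<close>
  have npos: "0 < real n"
  proof (rule ccontr)
    assume "\<not> 0 < real n"
    then have "L = 0" unfolding L(1) by simp
    then show False using L by simp
  qed
  have nm: "real n = real m * exp (L - 1)"
    using m npos by (simp add: L(1) exp_diff)
  define p where "p = exp (- (3 * (sqrt L / 6))\<^sup>2 - 2)"
  have p: "p = exp (- (L / 4) - 2)" using L(2) by (simp add: p_def power_mult_distrib power_divide)
  have Fs: "F w \<in> sets ?M" "measure ?M (F w) \<le> exp (2 * real m - n * p / 2)" if "w \<in> W" for w
  proof -
    have w: "1/2 \<le> l2norm m w" and s: "0 \<le> sqrt L / 6" using that L(2) by (auto simp: W_def)
    show "F w \<in> sets ?M" unfolding F_def by (rule colprod_count_tail(1)[OF w s])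
    show "measure ?M (F w) \<le> exp (2 * real m - n * p / 2)"
      unfolding F_def p_def by (rule colprod_count_tail(2)[OF w s])
  qed
  \<comment> \<open>The number e^9 arises at L = 16 and is bounded through e \<ge> 5/2. The
    requirement is half of it above 1207 = 1204 + 2 + 1: net size, count level, remaining
    exponent.\<close>
  have "3814 \<le> (5/2 :: real) ^ 9" by (simp add: power_divide)
  also have "\<dots> \<le> exp 1 ^ 9" using exp_lower_Taylor_quadratic[of 1] by (intro power_mono) auto
  also have "\<dots> = exp 9" by (simp add: exp_of_nat_mult[symmetric])
  also have "\<dots> \<le> exp (3 * L / 4 - 3)" using L(2) by simp
  finally have big: "3814 \<le> exp (3 * L / 4 - 3)" .
  have "real n * p = real m * exp (3 * L / 4 - 3)"
    unfolding nm p by (simp add: mult_exp_exp mult.assoc)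
  then have np: "1207 * real m \<le> n * p / 2" using big m by simp
  have "measure ?M (\<Union>w\<in>W. F w) \<le> real (card W) * exp (2 * real m - n * p / 2)"
    using finW Fs by (intro measure_Union_le_card) (auto intro: finite_measure_axioms)
  also have "\<dots> \<le> exp (1204 * real m) * exp (2 * real m - n * p / 2)"
    using cW by (intro mult_right_mono) auto
  also have "\<dots> \<le> exp (- real m)" using np by (simp add: mult_exp_exp)
  finally have ms: "measure ?M (\<Union>w\<in>W. F w) \<le> exp (- real m)" .
  show ?thesis
  proof (intro bexI[of _ "\<Union>w\<in>W. F w"] conjI ms ballI impI)
    fix A w assume A: "A \<in> space ?M - (\<Union>w\<in>W. F w)" and "w \<in> ?N" "1/2 \<le> l2norm m w"
    then have "A \<notin> F w" by (auto simp: W_def)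
    then show "2 * real m < (\<Sum>j<n. if sqrt L / 6 \<le> \<bar>colprod m A w j\<bar> then 1 else 0)"
      using A by (auto simp: F_def)
  qed (use finW Fs in auto)
qed

text \<open>A single vector chosen before the matrix needs no net. It is applied to the tail of
  \<open>x0\<close>, and this is where \<open>x0\<close> being fixed enters.\<close>

lemma fixed_vector_event:
  shows "\<exists>E\<in>sets (gauss_matrix m n G). measure (gauss_matrix m n G) E \<le> exp (- real m) \<and>
    (\<forall>A\<in>space (gauss_matrix m n G) - E. l2norm m (matvec n A v) \<le> 5 * sqrt m * l2norm n v)"
proof (cases "l2norm n v = 0")
  case True
  then have "matvec n A v i = 0" for A i by (simp add: l2norm_eq_0 matvec_def)
  then have "l2norm m (matvec n A v) = 0" for A by (simp add: l2norm_eq_0)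
  then show ?thesis using True by (intro bexI[of _ "{}"]) auto
next
  case False
  define r where "r = l2norm n v"
  have r: "0 < r" using False l2norm_nonneg[of n v] unfolding r_def by linarith
  let ?M = "gauss_matrix m n G"
  let ?v = "\<lambda>j. (1 / r) *\<^sub>R v j"
  have v1: "l2norm n ?v \<le> 1" unfolding l2norm_scaleR using r by (simp add: r_def)
  let ?E = "{A \<in> space ?M. 20 * real m \<le> (l2norm m (matvec n A ?v))\<^sup>2}"
  note tail = matvec_norm_tail[OF v1, of m "20 * real m"]
  have "measure ?M ?E \<le> 2 ^ m * exp (- (20 * real m / 4))" by (rule tail(2))
  also have "(2::real) ^ m \<le> exp 1 ^ m" using exp_ge_add_one_self[of 1] by (intro power_mono) auto
  then have "2 ^ m * exp (- (20 * real m / 4)) \<le> exp m * exp (- (20 * real m / 4))"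
    by (intro mult_right_mono) (auto simp: exp_of_nat_mult[symmetric])
  also have "\<dots> \<le> exp (- real m)" by (simp add: mult_exp_exp)
  finally have ms: "measure ?M ?E \<le> exp (- real m)" .
  have "l2norm m (matvec n A v) \<le> 5 * sqrt m * r" if "A \<in> space ?M - ?E" for A
  proof -
    have "(l2norm m (matvec n A ?v))\<^sup>2 \<le> (5 * sqrt m)\<^sup>2" using that by (auto simp: power_mult_distrib)
    then have "l2norm m (matvec n A ?v) \<le> 5 * sqrt m" by (rule power2_le_imp_le) simp
    then show ?thesis unfolding matvec_scaleR l2norm_scaleR using r by (simp add: field_simps)
  qed
  then show ?thesis unfolding r_def[symmetric] using ms tail(1) by (intro bexI[of _ ?E] conjI ballI)
qed

end

section \<open>Recovery\<close>

lemma l1norm_restr_le_diff: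
  "l1norm n (restr T a) \<le> l1norm n (restr T b) + l1norm n (restr T (\<lambda>j. b j - a j))"
  unfolding l1norm_def sum.distrib[symmetric]
proof (intro sum_mono)
  fix j
  show "norm (restr T a j) \<le> norm (restr T b j) + norm (restr T (\<lambda>j. b j - a j) j)"
    unfolding restr_def using norm_triangle_sub[of "a j" "b j"] by (simp add: norm_minus_commute)
qed

text \<open>There are finitely many supports, so an optimal one exists. Any sparse \<open>z\<close>,
  whatever its phase, misses at least the part of \<open>x\<close> outside its own support.\<close>

lemma exists_best_support:
  fixes x :: "nat \<Rightarrow> 'a::real_normed_field"
  assumes x: "x \<in> vecs n"
  obtains S where "S \<subseteq> {..<n}" "card S \<le> k" "l2norm n (restr (- S) x) \<le> sigma_k n k x"
proof -
  define Y where "Y = {S. S \<subseteq> {..<n} \<and> card S \<le> k}"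
  have Y: "finite Y" "Y \<noteq> {}"
    unfolding Y_def by (auto intro: finite_subset[of _ "Pow {..<n}"] exI[of _ "{}"])
  define v where "v = (\<lambda>S. l2norm n (restr (- S) x))"
  have "Min (v ` Y) \<in> v ` Y" using Y by (intro Min_in) auto
  then obtain S where S: "S \<in> Y" "v S = Min (v ` Y)" by auto
  have Smin: "v S \<le> v S'" if "S' \<in> Y" for S' unfolding S(2) using Y that by auto
  have le: "v S \<le> l2norm n (\<lambda>j. x j - c * z j)"
    if z: "z \<in> vecs n" "card {j. z j \<noteq> 0} \<le> k" for z :: "nat \<Rightarrow> 'a" and c
  proof -
    have "v S \<le> v {j. z j \<noteq> 0}" using z vecs_support[of z n] by (intro Smin) (auto simp: Y_def)
    also have "\<dots> \<le> l2norm n (\<lambda>j. x j - c * z j)"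
      unfolding v_def by (rule l2norm_mono) (auto simp: restr_def)
    finally show ?thesis .
  qed
  have "v S \<le> sigma_k n k x"
    unfolding sigma_k_def
  proof (rule cInf_greatest)
    have "(\<lambda>_. 0 :: 'a) \<in> vecs n" by (simp add: vecs_def)
    then show "{pdist n x z | z. z \<in> vecs n \<and> card {j. z j \<noteq> 0} \<le> k} \<noteq> {}"
      by (auto intro!: exI[of _ "\<lambda>_. 0 :: 'a"])
    fix y assume "y \<in> {pdist n x z | z. z \<in> vecs n \<and> card {j. z j \<noteq> 0} \<le> k}"
    then obtain z where z: "y = pdist n x z" "z \<in> vecs n" "card {j. z j \<noteq> 0} \<le> k" by auto
    show "v S \<le> y"
      unfolding z(1) pdist_def
    proof (rule cInf_greatest)
      show "{l2norm n (\<lambda>j. x j - c * z j) | c. norm c = 1} \<noteq> {}"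
        using norm_one by blast
    qed (use le z(2,3) in auto)
  qed
  then show ?thesis using that[of S] S(1) by (auto simp: Y_def v_def)
qed

lemma pdist_le:
  assumes "norm c = 1" shows "pdist n x y \<le> l2norm n (\<lambda>j. x j - c * y j)"
  unfolding pdist_def
proof (rule cInf_lower)
  show "bdd_below {l2norm n (\<lambda>j. x j - c * y j) | c. norm c = 1}" by (rule bdd_belowI[of _ 0]) auto
qed (use assms in blast)

section \<open>Recovery on the good event and choice of the parameters\<close>

context gaussian_field
begin

lemma l2norm_add_sub_square:
  fixes x y :: "nat \<Rightarrow> 'a"
  shows "(l2norm n (\<lambda>j. x j + y j))\<^sup>2 = (l2norm n x)\<^sup>2 + 2 * (\<Sum>j<n. x j \<bullet> y j) + (l2norm n y)\<^sup>2"
    and "(l2norm n (\<lambda>j. x j - y j))\<^sup>2 = (l2norm n x)\<^sup>2 - 2 * (\<Sum>j<n. x j \<bullet> y j) + (l2norm n y)\<^sup>2"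
  unfolding l2norm_squared power2_norm_eq_inner
  by (simp_all add: inner_diff_left inner_diff_right inner_add_left inner_add_right inner_commute
      sum.distrib sum_subtractf sum_distrib_left)

text \<open>The form is skew, so the diagonal terms vanish and the two mixed ones add up.\<close>

lemma iota_form_diff_sum:
  assumes "(\<Sum>j<n. x j \<bullet> (\<iota> * y j)) = 0"
  shows "(\<Sum>j<n. (x j - y j) \<bullet> (\<iota> * (x j + y j))) = 0"
proof -
  have z: "v \<bullet> (\<iota> * v) = 0" for v using \<iota>_skew[of v v] by simp
  have "(x j - y j) \<bullet> (\<iota> * (x j + y j)) = 2 * (x j \<bullet> (\<iota> * y j))" for j
    using \<iota>_skew[of "y j" "x j"] by (simp add: distrib_left inner_diff_left inner_add_right z)
  then show ?thesis using assms by (simp flip: sum_distrib_left)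
qed

text \<open>The phaseless equations say that \<open>h = x - y\<close> and \<open>g = x + y\<close> satisfy
  \<open>(A h)\<^sub>i \<bullet> (A g)\<^sub>i = 0\<close>; aligning the global phase makes the product \<open>h \<bullet> (\<iota> * g)\<close> vanish,
  and an error \<open>h\<close> that is large compared with \<open>\<sigma>\<close> forces both \<open>h\<close> and \<open>g\<close> to be
  effectively sparse.\<close>

lemma recovery_deterministic:
  fixes A :: "nat \<times> nat \<Rightarrow> 'a"
  assumes t: "1 \<le> t" "4 * 10 ^ 32 * real k \<le> t" and m: "1 \<le> m"
    and upper: "\<And>z. z \<in> sparse n t \<Longrightarrow> l2norm m (matvec n A z) \<le> M * l2norm n z"
    and M: "0 \<le> M" "M\<^sup>2 \<le> 512 * m"
    and lower: "\<forall>h\<in>lattice_net n (1 / sqrt t) t. \<forall>g\<in>lattice_net n (1 / sqrt t) t.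
       l2norm n h \<le> 1 \<longrightarrow> l2norm n g \<le> 1 \<longrightarrow>
       1/4 \<le> (l2norm n h)\<^sup>2 * (l2norm n g)\<^sup>2 - (\<Sum>j<n. h j \<bullet> (\<iota> * g j))\<^sup>2 \<longrightarrow>
       m / 10240 < (\<Sum>i<m. \<bar>matvec n A h i \<bullet> matvec n A g i\<bar>)"
    and x0: "x0 \<in> vecs n" and S: "S \<subseteq> {..<n}" "card S \<le> k"
    and \<sigma>: "\<sigma> = l2norm n (restr (- S) x0)"
    and u: "u \<in> vecs n" "\<And>i. i < m \<Longrightarrow> matvec n A u i = matvec n A (restr (- S) x0) i"
      "l1norm n u \<le> 10 ^ 17 * sqrt t * \<sigma>" "l2norm n u \<le> 120 * \<sigma>"
    and xs: "xs \<in> Delta1 m n A (\<lambda>i. norm (matvec n A x0 i))"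
  shows "pdist n xs x0 \<le> 10 ^ 34 * \<sigma>"
proof -
  have \<sigma>0: "0 \<le> \<sigma>" by (simp add: \<sigma>)
  have finS: "finite S" using S(1) finite_subset by blast
  \<comment> \<open>A competitor with the measurements of \<open>x0\<close> whose part outside
    \<open>S\<close> has small l1 norm.\<close>
  define y0 where "y0 = (\<lambda>j. restr S x0 j + u j)"
  have y0v: "y0 \<in> vecs n" using x0 u(1) by (auto simp: y0_def vecs_def restr_def)
  have Ay0: "matvec n A y0 i = matvec n A x0 i" if "i < m" for i
  proof -
    have "matvec n A y0 i = matvec n A (\<lambda>j. restr S x0 j + restr (- S) x0 j) i"
      unfolding y0_def matvec_add using u(2)[OF that] by simp
    then show ?thesis by (simp add: restr_split)
  qed
  have xsv: "xs \<in> vecs n" and Axs: "\<And>i. i < m \<Longrightarrow> norm (matvec n A xs i) = norm (matvec n A x0 i)"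
    and xsmin: "l1norm n xs \<le> l1norm n y0"
    using xs y0v Ay0 by (auto simp: Delta1_def)
  obtain c where c: "norm c = 1" "(\<Sum>j<n. xs j \<bullet> (\<iota> * (c * y0 j))) = 0" "0 \<le> (\<Sum>j<n. xs j \<bullet> (c * y0 j))"
    using align[where x=xs and y=y0 and n=n] by blast
  define y where "y = (\<lambda>j. c * y0 j)"
  have yv: "y \<in> vecs n" using y0v by (auto simp: y_def vecs_def)
  have l1y: "l1norm n y = l1norm n y0" using c(1) by (simp add: y_def l1norm_mult)
  define h where "h = (\<lambda>j. xs j - y j)"
  define g where "g = (\<lambda>j. xs j + y j)"
  have hv: "h \<in> vecs n" and gv: "g \<in> vecs n" using xsv yv by (auto simp: h_def g_def vecs_def)
  have zero: "matvec n A h i \<bullet> matvec n A g i = 0" if "i < m" for i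
  proof -
    have "norm (matvec n A y i) = norm (matvec n A xs i)"
      unfolding y_def matvec_mult using c(1) Ay0[OF that] Axs[OF that] by (simp add: norm_mult)
    then have "matvec n A y i \<bullet> matvec n A y i = matvec n A xs i \<bullet> matvec n A xs i"
      by (simp flip: power2_norm_eq_inner)
    then show ?thesis unfolding h_def g_def matvec_diff matvec_add
      by (simp add: inner_diff_left inner_diff_right inner_add_left inner_add_right inner_commute)
  qed
  have B: "(\<Sum>j<n. h j \<bullet> (\<iota> * g j)) = 0"
    unfolding h_def g_def using c(2) by (intro iota_form_diff_sum) (simp add: y_def)
  have xy: "0 \<le> (\<Sum>j<n. xs j \<bullet> y j)" using c(3) by (simp add: y_def)
  have gh: "l2norm n h \<le> l2norm n g"
    by (rule power2_le_imp_le) (use xy in \<open>simp_all add: h_def g_def l2norm_add_sub_square\<close>)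
  have gy: "l2norm n y \<le> l2norm n g"
    by (rule power2_le_imp_le) (use xy in \<open>simp_all add: g_def l2norm_add_sub_square\<close>)
  have sqk: "sqrt k \<le> 1 / (2 * 10 ^ 16) * sqrt t"
  proof (rule power2_le_imp_le)
    show "(sqrt k)\<^sup>2 \<le> (1 / (2 * 10 ^ 16) * sqrt t)\<^sup>2"
      using t(2) by (simp add: power_mult_distrib power_divide field_simps)
  qed simp
  have restrS: "l1norm n (restr S z) \<le> 1 / (2 * 10 ^ 16) * sqrt t * l2norm n z" if "z \<in> vecs n" for z :: "nat \<Rightarrow> 'a"
  proof -
    have "l1norm n (restr S z) \<le> sqrt k * l2norm n (restr S z)"
      by (rule l1norm_sparse[OF restr_sparse[OF that finS S(2)]])
    also have "\<dots> \<le> 1 / (2 * 10 ^ 16) * sqrt t * l2norm n z"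
      using sqk l2norm_restr_le[of n S z] by (intro mult_mono) auto
    finally show ?thesis .
  qed
  have yc: "l1norm n (restr (- S) y) \<le> l1norm n u"
    using c(1) by (intro l1norm_mono) (auto simp: restr_def y_def y0_def norm_mult)
  \<comment> \<open>The cone argument: minimality bounds \<open>h\<close> outside \<open>S\<close>
    by \<open>h\<close> on \<open>S\<close> plus twice the l1 norm of \<open>y\<close> outside
    \<open>S\<close>, where \<open>y\<close> is just \<open>c * u\<close>.\<close>
  have hl1: "l1norm n h \<le> 1 / 10 ^ 16 * sqrt t * l2norm n h + 2 * l1norm n u"
  proof -
    have "l1norm n xs = l1norm n (restr S xs) + l1norm n (restr (- S) xs)"
      "l1norm n y = l1norm n (restr S y) + l1norm n (restr (- S) y)"
      "l1norm n h = l1norm n (restr S h) + l1norm n (restr (- S) h)"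
      by (rule l1norm_restr_split)+
    moreover have "l1norm n (restr S y) \<le> l1norm n (restr S xs) + l1norm n (restr S h)"
      unfolding h_def by (rule l1norm_restr_le_diff)
    moreover have "l1norm n (restr (- S) h) \<le> l1norm n (restr (- S) xs) + l1norm n (restr (- S) y)"
      unfolding l1norm_def sum.distrib[symmetric]
      by (intro sum_mono) (auto simp: restr_def h_def norm_triangle_ineq4)
    ultimately show ?thesis using xsmin l1y yc restrS[OF hv] by (simp add: field_simps)
  qed
  have gl1: "l1norm n g \<le> 1 / 10 ^ 16 * sqrt t * l2norm n g + 2 * l1norm n u"
  proof -
    have "l1norm n g \<le> l1norm n xs + l1norm n y" unfolding g_def by (rule l1norm_triangle)
    also have "\<dots> \<le> 2 * l1norm n y" using xsmin l1y by simp
    also have "l1norm n y = l1norm n (restr S y) + l1norm n (restr (- S) y)" by (rule l1norm_restr_split)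
    also have "\<dots> \<le> 1 / (2 * 10 ^ 16) * sqrt t * l2norm n g + l1norm n u"
      using restrS[OF yv] yc mult_left_mono[OF gy, of "1 / (2 * 10 ^ 16) * sqrt t"] by simp
    finally show ?thesis by (simp add: field_simps)
  qed
  have hs: "l2norm n h \<le> 2 * 10 ^ 33 * \<sigma>"
  proof (rule ccontr)
    assume "\<not> l2norm n h \<le> 2 * 10 ^ 33 * \<sigma>"
    then have big: "2 * 10 ^ 33 * \<sigma> \<le> l2norm n h" and hpos: "0 < l2norm n h"
      using \<sigma>0 by (auto simp: not_le intro: le_less_trans)
    then have gpos: "0 < l2norm n g" using gh by linarith
    \<comment> \<open>The number 2 * 10^33 is what turns 2 * 10^17 \<open>sqrt t * \<sigma>\<close>
      into at most 10^(-16) \<open>sqrt t\<close> times the norm of \<open>h\<close>.\<close>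
    have u1: "2 * l1norm n u \<le> 1 / 10 ^ 16 * sqrt t * l2norm n h"
    proof -
      have "2 * l1norm n u \<le> 1 / 10 ^ 16 * sqrt t * (2 * 10 ^ 33 * \<sigma>)" using u(3) by (simp add: mult_ac)
      also have "\<dots> \<le> 1 / 10 ^ 16 * sqrt t * l2norm n h" using big by (intro mult_left_mono) auto
      finally show ?thesis .
    qed
    have "1 / 10 ^ 16 * sqrt t * l2norm n h \<le> 1 / 10 ^ 16 * sqrt t * l2norm n g"
      using gh by (intro mult_left_mono) auto
    then have h2: "l1norm n h \<le> 2 / 10 ^ 16 * sqrt t * l2norm n h"
      and g2: "l1norm n g \<le> 2 / 10 ^ 16 * sqrt t * l2norm n g"
      using hl1 gl1 u1 by (simp_all add: field_simps)
    define a where "a = 1 / l2norm n h"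
    define b where "b = 1 / l2norm n g"
    have ab: "0 < a" "0 < b" using hpos gpos by (auto simp: a_def b_def)
    show False
    proof (rule inner_not_all_zero[OF t(1) m upper M lower])
      show "(\<lambda>j. a *\<^sub>R h j) \<in> vecs n" "(\<lambda>j. b *\<^sub>R g j) \<in> vecs n" using hv gv by (auto simp: vecs_def)
      show "l2norm n (\<lambda>j. a *\<^sub>R h j) = 1" "l2norm n (\<lambda>j. b *\<^sub>R g j) = 1"
        unfolding l2norm_scaleR using hpos gpos by (auto simp: a_def b_def)
      show "l1norm n (\<lambda>j. a *\<^sub>R h j) \<le> 2 / 10 ^ 16 * sqrt t" "l1norm n (\<lambda>j. b *\<^sub>R g j) \<le> 2 / 10 ^ 16 * sqrt t"
        unfolding l1norm_scaleR using hpos gpos h2 g2 by (auto simp: a_def b_def field_simps)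
      have "(\<Sum>j<n. a *\<^sub>R h j \<bullet> (\<iota> * b *\<^sub>R g j)) = a * b * (\<Sum>j<n. h j \<bullet> (\<iota> * g j))"
        by (simp add: sum_distrib_left mult_ac)
      then show "(\<Sum>j<n. a *\<^sub>R h j \<bullet> (\<iota> * b *\<^sub>R g j)) = 0" using B by simp
      show "matvec n A (\<lambda>j. a *\<^sub>R h j) i \<bullet> matvec n A (\<lambda>j. b *\<^sub>R g j) i = 0" if "i < m" for i
        unfolding matvec_scaleR using zero[OF that] by simp
    qed
  qed
  have "pdist n xs x0 \<le> l2norm n (\<lambda>j. xs j - c * x0 j)" by (rule pdist_le[OF c(1)])
  also have "\<dots> = l2norm n (\<lambda>j. h j + c * (u j - restr (- S) x0 j))"
    by (rule l2norm_cong) (auto simp: h_def y_def y0_def restr_def algebra_simps)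
  also have "\<dots> \<le> l2norm n h + l2norm n (\<lambda>j. c * (u j - restr (- S) x0 j))" by (rule l2norm_triangle)
  also have "l2norm n (\<lambda>j. c * (u j - restr (- S) x0 j)) = l2norm n (\<lambda>j. u j - restr (- S) x0 j)"
    using c(1) by (simp add: l2norm_mult)
  also have "\<dots> \<le> l2norm n u + \<sigma>" unfolding \<sigma> by (rule l2norm_triangle_diff)
  also have "l2norm n h + (l2norm n u + \<sigma>) \<le> 10 ^ 34 * \<sigma>" using hs u(4) \<sigma>0 by simp
  finally show ?thesis by simp
qed

text \<open>Splitting ln (e N / t) = L + ln (m / t), the first part contributes t L. For the second,
  ln (m / t) is at most 2 sqrt (m / t), which leaves 2 sqrt (t m), at most 2 m / 10^12.\<close>

lemma entropy_bound_small:
  fixes m N t :: nat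
  assumes m: "1 \<le> m" "m \<le> N" and L: "L = ln (exp 1 * N / m)"
    and t: "1 \<le> t" "real t \<le> m / L / 10 ^ 24"
  shows "entropy_bound N t \<le> 3 / 10 ^ 12 * m"
proof -
  have L1: "1 \<le> L" unfolding L using m by (subst ln_ge_iff) (auto simp: field_simps)
  have tL: "t * L \<le> m / 10 ^ 24" using t(2) L1 by (simp add: field_simps)
  have "real t * 1 \<le> t * L" using L1 by (intro mult_left_mono) auto
  then have tm: "real t \<le> m / 10 ^ 24" using tL by simp
  have "ln (exp 1 * N / t) = ln (exp 1 * N / m * (m / t))" using m by simp
  also have "\<dots> = L + ln (m / t)" unfolding L using m t by (subst ln_mult) auto
  finally have E: "entropy_bound N t = t * L + t * ln (m / t)" by (simp add: entropy_bound_def distrib_left)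
  have "ln (m / t) = 2 * ln (sqrt (m / t))" using m t by (simp add: ln_sqrt)
  also have "\<dots> \<le> 2 * sqrt (m / t)" using ln_bound[of "sqrt (m / t)"] m t by simp
  finally have "t * ln (m / t) \<le> t * (2 * sqrt (m / t))" by (intro mult_left_mono) auto
  also have "\<dots> = 2 * sqrt (t * m)"
    using t by (simp add: real_sqrt_divide real_sqrt_mult field_simps)
  also have "sqrt (t * m) \<le> sqrt ((m / 10 ^ 12)\<^sup>2)"
    using mult_right_mono[OF tm, of m] by (intro real_sqrt_le_mono) (simp add: power2_eq_square)
  finally have "t * ln (m / t) \<le> 2 * (m / 10 ^ 12)" by simp
  then show ?thesis using E tL by simp
qed

text \<open>The factor 5 counts the events: one for the sparse operator bound, one for the pair
  products, and up to three for the replacement of the tail.\<close>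

theorem recovery_gaussian:
  assumes x0: "x0 \<in> vecs n" and k: "1 \<le> k" "k \<le> n"
    and m: "10 ^ 57 * real k * ln (exp 1 * real n / real k) \<le> real m"
  shows "recovery_whp G m n k x0 (10 ^ 34) (1 - 5 * exp (- (m / 3355443200)))"
proof -
  let ?M = "gauss_matrix m n G"
  interpret prob_space ?M by (rule prob_space_gauss_matrix)
  have "1 \<le> ln (exp 1 * real n / real k)" using k by (subst ln_ge_iff) (auto simp: field_simps)
  then have "10 ^ 57 * real k * 1 \<le> 10 ^ 57 * real k * ln (exp 1 * real n / real k)" by (intro mult_left_mono) auto
  then have mk: "10 ^ 57 * real k \<le> m" using m by simp
  have "real k \<le> m" using order_trans[OF mult_right_mono[of 1 "10 ^ 57" "real k"] mk] by simp
  then have m1: "1 \<le> m" and km: "k \<le> m" using k by linarith+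
  \<comment> \<open>Keeps L \<ge> 1 and t \<le> N also when there are more measurements than
    coordinates.\<close>
  define N where "N = max n m"
  have N: "n \<le> N" "m \<le> N" by (auto simp: N_def)
  define L where "L = ln (exp 1 * real N / real m)"
  have L1: "1 \<le> L" unfolding L_def using m1 N by (subst ln_ge_iff) (auto simp: field_simps)
  have Ck: "10 ^ 57 * real k \<le> m / L"
  proof (cases "n \<le> m")
    case True
    then have "L = 1" using m1 by (simp add: L_def N_def max_def)
    then show ?thesis using mk by simp
  next
    case False
    then have "L \<le> ln (exp 1 * real n / real k)"
      unfolding L_def N_def using km k m1 by (subst ln_le_cancel_iff) (auto simp: frac_le)
    then have "10 ^ 57 * real k * L \<le> m" using m order_trans[OF mult_left_mono] by fastforce
    then show ?thesis using L1 by (simp add: field_simps)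
  qed
  \<comment> \<open>A sparsity level with entropy at most 3 m / 10^12. As 10^57 = 10^24 * 10^33,
    even after rounding down it exceeds 4 * 10^32 k.\<close>
  define t where "t = nat \<lfloor>m / L / 10 ^ 24\<rfloor>"
  have big: "10 ^ 33 * real k \<le> m / L / 10 ^ 24" using Ck by simp
  then have big': "1000000000000000000000000000000000 * real k \<le> m / L / 10 ^ 24" by simp
  have k1: "1 \<le> real k" using k by simp
  have ge2: "2 \<le> m / L / 10 ^ 24" using big' k1 by linarith
  then have "real t = of_int \<lfloor>m / L / 10 ^ 24\<rfloor>" by (simp add: t_def)
  then have t_le: "real t \<le> m / L / 10 ^ 24" and t_ge: "m / L / 10 ^ 24 - 1 \<le> real t" by linarith+
  have "400000000000000000000000000000000 * real k \<le> t" using t_ge big' k1 by linarith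
  then have tk: "4 * 10 ^ 32 * real k \<le> t" by simp
  have t1: "1 \<le> t" using t_ge ge2 by linarith
  have "m / L / 10 ^ 24 \<le> 2 * real t" using t_ge ge2 by linarith
  then have t2: "m / L \<le> 2 * 10 ^ 24 * real t" by simp
  have "m / L \<le> m / 1" using L1 m1 by (intro divide_left_mono) auto
  then have "real t \<le> m" using t_le by simp
  then have tN: "t \<le> N" using N by simp
  have E3: "entropy_bound N t \<le> 3 / 10 ^ 12 * m" by (rule entropy_bound_small[OF m1 N(2) L_def t1 t_le])
  obtain S where S: "S \<subseteq> {..<n}" "card S \<le> k" "l2norm n (restr (- S) x0) \<le> sigma_k n k x0"
    using exists_best_support[OF x0] by blast
  define v where "v = restr (- S) x0"
  have vv: "v \<in> vecs n" using x0 by (simp add: v_def restr_vecs)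
  define \<sigma> where "\<sigma> = l2norm n v"
  have \<sigma>0: "0 \<le> \<sigma>" by (simp add: \<sigma>_def)
  obtain E1 where E1: "E1 \<in> sets ?M" "measure ?M E1 \<le> exp (- real m)"
    "\<And>A z. A \<in> space ?M - E1 \<Longrightarrow> z \<in> sparse n t \<Longrightarrow>
       l2norm m (matvec n A z) \<le> 16 * sqrt (m + entropy_bound N t) * l2norm n z"
    using sparse_bound_event[OF t1 tN N(1), of m] by blast
  obtain E2 where E2: "E2 \<in> sets ?M" "measure ?M E2 \<le> exp (- (m / 3355443200))"
    "\<And>A. A \<in> space ?M - E2 \<Longrightarrow> \<forall>h\<in>lattice_net n (1 / sqrt t) t. \<forall>g\<in>lattice_net n (1 / sqrt t) t.
       l2norm n h \<le> 1 \<longrightarrow> l2norm n g \<le> 1 \<longrightarrow>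
       1/4 \<le> (l2norm n h)\<^sup>2 * (l2norm n g)\<^sup>2 - (\<Sum>j<n. h j \<bullet> (\<iota> * g j))\<^sup>2 \<longrightarrow>
       m / 10240 < (\<Sum>i<m. \<bar>matvec n A h i \<bullet> matvec n A g i\<bar>)"
    using inner_lower_event[OF t1 tN N(1), of m] E3 by fastforce
  have ex: "\<exists>E\<in>sets ?M. measure ?M E \<le> 3 * exp (- real m) \<and> (\<forall>A\<in>space ?M - E.
      \<exists>u\<in>vecs n. (\<forall>i<m. matvec n A u i = matvec n A v i) \<and> l1norm n u \<le> 10 ^ 17 * sqrt t * \<sigma> \<and> l2norm n u \<le> 120 * \<sigma>)"
  \<comment> \<open>For small L, \<open>n\<close> is at most a constant times \<open>t\<close>, so
    the trivial l1 bound with factor \<open>sqrt n\<close> suffices and the tail itself serves as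
    \<open>u\<close>. The value 16 is what \<open>column_event\<close> requires.\<close>
  proof (cases "16 \<le> L")
    case False
    have "exp (L - 1) \<le> exp 15" using False by simp
    also have "exp (15::real) = exp 1 ^ 15" by (simp add: exp_of_nat_mult[symmetric])
    also have "\<dots> \<le> 3 ^ 15" using exp_le by (intro power_mono) auto
    finally have "exp (L - 1) \<le> 3 ^ 15" .
    moreover have "exp (L - 1) = N / m" using m1 N by (simp add: L_def exp_diff)
    ultimately have "real N \<le> 3 ^ 15 * m" using m1 by (simp add: field_simps)
    moreover have "real m \<le> 16 * (2 * 10 ^ 24 * real t)"
    proof -
      have "real m = L * (m / L)" using L1 by simp
      also have "\<dots> \<le> 16 * (2 * 10 ^ 24 * real t)" using False L1 t2 by (intro mult_mono) auto
      finally show ?thesis .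
    qed
    ultimately have "real n \<le> (10 ^ 17 * sqrt t)\<^sup>2" using N(1) by (simp add: power_mult_distrib)
    then have "sqrt n \<le> 10 ^ 17 * sqrt t" by (intro real_le_lsqrt) auto
    then have "l1norm n v \<le> 10 ^ 17 * sqrt t * \<sigma>"
      using l1norm_le_sqrt[of n v] mult_right_mono[OF _ \<sigma>0] unfolding \<sigma>_def by (meson order_trans)
    moreover have "l2norm n v \<le> 120 * \<sigma>" using \<sigma>0 by (simp add: \<sigma>_def)
    ultimately show ?thesis using vv by (intro bexI[of _ "{}"]) auto
  next
    case True
    then have nm: "m < n" using m1 by (auto simp: L_def N_def max_def split: if_splits)
    then have Nn: "N = n" by (simp add: N_def)
    obtain F1 where F1: "F1 \<in> sets ?M" "measure ?M F1 \<le> exp (- real m)"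
      "\<And>A z. A \<in> space ?M - F1 \<Longrightarrow> z \<in> sparse n m \<Longrightarrow>
         l2norm m (matvec n A z) \<le> 16 * sqrt (m + entropy_bound N m) * l2norm n z"
      using sparse_bound_event[OF m1 N(2,1), of m] by blast
    obtain F2 where F2: "F2 \<in> sets ?M" "measure ?M F2 \<le> exp (- real m)"
      "\<And>A w. A \<in> space ?M - F2 \<Longrightarrow> w \<in> lattice_net m (1 / (600 * sqrt m)) (1200 * m) \<Longrightarrow> 1/2 \<le> l2norm m w \<Longrightarrow>
         2 * real m < (\<Sum>j<n. if sqrt L / 6 \<le> \<bar>colprod m A w j\<bar> then 1 else 0)"
      using column_event[OF m1 L_def[unfolded Nn] True] by blast
    obtain F3 where F3: "F3 \<in> sets ?M" "measure ?M F3 \<le> exp (- real m)"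
      "\<And>A. A \<in> space ?M - F3 \<Longrightarrow> l2norm m (matvec n A v) \<le> 5 * sqrt m * l2norm n v"
      using fixed_vector_event[of m n v] by blast
    have F: "F1 \<union> F2 \<union> F3 \<in> sets ?M" using F1 F2 F3 by auto
    have "measure ?M (F1 \<union> F2 \<union> F3) \<le> measure ?M F1 + measure ?M F2 + measure ?M F3"
      using F1(1) F2(1) F3(1) measure_Un_le[of "F1 \<union> F2" ?M F3] measure_Un_le[of F1 ?M F2] by auto
    then have mF: "measure ?M (F1 \<union> F2 \<union> F3) \<le> 3 * exp (- real m)" using F1(2) F2(2) F3(2) by simp
    have "\<exists>u\<in>vecs n. (\<forall>i<m. matvec n A u i = matvec n A v i) \<and> l1norm n u \<le> 10 ^ 17 * sqrt t * \<sigma> \<and> l2norm n u \<le> 120 * \<sigma>"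
      if A: "A \<in> space ?M - (F1 \<union> F2 \<union> F3)" for A
    proof -
      have A': "A \<in> space ?M - F1" "A \<in> space ?M - F2" "A \<in> space ?M - F3" using A by auto
      \<comment> \<open>At sparsity \<open>m\<close> the entropy is m L, and 16^2 * 2 = 512 is at
        most 23^2 = 529.\<close>
      have "16 * sqrt (m + entropy_bound N m) \<le> 23 * sqrt (m * L)"
      proof (rule power2_le_imp_le)
        have e: "entropy_bound N m = m * L" by (simp add: entropy_bound_def L_def)
        have "real m \<le> L * real m" using L1 mult_right_mono[of 1 L "real m"] by simp
        then show "(16 * sqrt (m + entropy_bound N m))\<^sup>2 \<le> (23 * sqrt (m * L))\<^sup>2"
          using L1 by (simp add: e power_mult_distrib mult.commute)
      qed (use L1 in simp)
      then have up: "l2norm m (matvec n A z) \<le> 23 * sqrt (m * L) * l2norm n z" if "z \<in> sparse n m" for z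
        by (rule order_trans[OF F1(3)[OF A'(1) that] mult_right_mono]) simp
      obtain u where u: "u \<in> vecs n" "\<forall>i<m. matvec n A u i = matvec n A v i"
        "l1norm n u \<le> 24 * l2norm m (matvec n A v) / sqrt L" "l2norm n u \<le> 24 * l2norm m (matvec n A v) / sqrt m"
        using quotient_property[OF dim_le m1 L1 up F2(3)[OF A'(2)], of "matvec n A v"] by blast
      have Av: "l2norm m (matvec n A v) \<le> 5 * sqrt m * \<sigma>" unfolding \<sigma>_def by (rule F3(3)[OF A'(3)])
      have "24 * l2norm m (matvec n A v) / sqrt L \<le> 24 * (5 * sqrt m * \<sigma>) / sqrt L"
        using Av L1 by (intro divide_right_mono mult_left_mono) auto
      also have "\<dots> = 120 * sqrt (m / L) * \<sigma>" by (simp add: real_sqrt_divide)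
      also have "\<dots> \<le> 10 ^ 17 * sqrt t * \<sigma>"
      proof (intro mult_right_mono \<sigma>0)
        show "120 * sqrt (m / L) \<le> 10 ^ 17 * sqrt t"
        proof (rule power2_le_imp_le)
          show "(120 * sqrt (m / L))\<^sup>2 \<le> (10 ^ 17 * sqrt t)\<^sup>2"
            using t2 L1 by (simp add: power_mult_distrib)
        qed simp
      qed
      finally have 1: "l1norm n u \<le> 10 ^ 17 * sqrt t * \<sigma>" using u(3) by simp
      have "24 * l2norm m (matvec n A v) / sqrt m \<le> 24 * (5 * sqrt m * \<sigma>) / sqrt m"
        using Av by (intro divide_right_mono mult_left_mono) auto
      also have "\<dots> = 120 * \<sigma>" using m1 by simp
      finally have 2: "l2norm n u \<le> 120 * \<sigma>" using u(4) by simp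
      show ?thesis using u(1,2) 1 2 by blast
    qed
    then show ?thesis using F mF by (intro bexI[of _ "F1 \<union> F2 \<union> F3"]) auto
  qed
  obtain E3' where E3: "E3' \<in> sets ?M" "measure ?M E3' \<le> 3 * exp (- real m)"
    "\<And>A. A \<in> space ?M - E3' \<Longrightarrow> \<exists>u\<in>vecs n. (\<forall>i<m. matvec n A u i = matvec n A v i) \<and>
       l1norm n u \<le> 10 ^ 17 * sqrt t * \<sigma> \<and> l2norm n u \<le> 120 * \<sigma>"
    using ex by blast
  define E where "E = E1 \<union> E2 \<union> E3'"
  have Es: "E \<in> sets ?M" using E1 E2 E3 by (auto simp: E_def)
  have "measure ?M E \<le> measure ?M E1 + measure ?M E2 + measure ?M E3'"
    unfolding E_def using E1(1) E2(1) E3(1) measure_Un_le[of "E1 \<union> E2" ?M E3'] measure_Un_le[of E1 ?M E2] by auto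
  moreover have "exp (- real m) \<le> exp (- (m / 3355443200))" by simp
  ultimately have mE: "measure ?M E \<le> 5 * exp (- (m / 3355443200))" using E1(2) E2(2) E3(2) by linarith
  have "pdist n xs x0 \<le> 10 ^ 34 * sigma_k n k x0"
    if A: "A \<in> space ?M - E" and xs: "xs \<in> Delta1 m n A (\<lambda>i. norm (matvec n A x0 i))" for A xs
  proof -
    have A': "A \<in> space ?M - E1" "A \<in> space ?M - E2" "A \<in> space ?M - E3'" using A by (auto simp: E_def)
    obtain u where u: "u \<in> vecs n" "\<And>i. i < m \<Longrightarrow> matvec n A u i = matvec n A v i"
       "l1norm n u \<le> 10 ^ 17 * sqrt t * \<sigma>" "l2norm n u \<le> 120 * \<sigma>" using E3(3)[OF A'(3)] by blast
    have eb0: "0 \<le> entropy_bound N t" using entropy_bound_ge[OF t1 tN] by linarith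
    have M0: "0 \<le> 16 * sqrt (m + entropy_bound N t)" using eb0 by simp
    have "entropy_bound N t \<le> m"
      using entropy_bound_small[OF m1 N(2) L_def t1 t_le] by simp
    then have M2: "(16 * sqrt (m + entropy_bound N t))\<^sup>2 \<le> 512 * m" using eb0 by (simp add: power_mult_distrib)
    have "pdist n xs x0 \<le> 10 ^ 34 * \<sigma>"
      by (rule recovery_deterministic[OF t1 tk m1 E1(3)[OF A'(1)] M0 M2 E2(3)[OF A'(2)] x0 S(1,2) _ u(1) _ u(3,4) xs])
         (use u(2) in \<open>auto simp: \<sigma>_def v_def\<close>)
    also have "\<dots> \<le> 10 ^ 34 * sigma_k n k x0" using S(3) by (simp add: \<sigma>_def v_def)
    finally show ?thesis .
  qed
  moreover have "1 - 5 * exp (- (m / 3355443200)) \<le> measure ?M (space ?M - E)"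
    using mE Es by (simp add: prob_compl)
  ultimately show ?thesis
    unfolding recovery_whp_def using Es by (intro bexI[of _ "space ?M - E"]) auto
qed

end

section \<open>The real and the complex Gaussian law\<close>

definition linfun :: "'p set \<Rightarrow> ('p \<Rightarrow> 'a::real_inner) \<Rightarrow> ('p \<Rightarrow> 'a) \<Rightarrow> real" where
  "linfun P e a = (\<Sum>p\<in>P. a p \<bullet> e p)"

definition sqnorm :: "'p set \<Rightarrow> ('p \<Rightarrow> 'a::real_inner) \<Rightarrow> real" where
  "sqnorm P e = (\<Sum>p\<in>P. (norm (e p))\<^sup>2)"

lemma sqnorm_nonneg: "0 \<le> sqnorm P e"
  by (simp add: sqnorm_def sum_nonneg)

lemma sqnorm_add: "sqnorm P (\<lambda>p. e p + f p) = sqnorm P e + 2 * (\<Sum>p\<in>P. e p \<bullet> f p) + sqnorm P f"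
  and sqnorm_diff: "sqnorm P (\<lambda>p. e p - f p) = sqnorm P e - 2 * (\<Sum>p\<in>P. e p \<bullet> f p) + sqnorm P f"
  unfolding sqnorm_def power2_norm_eq_inner
  by (simp_all add: inner_diff_left inner_diff_right inner_add_left inner_add_right inner_commute
      sum.distrib sum_subtractf sum_distrib_left)

lemma linfun_add: "linfun P (\<lambda>p. e p + f p) a = linfun P e a + linfun P f a"
  and linfun_diff: "linfun P (\<lambda>p. e p - f p) a = linfun P e a - linfun P f a"
  by (simp_all add: linfun_def inner_add_right inner_diff_right sum.distrib sum_subtractf)

text \<open>Every real marginal in direction \<open>e\<close> is centred normal with variance
  \<tau>^2 times the squared norm of \<open>e\<close>: \<tau> is 1 over the reals and sqrt (1/2)
  over the complex numbers. All moments below follow from this alone.\<close>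

locale isotropic_normal =
  fixes G :: "'a::euclidean_space measure" and \<tau> :: real
  assumes G_prob: "prob_space G" and G_sets: "sets G = sets borel" and \<tau>_pos: "0 < \<tau>"
    and marginal: "\<And>e. e \<noteq> 0 \<Longrightarrow> distributed G lborel (\<lambda>z. z \<bullet> e) (normal_density 0 (\<tau> * norm e))"
begin

lemma prob_space_P: "prob_space (PiM P (\<lambda>_. G))"
  by (rule prob_space_PiM) (rule G_prob)

lemma linfun_measurable: "linfun P e \<in> borel_measurable (PiM P (\<lambda>_. G))"
proof -
  have "(\<lambda>a. a p) \<in> borel_measurable (PiM P (\<lambda>_. G))" if "p \<in> P" for p
    using measurable_component_singleton[OF that, of "\<lambda>_. G"] G_sets by (simp cong: measurable_cong_sets)
  then show ?thesis unfolding linfun_def by (intro borel_measurable_sum borel_measurable_inner) auto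
qed

text \<open>The sum rule for independent normals needs positive deviations, so zero coefficients are
  dropped first.\<close>

lemma linfun_distributed:
  assumes P: "finite P" and e: "0 < sqnorm P e"
  shows "distributed (PiM P (\<lambda>_. G)) lborel (linfun P e) (normal_density 0 (\<tau> * sqrt (sqnorm P e)))"
proof -
  let ?M = "PiM P (\<lambda>_. G)"
  interpret prob_space ?M by (rule prob_space_P)
  define P' where "P' = {p \<in> P. e p \<noteq> 0}"
  have P': "finite P'" "P' \<subseteq> P" using P by (auto simp: P'_def)
  have sq: "sqnorm P e = (\<Sum>p\<in>P'. (norm (e p))\<^sup>2)"
    unfolding sqnorm_def P'_def using P by (intro sum.mono_neutral_right) auto
  have "P' \<noteq> {}" using e sq by auto
  have "indep_vars (\<lambda>_. G) (\<lambda>p a. a p) P'"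
    using indep_vars_subset[OF indep_vars_PiM_components[OF G_prob] P'(2)] .
  then have ind: "indep_vars (\<lambda>_. borel) (\<lambda>p a. a p \<bullet> e p) P'"
  proof (rule indep_vars_compose2)
    show "(\<lambda>z. z \<bullet> e p) \<in> borel_measurable G" for p
      using G_sets by (simp cong: measurable_cong_sets)
  qed
  have D: "distributed ?M lborel (\<lambda>a. a p \<bullet> e p) (normal_density 0 (\<tau> * norm (e p)))" if p: "p \<in> P'" for p
  proof -
    have pP: "p \<in> P" and ep: "e p \<noteq> 0" using p by (auto simp: P'_def)
    note m = marginal[OF ep, unfolded distributed_def]
    have c: "(\<lambda>a. a p) \<in> measurable ?M G" by (rule measurable_component_singleton[OF pP])
    have "distr ?M lborel (\<lambda>a. a p \<bullet> e p) = distr (distr ?M G (\<lambda>a. a p)) lborel (\<lambda>z. z \<bullet> e p)"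
      by (subst distr_distr[OF conjunct2[OF conjunct2[OF m]] c]) (simp add: comp_def)
    also have "distr ?M G (\<lambda>a. a p) = G"
      using distr_PiM_component[of P "\<lambda>_. G" p] G_prob pP by simp
    also have "distr G lborel (\<lambda>z. z \<bullet> e p) = density lborel (normal_density 0 (\<tau> * norm (e p)))" using m by simp
    finally have "distr ?M lborel (\<lambda>a. a p \<bullet> e p) = density lborel (normal_density 0 (\<tau> * norm (e p)))" .
    moreover have "(\<lambda>a. a p \<bullet> e p) \<in> measurable ?M lborel"
      by (rule measurable_compose[OF c conjunct2[OF conjunct2[OF m]]])
    ultimately show ?thesis using conjunct1[OF conjunct2[OF m]] unfolding distributed_def by blast
  qed
  have "distributed ?M lborel (\<lambda>a. \<Sum>p\<in>P'. a p \<bullet> e p)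
      (normal_density (\<Sum>p\<in>P'. 0) (sqrt (\<Sum>p\<in>P'. (\<tau> * norm (e p))\<^sup>2)))"
    using \<tau>_pos by (intro sum_indep_normal P'(1) \<open>P' \<noteq> {}\<close> ind D) (simp_all add: P'_def)
  moreover have "(\<lambda>a. \<Sum>p\<in>P'. a p \<bullet> e p) = linfun P e"
    unfolding linfun_def P'_def using P by (intro ext sum.mono_neutral_left) auto
  moreover have "sqrt (\<Sum>p\<in>P'. (\<tau> * norm (e p))\<^sup>2) = \<tau> * sqrt (sqnorm P e)"
    using \<tau>_pos by (simp add: power_mult_distrib real_sqrt_mult sq flip: sum_distrib_left)
  ultimately show ?thesis by simp
qed

lemma linfun_zero:
  assumes "finite P" "sqnorm P e = 0" shows "linfun P e a = 0"
proof -
  have "\<forall>p\<in>P. (norm (e p))\<^sup>2 = 0" using assms unfolding sqnorm_def by (subst (asm) sum_nonneg_eq_0_iff) auto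
  then show ?thesis by (simp add: linfun_def)
qed

lemma linfun_fourth_moment:
  assumes P: "finite P"
  shows "has_bochner_integral (PiM P (\<lambda>_. G)) (\<lambda>a. (linfun P e a) ^ 4) (3 * \<tau> ^ 4 * (sqnorm P e)\<^sup>2)"
proof (cases "sqnorm P e = 0")
  case True
  then show ?thesis using linfun_zero[OF P True] by (simp add: has_bochner_integral_zero)
next
  case False
  then have pos: "0 < sqnorm P e" using sqnorm_nonneg[of P e] by linarith
  define s where "s = \<tau> * sqrt (sqnorm P e)"
  have s: "0 < s" using pos \<tau>_pos by (simp add: s_def)
  note D = linfun_distributed[OF P pos, folded s_def]
  have "has_bochner_integral lborel (\<lambda>x. normal_density 0 s x * (x - 0) ^ (2 * 2)) (fact (2 * 2) / ((2 / s\<^sup>2) ^ 2 * fact 2))"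
    by (rule normal_moment_even[OF s])
  moreover have "fact (2 * 2) / ((2 / s\<^sup>2) ^ 2 * fact 2) = 3 * s ^ 4"
    using s by (simp add: fact_numeral power_divide)
  ultimately have B: "has_bochner_integral lborel (\<lambda>x. normal_density 0 s x * x ^ 4) (3 * s ^ 4)"
    by simp
  have "integrable (PiM P (\<lambda>_. G)) (\<lambda>a. (linfun P e a) ^ 4)"
    using distributed_integrable[OF D, of "\<lambda>x. x ^ 4"] integrable.intros[OF B] by simp
  moreover have "(\<integral>a. (linfun P e a) ^ 4 \<partial>PiM P (\<lambda>_. G)) = 3 * s ^ 4"
    using distributed_integral[OF D, of "\<lambda>x. x ^ 4"] has_bochner_integral_integral_eq[OF B] by simp
  moreover have "s ^ 4 = \<tau> ^ 4 * (sqnorm P e)\<^sup>2"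
  proof -
    have "sqrt (sqnorm P e) ^ 4 = (sqrt (sqnorm P e) ^ 2) ^ 2" by simp
    then show ?thesis using pos by (simp add: s_def power_mult_distrib)
  qed
  ultimately show ?thesis by (simp add: has_bochner_integral_iff)
qed

text \<open>Wick's formula by polarisation: 12 x^2 y^2 = (x + y)^4 + (x - y)^4 - 2 x^4 - 2 y^4
  reduces it to fourth moments of single functionals, without joint laws.\<close>

lemma linfun_square_moment:
  assumes P: "finite P"
  shows "has_bochner_integral (PiM P (\<lambda>_. G)) (\<lambda>a. (linfun P e a)\<^sup>2 * (linfun P f a)\<^sup>2)
    (\<tau> ^ 4 * (sqnorm P e * sqnorm P f + 2 * (\<Sum>p\<in>P. e p \<bullet> f p)\<^sup>2))"
proof -
  let ?p = "\<lambda>p. e p + f p" and ?m = "\<lambda>p. e p - f p"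
  define d where "d = (\<Sum>p\<in>P. e p \<bullet> f p)"
  have "has_bochner_integral (PiM P (\<lambda>_. G))
      (\<lambda>a. ((linfun P ?p a) ^ 4 + (linfun P ?m a) ^ 4 - (2 * (linfun P e a) ^ 4 + 2 * (linfun P f a) ^ 4)) * (1 / 12))
      ((3 * \<tau> ^ 4 * (sqnorm P ?p)\<^sup>2 + 3 * \<tau> ^ 4 * (sqnorm P ?m)\<^sup>2
        - (2 * (3 * \<tau> ^ 4 * (sqnorm P e)\<^sup>2) + 2 * (3 * \<tau> ^ 4 * (sqnorm P f)\<^sup>2))) * (1 / 12))"
    by (intro has_bochner_integral_mult_left has_bochner_integral_diff has_bochner_integral_add
        has_bochner_integral_mult_right linfun_fourth_moment P)
  also have "(\<lambda>a. ((linfun P ?p a) ^ 4 + (linfun P ?m a) ^ 4 - (2 * (linfun P e a) ^ 4 + 2 * (linfun P f a) ^ 4)) * (1 / 12)) =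
      (\<lambda>a. (linfun P e a)\<^sup>2 * (linfun P f a)\<^sup>2)"
    unfolding linfun_add linfun_diff by (intro ext) (simp add: power4_eq_xxxx power2_eq_square algebra_simps)
  also have "(3 * \<tau> ^ 4 * (sqnorm P ?p)\<^sup>2 + 3 * \<tau> ^ 4 * (sqnorm P ?m)\<^sup>2
        - (2 * (3 * \<tau> ^ 4 * (sqnorm P e)\<^sup>2) + 2 * (3 * \<tau> ^ 4 * (sqnorm P f)\<^sup>2))) * (1 / 12) =
      \<tau> ^ 4 * (sqnorm P e * sqnorm P f + 2 * d\<^sup>2)"
    unfolding sqnorm_add sqnorm_diff d_def[symmetric] by (simp add: power2_eq_square algebra_simps)
  finally show ?thesis by (simp add: d_def)
qed

text \<open>Multiplying the normal density of deviation s by the exponential gives at most sqrt 2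
  times the normal density of deviation sqrt 2 * s.\<close>

lemma linfun_exp_moment:
  assumes P: "finite P" and \<theta>: "4 * \<theta> * \<tau>\<^sup>2 * sqnorm P e \<le> 1"
  shows "(\<integral>\<^sup>+ a. ennreal (exp (\<theta> * (linfun P e a)\<^sup>2)) \<partial>PiM P (\<lambda>_. G)) \<le> ennreal 2"
proof (cases "sqnorm P e = 0")
  case True
  interpret prob_space "PiM P (\<lambda>_. G)" by (rule prob_space_P)
  show ?thesis using linfun_zero[OF P True] by (simp add: emeasure_space_1)
next
  case False
  then have pos: "0 < sqnorm P e" using sqnorm_nonneg[of P e] by linarith
  define s where "s = \<tau> * sqrt (sqnorm P e)"
  have s: "0 < s" using pos \<tau>_pos by (simp add: s_def)
  have s2: "4 * \<theta> * s\<^sup>2 \<le> 1" using \<theta> pos by (simp add: s_def power_mult_distrib)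
  note D = linfun_distributed[OF P pos, folded s_def]
  have pw: "normal_density 0 s x * exp (\<theta> * x\<^sup>2) \<le> sqrt 2 * normal_density 0 (sqrt 2 * s) x" for x
  proof -
    have th: "\<theta> \<le> 1 / (4 * s\<^sup>2)" using s2 s by (simp add: field_simps)
    have "\<theta> * x\<^sup>2 \<le> 1 / (4 * s\<^sup>2) * x\<^sup>2" by (rule mult_right_mono[OF th]) simp
    then have "- x\<^sup>2 / (2 * s\<^sup>2) + \<theta> * x\<^sup>2 \<le> - x\<^sup>2 / (2 * s\<^sup>2) + 1 / (4 * s\<^sup>2) * x\<^sup>2" by simp
    also have "\<dots> = - x\<^sup>2 / (2 * (sqrt 2 * s)\<^sup>2)" using s by (simp add: power_mult_distrib field_simps)
    finally have e: "exp (- x\<^sup>2 / (2 * s\<^sup>2)) * exp (\<theta> * x\<^sup>2) \<le> exp (- x\<^sup>2 / (2 * (sqrt 2 * s)\<^sup>2))"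
      by (simp add: mult_exp_exp)
    have c: "sqrt 2 * (1 / sqrt (2 * pi * (sqrt 2 * s)\<^sup>2)) = 1 / sqrt (2 * pi * s\<^sup>2)"
      using s by (simp add: real_sqrt_mult power_mult_distrib field_simps)
    have "normal_density 0 s x * exp (\<theta> * x\<^sup>2) = 1 / sqrt (2 * pi * s\<^sup>2) * (exp (- x\<^sup>2 / (2 * s\<^sup>2)) * exp (\<theta> * x\<^sup>2))"
      by (simp add: normal_density_def)
    also have "\<dots> \<le> 1 / sqrt (2 * pi * s\<^sup>2) * exp (- x\<^sup>2 / (2 * (sqrt 2 * s)\<^sup>2))"
      by (rule mult_left_mono[OF e]) simp
    also have "\<dots> = sqrt 2 * normal_density 0 (sqrt 2 * s) x"
      unfolding c[symmetric] by (simp add: normal_density_def)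
    finally show ?thesis .
  qed
  interpret N: prob_space "density lborel (normal_density 0 (sqrt 2 * s))"
    using s by (intro prob_space_normal_density) auto
  have N1: "(\<integral>\<^sup>+ x. ennreal (normal_density 0 (sqrt 2 * s) x) \<partial>lborel) = 1"
    using N.emeasure_space_1 by (simp add: emeasure_density)
  have "(\<integral>\<^sup>+ a. ennreal (exp (\<theta> * (linfun P e a)\<^sup>2)) \<partial>PiM P (\<lambda>_. G)) =
      (\<integral>\<^sup>+ x. ennreal (normal_density 0 s x) * ennreal (exp (\<theta> * x\<^sup>2)) \<partial>lborel)"
    by (rule distributed_nn_integral[OF D, symmetric]) auto
  also have "\<dots> \<le> (\<integral>\<^sup>+ x. ennreal (sqrt 2) * ennreal (normal_density 0 (sqrt 2 * s) x) \<partial>lborel)"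
    by (intro nn_integral_mono) (simp add: ennreal_mult'[symmetric] ennreal_leI pw)
  also have "\<dots> = ennreal (sqrt 2)" by (subst nn_integral_cmult) (auto simp: N1)
  also have "\<dots> \<le> ennreal 2" by (intro ennreal_leI real_le_lsqrt) auto
  finally show ?thesis .
qed

text \<open>After standardising by d \<ge> 1/3 the level is at most r = 3 s. The density is bounded
  below on two unit intervals beyond r and -r, where x^2 / 2 is at most r^2 + 1.\<close>

lemma linfun_tail:
  assumes P: "finite P" and e: "1/3 \<le> \<tau> * sqrt (sqnorm P e)" and s: "0 \<le> s"
  shows "exp (- (3 * s)\<^sup>2 - 2) \<le> measure (PiM P (\<lambda>_. G)) {a \<in> space (PiM P (\<lambda>_. G)). s \<le> \<bar>linfun P e a\<bar>}"
proof -
  let ?M = "PiM P (\<lambda>_. G)"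
  interpret prob_space ?M by (rule prob_space_P)
  define d where "d = \<tau> * sqrt (sqnorm P e)"
  have d: "1/3 \<le> d" "0 < d" using e by (auto simp: d_def)
  have "sqnorm P e \<noteq> 0" using e by auto
  then have pos: "0 < sqnorm P e" using sqnorm_nonneg[of P e] by linarith
  have D: "distributed ?M lborel (\<lambda>a. linfun P e a / d) std_normal_density"
    using linfun_distributed[OF P pos, folded d_def] normal_standard_normal_convert[OF d(2), of "linfun P e" 0] by simp
  define r where "r = 3 * s"
  have r: "0 \<le> r" using s by (simp add: r_def)
  \<comment> \<open>The half-open interval keeps the two pieces disjoint also for
    \<open>r = 0\<close>.\<close>
  define J where "J = {r..r + 1} \<union> {- (r + 1)..<- r}"
  have J: "J \<in> sets lborel" by (simp add: J_def)
  have eJ: "emeasure lborel J = ennreal 2"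
  proof -
    have "emeasure lborel J = emeasure lborel {r..r + 1} + emeasure lborel {- (r + 1)..<- r}"
      unfolding J_def using r by (intro plus_emeasure[symmetric]) auto
    then show ?thesis using r by (simp flip: ennreal_plus)
  qed
  have dens: "exp (- r\<^sup>2 - 2) / 2 \<le> std_normal_density x" if "x \<in> J" for x
  proof -
    have "\<bar>x\<bar> \<le> r + 1" using that r by (auto simp: J_def)
    then have "\<bar>x\<bar>\<^sup>2 \<le> (r + 1)\<^sup>2" by (intro power_mono) auto
    also have "\<dots> \<le> 2 * (r\<^sup>2 + 1)" using zero_le_power2[of "r - 1"] by (simp add: power2_eq_square algebra_simps)
    finally have x2: "- r\<^sup>2 - 1 \<le> - (x\<^sup>2 / 2)" by simp
    have "2 * pi \<le> (2 * exp 1)\<^sup>2"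
    proof -
      have "(2 * 2)\<^sup>2 \<le> (2 * exp 1 :: real)\<^sup>2" using exp_ge_add_one_self[of 1] by (intro power_mono) auto
      then show ?thesis using pi_half_less_two by simp
    qed
    then have "sqrt (2 * pi) \<le> 2 * exp 1" by (intro real_le_lsqrt) auto
    then have c: "1 / (2 * exp 1) \<le> 1 / sqrt (2 * pi)" by (intro divide_left_mono) auto
    have "exp (- r\<^sup>2 - 2) / 2 = 1 / (2 * exp 1) * exp (- r\<^sup>2 - 1)"
      by (simp add: exp_diff field_simps flip: exp_add)
    also have "\<dots> \<le> 1 / sqrt (2 * pi) * exp (- (x\<^sup>2 / 2))"
      using c x2 by (intro mult_mono) auto
    finally show ?thesis by (simp add: std_normal_density_def)
  qed
  have [measurable]: "linfun P e \<in> borel_measurable ?M" by (rule linfun_measurable)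
  have "ennreal (exp (- r\<^sup>2 - 2)) = ennreal (exp (- r\<^sup>2 - 2) / 2) * emeasure lborel J"
    unfolding eJ by (subst ennreal_mult'[symmetric]) auto
  also have "\<dots> = (\<integral>\<^sup>+ x. ennreal (exp (- r\<^sup>2 - 2) / 2) * indicator J x \<partial>lborel)"
    using J by (simp add: nn_integral_cmult_indicator)
  also have "\<dots> \<le> (\<integral>\<^sup>+ x. ennreal (std_normal_density x) * indicator J x \<partial>lborel)"
    using dens by (intro nn_integral_mono) (auto split: split_indicator intro!: ennreal_leI)
  also have "\<dots> = emeasure ?M ((\<lambda>a. linfun P e a / d) -` J \<inter> space ?M)"
    by (rule distributed_emeasure[OF D J, symmetric])
  also have "\<dots> \<le> emeasure ?M {a \<in> space ?M. s \<le> \<bar>linfun P e a\<bar>}"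
  proof (rule emeasure_mono)
    show "(\<lambda>a. linfun P e a / d) -` J \<inter> space ?M \<subseteq> {a \<in> space ?M. s \<le> \<bar>linfun P e a\<bar>}"
    proof safe
      fix a assume "linfun P e a / d \<in> J"
      moreover have "r \<le> \<bar>x\<bar>" if "x \<in> J" for x using that r by (auto simp: J_def)
      ultimately have "r \<le> \<bar>linfun P e a / d\<bar>" by blast
      then have "r * d \<le> \<bar>linfun P e a\<bar>" using d by (simp add: field_simps)
      moreover have "s \<le> r * d" using mult_left_mono[OF d(1), of r] r by (simp add: r_def)
      ultimately show "s \<le> \<bar>linfun P e a\<bar>" by simp
    qed
  qed measurable
  finally show ?thesis by (simp add: emeasure_eq_measure r_def)
qed

end

section \<open>The real law\<close>

lemma real_gauss_isotropic: "isotropic_normal real_gauss 1"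
proof (rule isotropic_normal.intro)
  show "prob_space real_gauss" unfolding real_gauss_def by (rule prob_space_normal_density) simp
  then interpret prob_space real_gauss .
  show "sets real_gauss = sets borel" by (simp add: real_gauss_def)
  have D: "distributed real_gauss lborel (\<lambda>x. x) (normal_density 0 1)"
    unfolding distributed_def real_gauss_def by (simp add: distr_id2)
  show "distributed real_gauss lborel (\<lambda>z. z \<bullet> e) (normal_density 0 (1 * norm e))" if "e \<noteq> 0" for e :: real
    using normal_density_affine[OF D _ that, of 0] by (simp add: mult.commute)
qed simp

lemma real_gaussian_field: "gaussian_field real_gauss 0"
proof -
  interpret R: isotropic_normal real_gauss 1 by (rule real_gauss_isotropic)
  have lin: "(\<Sum>p\<in>P. a p * h p) = linfun P h a" for P :: "(nat \<times> nat) set" and a h :: "nat \<times> nat \<Rightarrow> real"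
    by (simp add: linfun_def)
  show "gaussian_field real_gauss 0"
  proof (rule gaussian_field.intro)
    show "prob_space real_gauss" "sets real_gauss = sets borel" by (rule R.G_prob R.G_sets)+
    show "\<exists>c::real. norm c = 1 \<and> (\<Sum>j<n. x j \<bullet> (0 * (c * y j))) = 0 \<and> 0 \<le> (\<Sum>j<n. x j \<bullet> (c * y j))"
      for n and x y :: "nat \<Rightarrow> real"
      by (rule exI[of _ "if 0 \<le> (\<Sum>j<n. x j * y j) then 1 else -1"]) (auto simp: sum_negf)
    fix P :: "(nat \<times> nat) set" and h g :: "nat \<times> nat \<Rightarrow> real" and s :: real assume P: "finite P"
    show "(\<integral>\<^sup>+ a. ennreal (exp ((norm (\<Sum>p\<in>P. a p * h p))\<^sup>2 / 4)) \<partial>PiM P (\<lambda>_. real_gauss)) \<le> ennreal 2"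
      if "(\<Sum>p\<in>P. (norm (h p))\<^sup>2) \<le> 1"
      using R.linfun_exp_moment[OF P, of "1/4" h] that unfolding lin by (simp add: sqnorm_def)
    \<comment> \<open>With \<iota> = 0 there is no degenerate direction, and this value is at least
      twice what is required.\<close>
    have "(\<integral>a. ((\<Sum>p\<in>P. a p * h p) \<bullet> (\<Sum>p\<in>P. a p * g p))\<^sup>2 \<partial>PiM P (\<lambda>_. real_gauss)) =
        sqnorm P h * sqnorm P g + 2 * (\<Sum>p\<in>P. h p \<bullet> g p)\<^sup>2"
      using has_bochner_integral_integral_eq[OF R.linfun_square_moment[OF P, of h g]]
      unfolding lin by (simp add: power_mult_distrib)
    moreover have "0 \<le> sqnorm P h * sqnorm P g" by (simp add: sqnorm_nonneg)
    ultimately show "((\<Sum>p\<in>P. (norm (h p))\<^sup>2) * (\<Sum>p\<in>P. (norm (g p))\<^sup>2) - (\<Sum>p\<in>P. h p \<bullet> (0 * g p))\<^sup>2) / 2 \<le>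
        (\<integral>a. ((\<Sum>p\<in>P. a p * h p) \<bullet> (\<Sum>p\<in>P. a p * g p))\<^sup>2 \<partial>PiM P (\<lambda>_. real_gauss))"
      unfolding sqnorm_def[symmetric] by (simp add: sqnorm_nonneg add_nonneg_nonneg)
    show "exp (- (3 * s)\<^sup>2 - 2) \<le> measure (PiM P (\<lambda>_. real_gauss)) {a \<in> space (PiM P (\<lambda>_. real_gauss)). s \<le> \<bar>\<Sum>p\<in>P. a p \<bullet> h p\<bar>}"
      if "1/4 \<le> (\<Sum>p\<in>P. (norm (h p))\<^sup>2)" "0 \<le> s"
    proof -
      have "1/3 \<le> 1 * sqrt (sqnorm P h)"
        unfolding mult_1 using that(1) by (intro real_le_rsqrt) (simp add: sqnorm_def power_divide)
      from R.linfun_tail[OF P this that(2)] show ?thesis by (simp add: linfun_def)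
    qed
  qed auto
qed

section \<open>The complex law\<close>

lemma (in pair_prob_space) distr_pair_snd: "distr (M1 \<Otimes>\<^sub>M M2) M2 snd = M2"
proof (intro measure_eqI)
  fix A assume A: "A \<in> sets (distr (M1 \<Otimes>\<^sub>M M2) M2 snd)"
  then have "emeasure (distr (M1 \<Otimes>\<^sub>M M2) M2 snd) A = emeasure (M1 \<Otimes>\<^sub>M M2) (space M1 \<times> A)"
    by (auto simp add: emeasure_distr space_pair_measure dest: sets.sets_into_space intro!: arg_cong2[where f=emeasure])
  with A show "emeasure (distr (M1 \<Otimes>\<^sub>M M2) M2 snd) A = emeasure M2 A"
    by (simp add: M2.emeasure_pair_measure_Times M1.emeasure_space_1)
qed simp

text \<open>The cases with one zero coefficient are separate because a normal density needs positive
  deviation.\<close>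

lemma (in prob_space) normal_linear_combination:
  assumes ind: "indep_var borel X borel Y" and s: "0 < s"
    and X: "distributed M lborel X (normal_density 0 s)" and Y: "distributed M lborel Y (normal_density 0 s)"
    and ab: "a \<noteq> 0 \<or> b \<noteq> 0"
  shows "distributed M lborel (\<lambda>x. a * X x + b * Y x) (normal_density 0 (s * sqrt (a\<^sup>2 + b\<^sup>2)))"
proof -
  have aX: "distributed M lborel (\<lambda>x. a * X x) (normal_density 0 (\<bar>a\<bar> * s))" if "a \<noteq> 0"
    using normal_density_affine[OF X s that, of 0] by simp
  have bY: "distributed M lborel (\<lambda>x. b * Y x) (normal_density 0 (\<bar>b\<bar> * s))" if "b \<noteq> 0"
    using normal_density_affine[OF Y s that, of 0] by simp
  consider "b = 0" "a \<noteq> 0" | "a = 0" "b \<noteq> 0" | "a \<noteq> 0" "b \<noteq> 0" using ab by blast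
  then show ?thesis
  proof cases
    case 1 then show ?thesis using aX by (simp add: mult.commute)
  next
    case 2 then show ?thesis using bY by (simp add: mult.commute)
  next
    case 3
    have "indep_var borel ((\<lambda>x. a * x) \<circ> X) borel ((\<lambda>x. b * x) \<circ> Y)"
      by (rule indep_var_compose[OF ind]) auto
    then have "distributed M lborel (\<lambda>x. a * X x + b * Y x) (normal_density (0 + 0) (sqrt ((\<bar>a\<bar> * s)\<^sup>2 + (\<bar>b\<bar> * s)\<^sup>2)))"
      using 3 s aX bY by (intro add_indep_normal) (auto simp: comp_def)
    moreover have "sqrt ((\<bar>a\<bar> * s)\<^sup>2 + (\<bar>b\<bar> * s)\<^sup>2) = s * sqrt (a\<^sup>2 + b\<^sup>2)"
      using s by (simp add: power_mult_distrib real_sqrt_mult flip: distrib_right)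
    ultimately show ?thesis by simp
  qed
qed

lemma complex_gauss_isotropic: "isotropic_normal complex_gauss (sqrt (1/2))"
proof (rule isotropic_normal.intro)
  define D where "D = density lborel (normal_density 0 (sqrt (1/2)))"
  have Dp: "prob_space D" unfolding D_def by (rule prob_space_normal_density) simp
  have Ds[measurable_cong]: "sets D = sets borel" by (simp add: D_def)
  interpret D: prob_space D by (rule Dp)
  interpret DD: pair_prob_space D D ..
  have meas: "(\<lambda>(a, b). Complex a b) \<in> borel_measurable (D \<Otimes>\<^sub>M D)"
  proof -
    have "(\<lambda>p. complex_of_real (fst p) + \<i> * complex_of_real (snd p)) \<in> borel_measurable (D \<Otimes>\<^sub>M D)"
      by measurable
    then show ?thesis by (simp add: case_prod_beta complex_eq_iff Complex_eq cong: measurable_cong)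
  qed
  have cg: "complex_gauss = distr (D \<Otimes>\<^sub>M D) borel (\<lambda>(a, b). Complex a b)"
    by (simp add: complex_gauss_def D_def)
  show "prob_space complex_gauss" unfolding cg by (rule DD.prob_space_distr[OF meas])
  show "sets complex_gauss = sets borel" by (simp add: cg)
  have d1: "distr (D \<Otimes>\<^sub>M D) borel fst = D"
    using D.distr_pair_fst[of D] by (subst (asm) distr_cong[OF refl Ds refl]) auto
  have d2: "distr (D \<Otimes>\<^sub>M D) borel snd = D"
    using DD.distr_pair_snd by (subst (asm) distr_cong[OF refl Ds refl]) auto
  have N1: "distributed (D \<Otimes>\<^sub>M D) lborel fst (normal_density 0 (sqrt (1/2)))"
    unfolding distributed_def
  proof (intro conjI)
    have "distr (D \<Otimes>\<^sub>M D) lborel fst = distr (D \<Otimes>\<^sub>M D) borel fst" by (rule distr_cong) auto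
    also have "\<dots> = D" by (rule d1)
    finally show "distr (D \<Otimes>\<^sub>M D) lborel fst = density lborel (normal_density 0 (sqrt (1/2)))"
      by (simp only: D_def[symmetric])
  qed auto
  have N2: "distributed (D \<Otimes>\<^sub>M D) lborel snd (normal_density 0 (sqrt (1/2)))"
    unfolding distributed_def
  proof (intro conjI)
    have "distr (D \<Otimes>\<^sub>M D) lborel snd = distr (D \<Otimes>\<^sub>M D) borel snd" by (rule distr_cong) auto
    also have "\<dots> = D" by (rule d2)
    finally show "distr (D \<Otimes>\<^sub>M D) lborel snd = density lborel (normal_density 0 (sqrt (1/2)))"
      by (simp only: D_def[symmetric])
  qed auto
  have ind: "DD.indep_var borel fst borel snd"
    unfolding DD.indep_var_distribution_eq d1 d2
  proof (intro conjI)
    have "distr (D \<Otimes>\<^sub>M D) (borel \<Otimes>\<^sub>M borel) (\<lambda>x. (fst x, snd x)) = distr (D \<Otimes>\<^sub>M D) (D \<Otimes>\<^sub>M D) (\<lambda>x. x)"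
      by (intro distr_cong refl sets_pair_measure_cong) (auto simp: Ds)
    then show "D \<Otimes>\<^sub>M D = distr (D \<Otimes>\<^sub>M D) (borel \<Otimes>\<^sub>M borel) (\<lambda>x. (fst x, snd x))" by simp
  qed auto
  show "distributed complex_gauss lborel (\<lambda>z. z \<bullet> e) (normal_density 0 (sqrt (1/2) * norm e))"
    if e: "e \<noteq> 0" for e :: complex
  proof -
    have "Re e \<noteq> 0 \<or> Im e \<noteq> 0" using e by (simp add: complex_eq_iff)
    then have L: "distributed (D \<Otimes>\<^sub>M D) lborel (\<lambda>p. Re e * fst p + Im e * snd p) (normal_density 0 (sqrt (1/2) * norm e))"
      using DD.normal_linear_combination[OF ind _ N1 N2, of "Re e" "Im e"] by (simp add: norm_complex_def)
    have "distr complex_gauss lborel (\<lambda>z. z \<bullet> e) = distr (D \<Otimes>\<^sub>M D) lborel (\<lambda>p. Re e * fst p + Im e * snd p)"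
      unfolding cg using meas
      by (subst distr_distr) (auto simp: comp_def inner_complex_def case_prod_beta mult.commute)
    then show ?thesis using L unfolding distributed_def by (simp add: cg)
  qed
qed simp

lemma complex_gaussian_field: "gaussian_field complex_gauss \<i>"
proof -
  interpret R: isotropic_normal complex_gauss "sqrt (1/2)" by (rule complex_gauss_isotropic)
  have tau4: "sqrt (1/2) ^ 4 = (1/4 :: real)"
  proof -
    have "sqrt (1/2) ^ 4 = ((sqrt (1/2))\<^sup>2)\<^sup>2" by (simp only: power_mult[symmetric]) simp
    then show ?thesis by (simp add: power2_eq_square)
  qed
  \<comment> \<open>Real and imaginary part of a complex combination are real functionals of the
    entries, with coefficients \<open>cnj h\<close> and \<open>\<i> * cnj h\<close> of equal
    norm.\<close>
  let ?e1 = "\<lambda>h p. cnj (h p)" and ?e2 = "\<lambda>h p. \<i> * cnj (h p)"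
  have Re: "Re (\<Sum>p\<in>P. a p * h p) = linfun P (?e1 h) a" and Im: "Im (\<Sum>p\<in>P. a p * h p) = linfun P (?e2 h) a"
    for P :: "(nat \<times> nat) set" and a h :: "nat \<times> nat \<Rightarrow> complex"
    by (simp_all add: linfun_def inner_complex_def)
  have sq: "sqnorm P (?e1 h) = sqnorm P h" "sqnorm P (?e2 h) = sqnorm P h"
    for P :: "(nat \<times> nat) set" and h :: "nat \<times> nat \<Rightarrow> complex"
    by (simp_all add: sqnorm_def norm_mult)
  show "gaussian_field complex_gauss \<i>"
  proof (rule gaussian_field.intro)
    show "prob_space complex_gauss" "sets complex_gauss = sets borel" by (rule R.G_prob R.G_sets)+
    show "DIM(complex) \<le> 2" by simp
    show "norm \<i> \<le> 1" by simp
    show "v \<bullet> (\<i> * w) = - (w \<bullet> (\<i> * v))" for v w :: complex by (simp add: inner_complex_def)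
    show "\<exists>c::complex. norm c = 1 \<and> (\<Sum>j<n. x j \<bullet> (\<i> * (c * y j))) = 0 \<and> 0 \<le> (\<Sum>j<n. x j \<bullet> (c * y j))"
      for n and x y :: "nat \<Rightarrow> complex"
    proof -
      \<comment> \<open>Dividing out the phase of the Hermitian product makes it real and
        nonnegative, which settles both alignment conditions at once.\<close>
      define w where "w = (\<Sum>j<n. x j * cnj (y j))"
      define c where "c = (if w = 0 then 1 else w / norm w)"
      have c1: "norm c = 1" by (simp add: c_def norm_divide)
      have "w * cnj w = complex_of_real (cmod w) * complex_of_real (cmod w)"
        by (simp add: complex_norm_square[symmetric] power2_eq_square)
      then have cw: "cnj c * w = norm w" by (simp add: c_def mult.commute)
      have cwR: "Re (cnj c * w) = norm w" and cwI: "Im (cnj c * w) = 0" unfolding cw by simp_all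
      have "(\<Sum>j<n. x j \<bullet> (c * y j)) = Re (cnj c * w)"
        unfolding w_def sum_distrib_left Re_sum by (intro sum.cong refl) (simp add: inner_complex_def algebra_simps)
      moreover have "(\<Sum>j<n. x j \<bullet> (\<i> * (c * y j))) = Im (cnj c * w)"
        unfolding w_def sum_distrib_left Im_sum by (intro sum.cong refl) (simp add: inner_complex_def algebra_simps)
      ultimately show ?thesis using c1 cwR cwI by (intro exI[of _ c]) simp
    qed
    fix P :: "(nat \<times> nat) set" and h g :: "nat \<times> nat \<Rightarrow> complex" and s :: real assume P: "finite P"
    let ?M = "PiM P (\<lambda>_. complex_gauss)"
    show "(\<integral>\<^sup>+ a. ennreal (exp ((norm (\<Sum>p\<in>P. a p * h p))\<^sup>2 / 4)) \<partial>?M) \<le> ennreal 2"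
      if h: "(\<Sum>p\<in>P. (norm (h p))\<^sup>2) \<le> 1"
    proof -
      have [measurable]: "linfun P (?e1 h) \<in> borel_measurable ?M" "linfun P (?e2 h) \<in> borel_measurable ?M"
        by (rule R.linfun_measurable)+
      have mom: "(\<integral>\<^sup>+ a. ennreal (exp (1/2 * (linfun P (?e1 h) a)\<^sup>2)) \<partial>?M) \<le> ennreal 2"
        "(\<integral>\<^sup>+ a. ennreal (exp (1/2 * (linfun P (?e2 h) a)\<^sup>2)) \<partial>?M) \<le> ennreal 2"
        by (rule R.linfun_exp_moment[OF P]; use h in \<open>simp only: sq; simp add: sqnorm_def\<close>)+
      \<comment> \<open>The arithmetic-geometric mean inequality replaces independence of the two
        parts, at the price of doubling the exponents.\<close>
      have pw: "exp ((norm (\<Sum>p\<in>P. a p * h p))\<^sup>2 / 4) \<le>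
          1/2 * exp (1/2 * (linfun P (?e1 h) a)\<^sup>2) + 1/2 * exp (1/2 * (linfun P (?e2 h) a)\<^sup>2)" for a
      proof -
        define u v where "u = exp ((linfun P (?e1 h) a)\<^sup>2 / 4)" and "v = exp ((linfun P (?e2 h) a)\<^sup>2 / 4)"
        have "exp ((norm (\<Sum>p\<in>P. a p * h p))\<^sup>2 / 4) = u * v"
          unfolding cmod_power2 Re Im by (simp add: u_def v_def mult_exp_exp add_divide_distrib)
        also have "\<dots> \<le> 1/2 * u\<^sup>2 + 1/2 * v\<^sup>2"
          using zero_le_power2[of "u - v"] by (simp add: power2_eq_square algebra_simps)
        finally show ?thesis by (simp add: u_def v_def exp_double[symmetric] power2_eq_square mult_exp_exp)
      qed
      have "(\<integral>\<^sup>+ a. ennreal (exp ((norm (\<Sum>p\<in>P. a p * h p))\<^sup>2 / 4)) \<partial>?M) \<le>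
          (\<integral>\<^sup>+ a. ennreal (1/2) * ennreal (exp (1/2 * (linfun P (?e1 h) a)\<^sup>2)) + ennreal (1/2) * ennreal (exp (1/2 * (linfun P (?e2 h) a)\<^sup>2)) \<partial>?M)"
      proof (rule nn_integral_mono)
        fix a
        have half: "ennreal (1/2 * x) = ennreal (1/2) * ennreal x" for x by (rule ennreal_mult') simp
        show "ennreal (exp ((norm (\<Sum>p\<in>P. a p * h p))\<^sup>2 / 4)) \<le>
            ennreal (1/2) * ennreal (exp (1/2 * (linfun P (?e1 h) a)\<^sup>2)) + ennreal (1/2) * ennreal (exp (1/2 * (linfun P (?e2 h) a)\<^sup>2))"
          unfolding half[symmetric] using ennreal_leI[OF pw[of a]] by (subst (asm) ennreal_plus) auto
      qed
      also have "\<dots> = ennreal (1/2) * (\<integral>\<^sup>+ a. ennreal (exp (1/2 * (linfun P (?e1 h) a)\<^sup>2)) \<partial>?M)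
          + ennreal (1/2) * (\<integral>\<^sup>+ a. ennreal (exp (1/2 * (linfun P (?e2 h) a)\<^sup>2)) \<partial>?M)"
        by (subst nn_integral_add) (auto simp: nn_integral_cmult)
      also have "\<dots> \<le> ennreal (1/2) * ennreal 2 + ennreal (1/2) * ennreal 2"
        by (intro add_mono mult_left_mono mom) auto
      also have "ennreal (1/2) * ennreal 2 = ennreal 1" by (subst ennreal_mult'[symmetric]) auto
      also have "ennreal 1 + ennreal 1 = ennreal 2" by (subst ennreal_plus[symmetric]) auto
      finally show ?thesis .
    qed
    show "((\<Sum>p\<in>P. (norm (h p))\<^sup>2) * (\<Sum>p\<in>P. (norm (g p))\<^sup>2) - (\<Sum>p\<in>P. h p \<bullet> (\<i> * g p))\<^sup>2) / 2 \<le>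
        (\<integral>a. ((\<Sum>p\<in>P. a p * h p) \<bullet> (\<Sum>p\<in>P. a p * g p))\<^sup>2 \<partial>?M)"
    proof -
      \<comment> \<open>Expanding the squared inner product directly would give products of four
        different functionals. Polarisation, X \<bullet> Y = (|X + Y|^2 - |X - Y|^2) / 4, leaves
        only products of two squares.\<close>
      define u v where "u = (\<lambda>p. h p + g p)" and "v = (\<lambda>p. h p - g p)"
      define U1 U2 V1 V2 where "U1 = linfun P (?e1 u)" and "U2 = linfun P (?e2 u)"
        and "V1 = linfun P (?e1 v)" and "V2 = linfun P (?e2 v)"
      define d where "d = (\<Sum>p\<in>P. h p \<bullet> g p)"
      define B where "B = (\<Sum>p\<in>P. h p \<bullet> (\<i> * g p))"
      let ?H = "sqnorm P h" and ?G = "sqnorm P g"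
      have su: "sqnorm P u = ?H + 2 * d + ?G" and sv: "sqnorm P v = ?H - 2 * d + ?G"
        unfolding u_def v_def sqnorm_add sqnorm_diff d_def by simp_all
      have uv: "(\<Sum>p\<in>P. ?e1 u p \<bullet> ?e1 v p) = ?H - ?G" "(\<Sum>p\<in>P. ?e2 u p \<bullet> ?e2 v p) = ?H - ?G"
        unfolding sqnorm_def sum_subtractf[symmetric] power2_norm_eq_inner
        by (intro sum.cong refl; simp add: u_def v_def inner_complex_def algebra_simps)+
      have uw: "(\<Sum>p\<in>P. ?e1 u p \<bullet> ?e2 v p) = 2 * B" "(\<Sum>p\<in>P. ?e2 u p \<bullet> ?e1 v p) = - (2 * B)"
        unfolding B_def sum_distrib_left sum_negf[symmetric]
        by (intro sum.cong refl; simp add: u_def v_def inner_complex_def algebra_simps)+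
      have u0: "(\<Sum>p\<in>P. ?e1 z p \<bullet> ?e2 z p) = 0" for z :: "nat \<times> nat \<Rightarrow> complex"
        by (intro sum.neutral) (simp add: inner_complex_def)
      have dd: "(\<Sum>p\<in>P. ?e1 z p \<bullet> ?e1 z p) = sqnorm P z" "(\<Sum>p\<in>P. ?e2 z p \<bullet> ?e2 z p) = sqnorm P z"
        for z :: "nat \<times> nat \<Rightarrow> complex"
        unfolding sqnorm_def power2_norm_eq_inner by (intro sum.cong refl; simp add: inner_complex_def)+
      note mom = R.linfun_square_moment[OF P, unfolded tau4]
      define a b where "a = sqnorm P u" and "b = sqnorm P v"
      have m: "has_bochner_integral ?M (\<lambda>x. (U1 x)\<^sup>2 * (U1 x)\<^sup>2) (1/4 * (a * a + 2 * a\<^sup>2))"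
        "has_bochner_integral ?M (\<lambda>x. (U2 x)\<^sup>2 * (U2 x)\<^sup>2) (1/4 * (a * a + 2 * a\<^sup>2))"
        "has_bochner_integral ?M (\<lambda>x. (V1 x)\<^sup>2 * (V1 x)\<^sup>2) (1/4 * (b * b + 2 * b\<^sup>2))"
        "has_bochner_integral ?M (\<lambda>x. (V2 x)\<^sup>2 * (V2 x)\<^sup>2) (1/4 * (b * b + 2 * b\<^sup>2))"
        "has_bochner_integral ?M (\<lambda>x. (U1 x)\<^sup>2 * (U2 x)\<^sup>2) (1/4 * (a * a + 2 * 0\<^sup>2))"
        "has_bochner_integral ?M (\<lambda>x. (V1 x)\<^sup>2 * (V2 x)\<^sup>2) (1/4 * (b * b + 2 * 0\<^sup>2))"
        "has_bochner_integral ?M (\<lambda>x. (U1 x)\<^sup>2 * (V1 x)\<^sup>2) (1/4 * (a * b + 2 * (?H - ?G)\<^sup>2))"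
        "has_bochner_integral ?M (\<lambda>x. (U2 x)\<^sup>2 * (V2 x)\<^sup>2) (1/4 * (a * b + 2 * (?H - ?G)\<^sup>2))"
        "has_bochner_integral ?M (\<lambda>x. (U1 x)\<^sup>2 * (V2 x)\<^sup>2) (1/4 * (a * b + 2 * (2 * B)\<^sup>2))"
        "has_bochner_integral ?M (\<lambda>x. (U2 x)\<^sup>2 * (V1 x)\<^sup>2) (1/4 * (a * b + 2 * (- (2 * B))\<^sup>2))"
        using mom[of "?e1 u" "?e1 u"] mom[of "?e2 u" "?e2 u"] mom[of "?e1 v" "?e1 v"] mom[of "?e2 v" "?e2 v"]
          mom[of "?e1 u" "?e2 u"] mom[of "?e1 v" "?e2 v"] mom[of "?e1 u" "?e1 v"] mom[of "?e2 u" "?e2 v"]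
          mom[of "?e1 u" "?e2 v"] mom[of "?e2 u" "?e1 v"]
        unfolding sq uv uw u0 dd a_def b_def U1_def U2_def V1_def V2_def by blast+
      let ?f = "\<lambda>x. ((U1 x)\<^sup>2 * (U1 x)\<^sup>2 + (U2 x)\<^sup>2 * (U2 x)\<^sup>2 + ((V1 x)\<^sup>2 * (V1 x)\<^sup>2 + (V2 x)\<^sup>2 * (V2 x)\<^sup>2)
          + 2 * ((U1 x)\<^sup>2 * (U2 x)\<^sup>2 + (V1 x)\<^sup>2 * (V2 x)\<^sup>2)
          - 2 * ((U1 x)\<^sup>2 * (V1 x)\<^sup>2 + (U2 x)\<^sup>2 * (V2 x)\<^sup>2 + ((U1 x)\<^sup>2 * (V2 x)\<^sup>2 + (U2 x)\<^sup>2 * (V1 x)\<^sup>2))) * (1/16)"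
      have I: "has_bochner_integral ?M ?f
        ((1/4 * (a * a + 2 * a\<^sup>2) + 1/4 * (a * a + 2 * a\<^sup>2) + (1/4 * (b * b + 2 * b\<^sup>2) + 1/4 * (b * b + 2 * b\<^sup>2))
          + 2 * (1/4 * (a * a + 2 * 0\<^sup>2) + 1/4 * (b * b + 2 * 0\<^sup>2))
          - 2 * (1/4 * (a * b + 2 * (?H - ?G)\<^sup>2) + 1/4 * (a * b + 2 * (?H - ?G)\<^sup>2)
            + (1/4 * (a * b + 2 * (2 * B)\<^sup>2) + 1/4 * (a * b + 2 * (- (2 * B))\<^sup>2)))) * (1/16))"
        by (intro has_bochner_integral_mult_left has_bochner_integral_diff has_bochner_integral_add
            has_bochner_integral_mult_right m)
      have "((\<Sum>p\<in>P. x p * h p) \<bullet> (\<Sum>p\<in>P. x p * g p))\<^sup>2 = ?f x" for x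
      proof -
        define X Y where "X = (\<Sum>p\<in>P. x p * h p)" and "Y = (\<Sum>p\<in>P. x p * g p)"
        have "(\<Sum>p\<in>P. x p * u p) = X + Y" "(\<Sum>p\<in>P. x p * v p) = X - Y"
          by (simp_all add: u_def v_def X_def Y_def algebra_simps sum.distrib sum_subtractf)
        then have UV: "U1 x = Re X + Re Y" "U2 x = Im X + Im Y" "V1 x = Re X - Re Y" "V2 x = Im X - Im Y"
          unfolding U1_def U2_def V1_def V2_def using Re[of x u P] Im[of x u P] Re[of x v P] Im[of x v P] by simp_all
        show ?thesis unfolding X_def[symmetric] Y_def[symmetric] inner_complex_def UV
          by (simp add: power2_eq_square algebra_simps)
      qed
      then have "(\<integral>x. ((\<Sum>p\<in>P. x p * h p) \<bullet> (\<Sum>p\<in>P. x p * g p))\<^sup>2 \<partial>?M) = (\<integral>x. ?f x \<partial>?M)"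
        by (intro Bochner_Integration.integral_cong refl)
      \<comment> \<open>The exact second moment; the claimed bound drops the nonnegative term in
        \<open>d\<close>.\<close>
      also have "\<dots> = (?H * ?G - B\<^sup>2) / 2 + 3 / 2 * d\<^sup>2"
        unfolding has_bochner_integral_integral_eq[OF I] a_def b_def su sv
        by (simp add: power2_eq_square field_simps)
      finally show ?thesis by (simp add: sqnorm_def B_def)
    qed
    show "exp (- (3 * s)\<^sup>2 - 2) \<le> measure ?M {a \<in> space ?M. s \<le> \<bar>\<Sum>p\<in>P. a p \<bullet> h p\<bar>}"
      if "1/4 \<le> (\<Sum>p\<in>P. (norm (h p))\<^sup>2)" "0 \<le> s"
    proof -
      have "1/3 \<le> sqrt (1/2 * sqnorm P h)"
        using that(1) by (intro real_le_rsqrt) (simp add: sqnorm_def power_divide)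
      then have "1/3 \<le> sqrt (1/2) * sqrt (sqnorm P h)" by (simp only: real_sqrt_mult)
      from R.linfun_tail[OF P this that(2)] show ?thesis by (simp add: linfun_def)
    qed
  qed
qed

section \<open>Both fields with common constants\<close>

lemma recovery_whp_mono: "recovery_whp G m n k x0 C p \<Longrightarrow> p' \<le> p \<Longrightarrow> recovery_whp G m n k x0 C p'"
  unfolding recovery_whp_def by (meson order_trans)

theorem theorem2p11:
  shows "\<exists>C c1 c2 c3 C'::real. C > 0 \<and> c1 > 0 \<and> c2 > 0 \<and> c3 > 0 \<and> C' > 0 \<and>
    (\<forall>m n k. \<forall>x0::nat \<Rightarrow> real.
       x0 \<in> vecs n \<and> 1 \<le> k \<and> k \<le> n \<and> C * real k * ln (exp 1 * real n / real k) \<le> real m \<longrightarrow>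
       recovery_whp real_gauss m n k x0 C'
         (1 - c3 * exp (- c2 * real m) - exp (- sqrt (real m * real n))
            - 2 * real m * exp (- (c1 * real m / ln (exp 1 * real n / real m))))) \<and>
    (\<forall>m n k. \<forall>x0::nat \<Rightarrow> complex.
       x0 \<in> vecs n \<and> 1 \<le> k \<and> k \<le> n \<and> C * real k * ln (exp 1 * real n / real k) \<le> real m \<longrightarrow>
       recovery_whp complex_gauss m n k x0 C'
         (1 - c3 * exp (- c2 * real m) - exp (- sqrt (real m * real n))
            - 2 * real m * exp (- (c1 * real m / ln (exp 1 * real n / real m)))))"
proof -
  \<comment> \<open>The two further subtracted terms are nonnegative whatever the sign of the
    logarithm, also when it is zero and the quotient is 0 by convention.\<close>
  have le: "1 - 5 * exp (- (1 / 3355443200) * real m) - exp (- sqrt (real m * real n))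
      - 2 * real m * exp (- (1 * real m / ln (exp 1 * real n / real m))) \<le> 1 - 5 * exp (- (m / 3355443200))" for m n
  proof -
    have "0 \<le> exp (- sqrt (real m * real n))" "0 \<le> 2 * real m * exp (- (1 * real m / ln (exp 1 * real n / real m)))"
      by simp_all
    moreover have "exp (- (1 / 3355443200) * real m) = exp (- (m / 3355443200))" by simp
    ultimately show ?thesis by linarith
  qed
  show ?thesis
    by (rule exI[of _ "10 ^ 57"], rule exI[of _ 1], rule exI[of _ "1 / 3355443200"], rule exI[of _ 5],
        rule exI[of _ "10 ^ 34"])
       (intro conjI allI impI; (elim conjE)?; (simp; fail)?;
        rule recovery_whp_mono[OF gaussian_field.recovery_gaussian[OF real_gaussian_field] le]
          recovery_whp_mono[OF gaussian_field.recovery_gaussian[OF complex_gaussian_field] le]; assumption)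
qed

end
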